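(* Let $A_n$ ($n=0,1,2,\ldots$) and $A$ be self-adjoint operators on a Hilbert space with spectral families $E_n(t)$ and $E(t)$, respectively, and let $A_n$ converge to $A$ in the strong resolvent sense. Let $f:\mathbb{R}\to\mathbb{R}$ be a bounded function that is continuous at every eigenvalue of $A$. Then the following statements hold: 1. If $f$ is Darboux--Stieltjes integrable with respect to $\rho(t)=\|E(t)\phi\|^2$, then $\lim_{n\to\infty}\langle\phi,f(A_n)\phi\rangle=\langle\phi,f(A)\phi\rangle$. 2. If $f$ is Darboux--Stieltjes integrable with respect to $\rho(t)=\langle\psi,E(t)\phi\rangle$, then $\lim_{n\to\infty}\langle\psi,f(A_n)\phi\rangle=\langle\psi,f(A)\phi\rangle$. 3. If $f$ is Darboux--Stieltjes integrable with respect to $E(t)$, then $f(A_n)$ converges strongly to $f(A)$.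
   Context: Strong resolvent convergence: $(A_n-z)^{-1}\to(A-z)^{-1}$ strongly for some nonreal $z$. The spectral family $E(t)$ of $A$ is taken right continuous (in the strong sense), $A=\int t\,dE(t)$ and $f(A)=\int_{\sigma(A)}f(t)\,dE(t)$. Functions $f$ are taken to be such that all the operators $f(A_n)$, $f(A)$ are defined (measurable with respect to the spectral families). Darboux--Stieltjes integrability on $[a,b]$ with respect to a non-decreasing $\rho$: for a partition $a=t_0<\dots<t_n=b$ put $M_k=\sup_{[t_{k-1},t_k]}f$, $m_k=\inf_{[t_{k-1},t_k]}f$, $\Delta\rho_k=\rho(t_k)-\rho(t_{k-1})$, $U=\sum_kM_k\Delta\rho_k$, $L=\sum_km_k\Delta\rho_k$; $f$ is integrable if $\inf U=\sup L$ over all partitions. For bounded $f$ on $\mathbb{R}$, integrability with respect to $\rho(t)=\|E(t)\phi\|^2$ means integrability on every compact interval. Integrability with respect to $\rho(t)=\langle\psi,E(t)\phi\rangle$ means integrability with respect to each of the four non-decreasing functions $\|E(t)\tfrac{\psi+\phi}{2}\|^2$, $\|E(t)\tfrac{\psi-\phi}{2}\|^2$, $\|E(t)\tfrac{\psi+i\phi}{2}\|^2$, $\|E(t)\tfrac{\psi-i\phi}{2}\|^2$ occurring in the polarization identity. Integrability with respect to $E(t)$ means integrability with respect to $\|E(t)\phi\|^2$ for all $\phi$ in the Hilbert space. *)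

theory Defs
  imports "HOL-Analysis.Analysis"
begin

section \<open>Complex Hilbert spaces\<close>

text \<open>The inner product is antilinear in the first and linear in the second argument.
  Positive definiteness follows from \<open>norm_eq_sqrt_cinner\<close> and the norm axioms; completeness is
  inherited from \<^class>\<open>banach\<close>.\<close>

class complex_hilbert_space = banach +
  fixes scaleC :: "complex \<Rightarrow> 'a \<Rightarrow> 'a"  (infixr "*\<^sub>C" 75)
    and cinner :: "'a \<Rightarrow> 'a \<Rightarrow> complex"
  assumes scaleC_add_right: "scaleC c (x + y) = scaleC c x + scaleC c y"
    and scaleC_add_left: "scaleC (c + d) x = scaleC c x + scaleC d x"
    and scaleC_scaleC: "scaleC c (scaleC d x) = scaleC (c * d) x"
    and scaleR_scaleC: "scaleR r x = scaleC (complex_of_real r) x"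
    and cinner_commute: "cinner x y = cnj (cinner y x)"
    and cinner_add_right: "cinner x (y + z) = cinner x y + cinner x z"
    and cinner_scaleC_right: "cinner x (scaleC c y) = c * cinner x y"
    and norm_eq_sqrt_cinner: "norm x = sqrt (Re (cinner x x))"

instantiation complex :: complex_hilbert_space
begin

definition scaleC_complex :: "complex \<Rightarrow> complex \<Rightarrow> complex"
  where "scaleC_complex c x = c * x"

definition cinner_complex :: "complex \<Rightarrow> complex \<Rightarrow> complex"
  where "cinner_complex x y = cnj x * y"

instance
  by standard
    (auto simp: scaleC_complex_def cinner_complex_def algebra_simps scaleR_conv_of_real
      cmod_def power2_eq_square)

end

section \<open>Unbounded operators\<close>

text \<open>The values of \<open>op_app\<close> outside \<open>op_dom\<close> are irrelevant, so operators are compared with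
  \<open>op_eq\<close> and not with equality.\<close>

datatype 'h operator = Operator (op_dom: "'h set") (op_app: "'h \<Rightarrow> 'h")

definition op_eq :: "'h operator \<Rightarrow> 'h operator \<Rightarrow> bool"
  where "op_eq A B \<longleftrightarrow> op_dom A = op_dom B \<and> (\<forall>\<phi>\<in>op_dom A. op_app A \<phi> = op_app B \<phi>)"

definition linear_operator :: "'h::complex_hilbert_space operator \<Rightarrow> bool"
  where "linear_operator A \<longleftrightarrow>
    0 \<in> op_dom A \<and>
    (\<forall>\<phi>\<in>op_dom A. \<forall>\<psi>\<in>op_dom A.
      \<phi> + \<psi> \<in> op_dom A \<and> op_app A (\<phi> + \<psi>) = op_app A \<phi> + op_app A \<psi>) \<and>
    (\<forall>\<phi>\<in>op_dom A. \<forall>c. c *\<^sub>C \<phi> \<in> op_dom A \<and> op_app A (c *\<^sub>C \<phi>) = c *\<^sub>C op_app A \<phi>)"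

text \<open>The description below is unique if the domain of \<open>A\<close> is dense.\<close>

definition adjoint_op :: "'h::complex_hilbert_space operator \<Rightarrow> 'h operator"
  where "adjoint_op A = Operator
    {\<psi>. \<exists>\<eta>. \<forall>\<phi>\<in>op_dom A. cinner \<psi> (op_app A \<phi>) = cinner \<eta> \<phi>}
    (\<lambda>\<psi>. THE \<eta>. \<forall>\<phi>\<in>op_dom A. cinner \<psi> (op_app A \<phi>) = cinner \<eta> \<phi>)"

definition self_adjoint :: "'h::complex_hilbert_space operator \<Rightarrow> bool"
  where "self_adjoint A \<longleftrightarrow>
    linear_operator A \<and> closure (op_dom A) = UNIV \<and> op_eq (adjoint_op A) A"

definition resolvent :: "'h::complex_hilbert_space operator \<Rightarrow> complex \<Rightarrow> 'h \<Rightarrow> 'h"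
  where "resolvent A z = inv_into (op_dom A) (\<lambda>\<phi>. op_app A \<phi> - z *\<^sub>C \<phi>)"

definition resolvent_set :: "'h::complex_hilbert_space operator \<Rightarrow> complex set"
  where "resolvent_set A =
    {z. bij_betw (\<lambda>\<phi>. op_app A \<phi> - z *\<^sub>C \<phi>) (op_dom A) UNIV \<and> bounded_linear (resolvent A z)}"

definition op_spectrum :: "'h::complex_hilbert_space operator \<Rightarrow> complex set"
  where "op_spectrum A = - resolvent_set A"

definition op_eigenvalue :: "'h::complex_hilbert_space operator \<Rightarrow> complex \<Rightarrow> bool"
  where "op_eigenvalue A z \<longleftrightarrow> (\<exists>\<phi>\<in>op_dom A. \<phi> \<noteq> 0 \<and> op_app A \<phi> = z *\<^sub>C \<phi>)"

definition strong_resolvent_convergence ::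
    "(nat \<Rightarrow> 'h::complex_hilbert_space operator) \<Rightarrow> 'h operator \<Rightarrow> bool"
  where "strong_resolvent_convergence An A \<longleftrightarrow>
    (\<exists>z. Im z \<noteq> 0 \<and> (\<forall>\<phi>. (\<lambda>n. resolvent (An n) z \<phi>) \<longlonglongrightarrow> resolvent A z \<phi>))"

section \<open>Spectral families and functional calculus\<close>

definition orthogonal_projection :: "('h::complex_hilbert_space \<Rightarrow> 'h) \<Rightarrow> bool"
  where "orthogonal_projection P \<longleftrightarrow>
    (\<forall>\<phi> \<psi>. P (\<phi> + \<psi>) = P \<phi> + P \<psi>) \<and> (\<forall>c \<phi>. P (c *\<^sub>C \<phi>) = c *\<^sub>C P \<phi>) \<and>
    (\<forall>\<phi>. P (P \<phi>) = P \<phi>) \<and> (\<forall>\<phi> \<psi>. cinner \<psi> (P \<phi>) = cinner (P \<psi>) \<phi>)"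

definition spectral_family :: "(real \<Rightarrow> 'h::complex_hilbert_space \<Rightarrow> 'h) \<Rightarrow> bool"
  where "spectral_family E \<longleftrightarrow>
    (\<forall>t. orthogonal_projection (E t)) \<and>
    (\<forall>s t \<phi>. E s (E t \<phi>) = E (min s t) \<phi>) \<and>
    (\<forall>t \<phi>. ((\<lambda>s. E s \<phi>) \<longlongrightarrow> E t \<phi>) (at_right t)) \<and>
    (\<forall>\<phi>. ((\<lambda>t. E t \<phi>) \<longlongrightarrow> 0) at_bot) \<and>
    (\<forall>\<phi>. ((\<lambda>t. E t \<phi>) \<longlongrightarrow> \<phi>) at_top)"

text \<open>The completed Lebesgue--Stieltjes measure of \<open>t \<mapsto> \<parallel>E(t)\<phi>\<parallel>\<^sup>2\<close>. The completion matters because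
  \<open>f\<close> need not be Borel measurable in order to be measurable with respect to \<open>E\<close>.\<close>

definition spectral_measure :: "(real \<Rightarrow> 'h::complex_hilbert_space \<Rightarrow> 'h) \<Rightarrow> 'h \<Rightarrow> real measure"
  where "spectral_measure E \<phi> = completion (interval_measure (\<lambda>t. (norm (E t \<phi>))\<^sup>2))"

definition spectral_measurable ::
    "(real \<Rightarrow> 'h::complex_hilbert_space \<Rightarrow> 'h) \<Rightarrow> (real \<Rightarrow> real) \<Rightarrow> bool"
  where "spectral_measurable E f \<longleftrightarrow> (\<forall>\<phi>. f \<in> borel_measurable (spectral_measure E \<phi>))"

text \<open>The integral of \<open>f\<close> with respect to \<open>t \<mapsto> \<langle>\<psi>, E(t)\<phi>\<rangle>\<close>, by the polarization identity
  \<open>\<langle>\<psi>, \<phi>\<rangle> = \<parallel>(\<psi>+\<phi>)/2\<parallel>\<^sup>2 - \<parallel>(\<psi>-\<phi>)/2\<parallel>\<^sup>2 + i\<parallel>(\<psi>-i\<phi>)/2\<parallel>\<^sup>2 - i\<parallel>(\<psi>+i\<phi>)/2\<parallel>\<^sup>2\<close>.\<close>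

definition spectral_form ::
    "(real \<Rightarrow> 'h::complex_hilbert_space \<Rightarrow> 'h) \<Rightarrow> (real \<Rightarrow> real) \<Rightarrow> 'h \<Rightarrow> 'h \<Rightarrow> complex"
  where "spectral_form E f \<psi> \<phi> =
    (let I = (\<lambda>\<xi>. complex_of_real (\<integral>t. f t \<partial>spectral_measure E \<xi>)) in
      I ((1/2) *\<^sub>C (\<psi> + \<phi>)) - I ((1/2) *\<^sub>C (\<psi> - \<phi>))
      + \<i> * I ((1/2) *\<^sub>C (\<psi> - \<i> *\<^sub>C \<phi>)) - \<i> * I ((1/2) *\<^sub>C (\<psi> + \<i> *\<^sub>C \<phi>)))"

definition spectral_integral_dom ::
    "(real \<Rightarrow> 'h::complex_hilbert_space \<Rightarrow> 'h) \<Rightarrow> (real \<Rightarrow> real) \<Rightarrow> 'h set"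
  where "spectral_integral_dom E f =
    {\<phi>. f \<in> borel_measurable (spectral_measure E \<phi>) \<and>
        integrable (spectral_measure E \<phi>) (\<lambda>t. (f t)\<^sup>2)}"

text \<open>The operator \<open>\<integral> f(t) dE(t)\<close>, with its natural domain, which is dense if \<open>f\<close> is measurable
  with respect to \<open>E\<close>. The test vectors \<open>\<psi>\<close> are taken from the domain because for unbounded \<open>f\<close>
  the four integrals in \<open>spectral_form\<close> need not exist separately otherwise.\<close>

definition spectral_integral ::
    "(real \<Rightarrow> 'h::complex_hilbert_space \<Rightarrow> 'h) \<Rightarrow> (real \<Rightarrow> real) \<Rightarrow> 'h operator"
  where "spectral_integral E f = Operator (spectral_integral_dom E f)
    (\<lambda>\<phi>. THE \<eta>. \<forall>\<psi>\<in>spectral_integral_dom E f. cinner \<psi> \<eta> = spectral_form E f \<psi> \<phi>)"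

definition spectral_family_of ::
    "(real \<Rightarrow> 'h::complex_hilbert_space \<Rightarrow> 'h) \<Rightarrow> 'h operator \<Rightarrow> bool"
  where "spectral_family_of E A \<longleftrightarrow> spectral_family E \<and> op_eq A (spectral_integral E (\<lambda>t. t))"

text \<open>\<open>f(A) = \<integral>\<^bsub>\<sigma>(A)\<^esub> f(t) dE(t)\<close>, where \<open>E\<close> is the spectral family of \<open>A\<close>. For bounded \<open>f\<close>
  the domain is the whole space.\<close>

definition fun_of_op ::
    "'h::complex_hilbert_space operator \<Rightarrow> (real \<Rightarrow> 'h \<Rightarrow> 'h) \<Rightarrow> (real \<Rightarrow> real) \<Rightarrow> 'h operator"
  where "fun_of_op A E f =
    spectral_integral E (\<lambda>t. indicator {s. complex_of_real s \<in> op_spectrum A} t * f t)"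

section \<open>Darboux--Stieltjes integrability\<close>

definition partitions :: "real \<Rightarrow> real \<Rightarrow> (nat \<times> (nat \<Rightarrow> real)) set"
  where "partitions a b = {(n, t). t 0 = a \<and> t n = b \<and> (\<forall>k<n. t k < t (Suc k))}"

definition upper_sum :: "(real \<Rightarrow> real) \<Rightarrow> (real \<Rightarrow> real) \<Rightarrow> nat \<times> (nat \<Rightarrow> real) \<Rightarrow> real"
  where "upper_sum f \<rho> = (\<lambda>(n, t).
    \<Sum>k<n. (SUP x\<in>{t k..t (Suc k)}. f x) * (\<rho> (t (Suc k)) - \<rho> (t k)))"

definition lower_sum :: "(real \<Rightarrow> real) \<Rightarrow> (real \<Rightarrow> real) \<Rightarrow> nat \<times> (nat \<Rightarrow> real) \<Rightarrow> real"
  where "lower_sum f \<rho> = (\<lambda>(n, t).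
    \<Sum>k<n. (INF x\<in>{t k..t (Suc k)}. f x) * (\<rho> (t (Suc k)) - \<rho> (t k)))"

text \<open>Meant for bounded \<open>f\<close> and non-decreasing \<open>\<rho>\<close>: then all suprema and infima are those of
  nonempty bounded sets of reals.\<close>

definition DS_integrable_on :: "(real \<Rightarrow> real) \<Rightarrow> (real \<Rightarrow> real) \<Rightarrow> real \<Rightarrow> real \<Rightarrow> bool"
  where "DS_integrable_on f \<rho> a b \<longleftrightarrow>
    (INF p\<in>partitions a b. upper_sum f \<rho> p) = (SUP p\<in>partitions a b. lower_sum f \<rho> p)"

definition DS_integrable :: "(real \<Rightarrow> real) \<Rightarrow> (real \<Rightarrow> real) \<Rightarrow> bool"
  where "DS_integrable f \<rho> \<longleftrightarrow> (\<forall>a b. a < b \<longrightarrow> DS_integrable_on f \<rho> a b)"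

definition DS_integrable_vec ::
    "(real \<Rightarrow> real) \<Rightarrow> (real \<Rightarrow> 'h::complex_hilbert_space \<Rightarrow> 'h) \<Rightarrow> 'h \<Rightarrow> bool"
  where "DS_integrable_vec f E \<phi> \<longleftrightarrow> DS_integrable f (\<lambda>t. (norm (E t \<phi>))\<^sup>2)"

definition DS_integrable_pair ::
    "(real \<Rightarrow> real) \<Rightarrow> (real \<Rightarrow> 'h::complex_hilbert_space \<Rightarrow> 'h) \<Rightarrow> 'h \<Rightarrow> 'h \<Rightarrow> bool"
  where "DS_integrable_pair f E \<psi> \<phi> \<longleftrightarrow>
    DS_integrable_vec f E ((1/2) *\<^sub>C (\<psi> + \<phi>)) \<and>
    DS_integrable_vec f E ((1/2) *\<^sub>C (\<psi> - \<phi>)) \<and>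
    DS_integrable_vec f E ((1/2) *\<^sub>C (\<psi> + \<i> *\<^sub>C \<phi>)) \<and>
    DS_integrable_vec f E ((1/2) *\<^sub>C (\<psi> - \<i> *\<^sub>C \<phi>))"

definition DS_integrable_family ::
    "(real \<Rightarrow> real) \<Rightarrow> (real \<Rightarrow> 'h::complex_hilbert_space \<Rightarrow> 'h) \<Rightarrow> bool"
  where "DS_integrable_family f E \<longleftrightarrow> (\<forall>\<phi>. DS_integrable_vec f E \<phi>)"

end

theory Submission
  imports Defs "HOL-Probability.Distribution_Functions"
begin

text \<open>For a vector \<open>\<phi>\<close> write \<open>\<mu>(\<phi>)\<close> for the finite
measure on the line with distribution function
\<open>\<parallel>E(t)\<phi>\<parallel>\<^sup>2\<close>. All three limits concern integrals of
\<open>f\<close>: \<open>\<langle>\<phi>, f(A)\<phi>\<rangle>\<close> is \<open>\<integral> f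
d\<mu>(\<phi>)\<close>, the general matrix element is obtained by polarization, and
\<open>\<parallel>f(A)\<phi>\<parallel>\<^sup>2\<close> is \<open>\<integral> f\<^sup>2
d\<mu>(\<phi>)\<close>. So the theorem follows from two facts: strong resolvent convergence makes
the measures converge weakly, and \<open>f\<close> is continuous almost everywhere for the limit
measure. Strong convergence is then weak convergence together with convergence of the norms, and
for the norms one uses that \<open>f\<^sup>2\<close> is continuous wherever \<open>f\<close> is.

\<^emph>\<open>Functional calculus.\<close> Sending the indicator of \<open>(-\<infinity>,
s]\<close> to \<open>E(s)\<phi>\<close> is an isometry from step functions in
\<open>L\<^sup>2(\<mu>(\<phi>))\<close> into the Hilbert space. Its extension takes a bounded
Borel function \<open>g\<close> to the vector \<open>g(A)\<phi>\<close>; the relation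
\<open>rep\<close> expresses this. The rules \<open>smeas_rep\<close> and \<open>rep_mult\<close>
say that the measure of \<open>g(A)\<phi>\<close> is \<open>\<bar>g\<bar>\<^sup>2
\<mu>(\<phi>)\<close> and that the calculus is multiplicative, and \<open>op_app_rep\<close>
connects it with \<open>A\<close>: if \<open>t r(t)\<close> is bounded, then
\<open>r(A)\<phi>\<close> lies in the domain of \<open>A\<close> and \<open>A\<close> acts on it
as multiplication by \<open>t\<close>. Three choices of \<open>r\<close> give all that is needed
about \<open>A\<close>: \<open>1/(t - z)\<close> identifies the resolvent, the indicator of a
point shows that atoms are eigenvalues, and the indicator of a short interval shows that
\<open>\<mu>(\<phi>)\<close> lives on the spectrum, so that integrating over the spectrum or over
the line makes no difference.

\<^emph>\<open>Weak convergence.\<close> Put \<open>r(t) = 1/(t - z)\<close>. Every moment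
\<open>\<integral> cnj (r\<^sup>k) r\<^sup>j d\<mu>(\<phi>)\<close> is an inner product of powers
of the resolvent applied to \<open>\<phi>\<close>, hence converges along the sequence. As
\<open>r\<close> takes values in a compact disc, the Stone--Weierstrass theorem extends this to
\<open>\<integral> \<bar>r\<bar>\<^sup>2 h d\<mu>(\<phi>)\<close> for bounded continuous
\<open>h\<close>. The weight \<open>\<bar>r\<bar>\<^sup>2\<close> is removed by a cut-off: all
measures have the same total mass \<open>\<parallel>\<phi>\<parallel>\<^sup>2\<close>, so no mass
escapes to infinity.

\<^emph>\<open>Continuity almost everywhere.\<close> An upper Darboux sum dominates the integral
of the upper semicontinuous envelope of \<open>f\<close>, and a lower sum is dominated by that of
the lower envelope; at partition points this uses that \<open>f\<close> is continuous at atoms.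
Integrability makes the two integrals agree, so the envelopes agree almost everywhere. Conversely,
an almost everywhere continuous bounded function is squeezed between Lipschitz functions whose
integrals are close, which transfers weak convergence to \<open>f\<close> even though
\<open>f\<close> is measurable for the completed measures only.\<close>

section \<open>Complex Hilbert spaces\<close>

lemma scaleC_one [simp]: "1 *\<^sub>C x = (x::'h::complex_hilbert_space)"
  using scaleR_scaleC[of 1 x] by simp

lemma scaleC_zero_left [simp]: "0 *\<^sub>C x = (0::'h::complex_hilbert_space)"
  using scaleR_scaleC[of 0 x] by simp

lemma scaleC_zero_right [simp]: "c *\<^sub>C 0 = (0::'h::complex_hilbert_space)"
  using scaleC_add_right[of c 0 0] by simp

lemma scaleC_minus_left: "(- c) *\<^sub>C x = - (c *\<^sub>C (x::'h::complex_hilbert_space))"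
  using scaleC_add_left[of c "-c" x] by (simp add: eq_neg_iff_add_eq_0 add.commute)

lemma scaleC_minus_right: "c *\<^sub>C (- x) = - (c *\<^sub>C (x::'h::complex_hilbert_space))"
  using scaleC_add_right[of c x "-x"] by (simp add: eq_neg_iff_add_eq_0 add.commute)

lemma scaleC_diff_right: "c *\<^sub>C (x - y) = c *\<^sub>C x - c *\<^sub>C (y::'h::complex_hilbert_space)"
  using scaleC_add_right[of c x "-y"] by (simp add: scaleC_minus_right)

lemma cinner_add_left: "cinner (x + y) z = cinner x z + cinner (y::'h::complex_hilbert_space) z"
  by (metis cinner_commute cinner_add_right complex_cnj_add)

lemma cinner_scaleC_left: "cinner (c *\<^sub>C x) y = cnj c * cinner (x::'h::complex_hilbert_space) y"
  by (metis cinner_commute cinner_scaleC_right complex_cnj_mult)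

lemma cinner_zero_right [simp]: "cinner x (0::'h::complex_hilbert_space) = 0"
  using cinner_add_right[of x 0 0] by simp

lemma cinner_zero_left [simp]: "cinner (0::'h::complex_hilbert_space) x = 0"
  using cinner_add_left[of 0 0 x] by simp

lemma cinner_minus_right: "cinner x (- y) = - cinner x (y::'h::complex_hilbert_space)"
  using cinner_add_right[of x y "-y"] by (simp add: eq_neg_iff_add_eq_0 add.commute)

lemma cinner_minus_left: "cinner (- x) y = - cinner (x::'h::complex_hilbert_space) y"
  using cinner_add_left[of x "-x" y] by (simp add: eq_neg_iff_add_eq_0 add.commute)

lemma cinner_diff_right: "cinner x (y - z) = cinner x y - cinner x (z::'h::complex_hilbert_space)"
  using cinner_add_right[of x y "-z"] by (simp add: cinner_minus_right)

lemma cinner_diff_left: "cinner (x - y) z = cinner x z - cinner (y::'h::complex_hilbert_space) z"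
  using cinner_add_left[of x "-y" z] by (simp add: cinner_minus_left)

lemma Re_cinner_self: "Re (cinner x x) = (norm (x::'h::complex_hilbert_space))\<^sup>2"
proof -
  have "sqrt (Re (cinner x x)) \<ge> 0"
    using norm_ge_zero[of x] by (simp only: norm_eq_sqrt_cinner[symmetric])
  then show ?thesis by (simp add: norm_eq_sqrt_cinner)
qed

lemma cinner_self: "cinner x x = complex_of_real ((norm (x::'h::complex_hilbert_space))\<^sup>2)"
proof -
  have "Im (cinner x x) = 0"
    using arg_cong[OF cinner_commute[of x x], of Im] by simp
  then show ?thesis using Re_cinner_self[of x] by (simp add: complex_eq_iff)
qed

lemma norm_scaleC: "norm (c *\<^sub>C x) = cmod c * norm (x::'h::complex_hilbert_space)"
proof -
  have "cinner (c *\<^sub>C x) (c *\<^sub>C x) = (cnj c * c) * cinner x x"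
    by (simp add: cinner_scaleC_left cinner_scaleC_right)
  also have "cnj c * c = complex_of_real ((cmod c)\<^sup>2)"
    by (metis complex_norm_square mult.commute)
  finally have "cinner (c *\<^sub>C x) (c *\<^sub>C x) = complex_of_real ((cmod c * norm x)\<^sup>2)"
    by (simp add: cinner_self power_mult_distrib)
  then have "(norm (c *\<^sub>C x))\<^sup>2 = (cmod c * norm x)\<^sup>2"
    unfolding cinner_self of_real_eq_iff .
  then show ?thesis by (simp add: power2_eq_iff_nonneg)
qed

lemma norm_add_sq:
  "(norm (x + y))\<^sup>2 = (norm x)\<^sup>2 + 2 * Re (cinner x y) + (norm (y::'h::complex_hilbert_space))\<^sup>2"
proof -
  have "Re (cinner y x) = Re (cinner x y)"
    using arg_cong[OF cinner_commute[of x y], of Re] by simp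
  then show ?thesis
    by (simp add: Re_cinner_self[symmetric] cinner_add_left cinner_add_right)
qed

lemma norm_diff_sq:
  "(norm (x - y))\<^sup>2 = (norm x)\<^sup>2 - 2 * Re (cinner x y) + (norm (y::'h::complex_hilbert_space))\<^sup>2"
  using norm_add_sq[of x "-y"] by (simp add: cinner_minus_right)

lemma parallelogram_law:
  "(norm (x + y))\<^sup>2 + (norm (x - y))\<^sup>2 = 2 * (norm x)\<^sup>2 + 2 * (norm (y::'h::complex_hilbert_space))\<^sup>2"
  by (simp add: norm_add_sq norm_diff_sq)

text \<open>Recovers a sesquilinear form from its quadratic form. With \<open>q \<xi> =
\<integral> f d\<mu>(\<xi>)\<close> this is \<open>spectral_form\<close>.\<close>

definition polar :: "('h::complex_hilbert_space \<Rightarrow> complex) \<Rightarrow> 'h \<Rightarrow> 'h \<Rightarrow> complex"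
  where "polar q \<psi> \<phi> = q ((1/2) *\<^sub>C (\<psi> + \<phi>)) - q ((1/2) *\<^sub>C (\<psi> - \<phi>))
    + \<i> * q ((1/2) *\<^sub>C (\<psi> - \<i> *\<^sub>C \<phi>)) - \<i> * q ((1/2) *\<^sub>C (\<psi> + \<i> *\<^sub>C \<phi>))"

lemma polarization:
  fixes T :: "'h::complex_hilbert_space \<Rightarrow> 'h"
  assumes add: "\<And>x y. T (x + y) = T x + T y" and scale: "\<And>c x. T (c *\<^sub>C x) = c *\<^sub>C T x"
  shows "cinner \<psi> (T \<phi>) = polar (\<lambda>\<xi>. cinner \<xi> (T \<xi>)) \<psi> \<phi>"
proof -
  have minus: "T (- x) = - T x" for x
    using scale[of "-1" x] by (simp add: scaleC_minus_left)
  have diff: "T (x - y) = T x - T y" for x y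
    using add[of x "- y"] minus[of y] by simp
  show ?thesis
    unfolding polar_def
    by (simp add: add diff scale cinner_add_left cinner_add_right cinner_diff_left cinner_diff_right
        cinner_scaleC_left cinner_scaleC_right) (simp add: field_simps)
qed

lemma tendsto_norm_diff_iff: "(f \<longlongrightarrow> x) F \<longleftrightarrow> ((\<lambda>n. norm (f n - x)) \<longlongrightarrow> 0) F"
  by (simp add: tendsto_iff dist_norm)

text \<open>Polarization writes the inner product through norms, whose continuity is
known.\<close>

lemma tendsto_cinner:
  fixes x y :: "'h::complex_hilbert_space"
  assumes "(f \<longlongrightarrow> x) F" and "(g \<longlongrightarrow> y) F"
  shows "((\<lambda>n. cinner (f n) (g n)) \<longlongrightarrow> cinner x y) F"
proof -
  have scale: "((\<lambda>n. c *\<^sub>C h n) \<longlongrightarrow> c *\<^sub>C z) F" if "(h \<longlongrightarrow> z) F" for c h and z :: 'h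
  proof -
    have "((\<lambda>n. cmod c * norm (h n - z)) \<longlongrightarrow> cmod c * 0) F"
      by (intro tendsto_mult_left) (rule that[THEN tendsto_norm_diff_iff[THEN iffD1]])
    then have "((\<lambda>n. norm (c *\<^sub>C h n - c *\<^sub>C z)) \<longlongrightarrow> 0) F"
      by (simp add: scaleC_diff_right[symmetric] norm_scaleC)
    then show ?thesis by (rule tendsto_norm_diff_iff[THEN iffD2])
  qed
  have id: "cinner a b = polar (\<lambda>\<xi>. complex_of_real ((norm \<xi>)\<^sup>2)) a b" for a b :: 'h
    using polarization[of "\<lambda>x. x" a b] by (simp add: cinner_self)
  show ?thesis
    unfolding id[of x] id[of "f _"] polar_def
    by (intro tendsto_intros scale assms)
qed

lemma cinner_eqI:
  assumes "\<And>\<psi>. cinner \<psi> x = cinner \<psi> (y::'h::complex_hilbert_space)"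
  shows "x = y"
proof -
  have "cinner (x - y) (x - y) = 0" using assms[of "x - y"] by (simp add: cinner_diff_right)
  then show ?thesis by (simp add: cinner_self)
qed

text \<open>Gives the uniqueness behind the descriptions in \<open>adjoint_op\<close> and
\<open>spectral_integral\<close>.\<close>

lemma cinner_eqI_dense:
  fixes x y :: "'h::complex_hilbert_space"
  assumes dense: "closure D = UNIV" and eq: "\<And>\<psi>. \<psi> \<in> D \<Longrightarrow> cinner \<psi> x = cinner \<psi> y"
  shows "x = y"
proof (rule cinner_eqI)
  fix \<psi>
  have "\<psi> \<in> closure D" using dense by simp
  then obtain d where d: "\<And>n. d n \<in> D" "d \<longlonglongrightarrow> \<psi>" unfolding closure_sequential by auto
  have "(\<lambda>n. cinner (d n) x) \<longlonglongrightarrow> cinner \<psi> x" "(\<lambda>n. cinner (d n) y) \<longlonglongrightarrow> cinner \<psi> y"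
    by (intro tendsto_cinner d tendsto_const)+
  then show "cinner \<psi> x = cinner \<psi> y" using eq[OF d(1)] LIMSEQ_unique by auto
qed

text \<open>Expand \<open>\<parallel>x - f n\<parallel>\<^sup>2\<close>: the mixed term is
controlled by weak convergence.\<close>

lemma tendsto_of_weak_and_norm:
  fixes x :: "'h::complex_hilbert_space"
  assumes w: "\<And>\<psi>. (\<lambda>n. cinner \<psi> (f n)) \<longlonglongrightarrow> cinner \<psi> x" and n: "(\<lambda>n. (norm (f n))\<^sup>2) \<longlonglongrightarrow> (norm x)\<^sup>2"
  shows "f \<longlonglongrightarrow> x"
proof -
  have "(\<lambda>n. (norm x)\<^sup>2 - 2 * Re (cinner x (f n)) + (norm (f n))\<^sup>2)
      \<longlonglongrightarrow> (norm x)\<^sup>2 - 2 * Re (cinner x x) + (norm x)\<^sup>2"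
    by (intro tendsto_intros w n)
  then have "(\<lambda>n. (norm (x - f n))\<^sup>2) \<longlonglongrightarrow> 0" by (simp add: norm_diff_sq Re_cinner_self)
  then have "(\<lambda>n. sqrt ((norm (x - f n))\<^sup>2)) \<longlonglongrightarrow> sqrt 0" by (rule tendsto_real_sqrt)
  then have "(\<lambda>n. norm (f n - x)) \<longlonglongrightarrow> 0" by (simp add: norm_minus_commute)
  then show ?thesis by (rule tendsto_norm_diff_iff[THEN iffD2])
qed

section \<open>Orthogonal projections\<close>

lemma projection_inner:
  assumes "orthogonal_projection P"
  shows "cinner (P x) (P y) = cinner x (P y)"
  using assms unfolding orthogonal_projection_def by metis

lemma projection_norm_sq:
  assumes "orthogonal_projection P"
  shows "cinner x (P x) = complex_of_real ((norm (P x))\<^sup>2)"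
  using projection_inner[OF assms, of x x] by (simp add: cinner_self)

lemma projection_contraction:
  assumes "orthogonal_projection P"
  shows "norm (P x) \<le> norm x"
proof -
  have "Re (cinner x (P x)) = (norm (P x))\<^sup>2" by (simp add: projection_norm_sq[OF assms])
  then have "(norm x)\<^sup>2 = (norm (P x))\<^sup>2 + (norm (x - P x))\<^sup>2"
    by (simp add: norm_diff_sq)
  then have "(norm (P x))\<^sup>2 \<le> (norm x)\<^sup>2"
    using zero_le_power2[of "norm (x - P x)"] by linarith
  then show ?thesis by (simp add: power2_le_iff_abs_le)
qed

section \<open>Finite Borel measures on the line\<close>

text \<open>Half-lines generate the Borel sets and are closed under intersection, so an identity
between finite measures that is linear in the measures need only be checked on them. The
identities needed are additivity and the parallelogram law for \<open>\<phi> \<mapsto>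
\<parallel>E(t)\<phi>\<parallel>\<^sup>2\<close>.\<close>

lemma cdf_sum_determines_measure:
  assumes A: "finite_borel_measure A" and B: "finite_borel_measure B" and C: "finite_borel_measure C"
    and cdf: "\<And>t. cdf A t + cdf B t = c * cdf C t" and S: "S \<in> sets borel"
  shows "measure A S + measure B S = c * measure C S"
proof -
  interpret A: finite_borel_measure A by fact
  interpret B: finite_borel_measure B by fact
  interpret C: finite_borel_measure C by fact
  have U: "measure A UNIV + measure B UNIV = c * measure C UNIV"
  proof -
    have "(\<lambda>n. cdf A (real n) + cdf B (real n)) \<longlonglongrightarrow> measure A UNIV + measure B UNIV"
      using A.cdf_lim_infty B.cdf_lim_infty by (intro tendsto_add) (simp_all add: A.borel_UNIV B.borel_UNIV)
    moreover have "(\<lambda>n. c * cdf C (real n)) \<longlonglongrightarrow> c * measure C UNIV"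
      using C.cdf_lim_infty by (intro tendsto_mult_left) (simp add: C.borel_UNIV)
    ultimately show ?thesis using LIMSEQ_unique by (simp add: cdf)
  qed
  have borel: "sets borel = sigma_sets UNIV (range (\<lambda>a::real. {..a}))"
    by (subst borel_eq_atMost) simp
  have "Int_stable (range (\<lambda>a::real. {..a}))" "range (\<lambda>a::real. {..a}) \<subseteq> Pow UNIV"
    by (auto simp: Int_stable_def)
  from this S[unfolded borel] show ?thesis
  proof (induction rule: sigma_sets_induct_disjoint)
    case (basic S)
    then show ?case using cdf by (auto simp: cdf_def)
  next
    case (compl S)
    then have "S \<in> sets borel" using borel by simp
    then have "measure A (UNIV - S) = measure A UNIV - measure A S"
      "measure B (UNIV - S) = measure B UNIV - measure B S"
      "measure C (UNIV - S) = measure C UNIV - measure C S"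
      using A.finite_measure_compl[of S] B.finite_measure_compl[of S] C.finite_measure_compl[of S]
      by (auto simp: A.borel_UNIV B.borel_UNIV C.borel_UNIV A.M_is_borel B.M_is_borel C.M_is_borel)
    then show ?case using compl.IH U by (simp only: right_diff_distrib)
  next
    case (union F)
    then have F: "range F \<subseteq> sets borel" using borel by auto
    have "(\<lambda>i. measure A (F i) + measure B (F i)) sums (measure A (\<Union>i. F i) + measure B (\<Union>i. F i))"
      using F union(1) by (intro sums_add A.finite_measure_UNION B.finite_measure_UNION)
        (auto simp: A.M_is_borel B.M_is_borel)
    moreover have "(\<lambda>i. c * measure C (F i)) sums (c * measure C (\<Union>i. F i))"
      using F union(1) by (intro sums_mult C.finite_measure_UNION) (auto simp: C.M_is_borel)
    ultimately show ?case using union.IH sums_unique2 by simp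
  qed simp
qed

definition bdd_borel :: "(real \<Rightarrow> 'b::real_normed_vector) \<Rightarrow> bool"
  where "bdd_borel g \<longleftrightarrow> g \<in> borel_measurable borel \<and> (\<exists>C. \<forall>t. norm (g t) \<le> C)"

lemma bdd_borelI: "g \<in> borel_measurable borel \<Longrightarrow> (\<And>t. norm (g t) \<le> C) \<Longrightarrow> bdd_borel g"
  unfolding bdd_borel_def by auto

lemma bdd_borel_measurable: "bdd_borel g \<Longrightarrow> g \<in> borel_measurable borel"
  unfolding bdd_borel_def by simp

lemma bdd_borel_add:
  fixes g h :: "real \<Rightarrow> 'b::{real_normed_vector, second_countable_topology}"
  assumes "bdd_borel g" "bdd_borel h"
  shows "bdd_borel (\<lambda>t. g t + h t)"
proof -
  from assms obtain C D where "\<forall>t. norm (g t) \<le> C" "\<forall>t. norm (h t) \<le> D"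
    by (auto simp: bdd_borel_def)
  then show ?thesis using assms
    by (intro bdd_borelI[where C="C + D"])
      (auto simp: bdd_borel_def intro!: borel_measurable_add order_trans[OF norm_triangle_ineq] add_mono)
qed

lemma bdd_borel_mult:
  fixes g h :: "real \<Rightarrow> 'b::{real_normed_algebra, second_countable_topology}"
  assumes "bdd_borel g" "bdd_borel h"
  shows "bdd_borel (\<lambda>t. g t * h t)"
proof -
  from assms obtain C D where CD: "\<forall>t. norm (g t) \<le> C" "\<forall>t. norm (h t) \<le> D"
    by (auto simp: bdd_borel_def)
  have "norm (g t * h t) \<le> C * D" for t
    using CD order_trans[OF norm_ge_zero CD(1)[rule_format]]
    by (intro order_trans[OF norm_mult_ineq] mult_mono) auto
  then show ?thesis using assms
    by (intro bdd_borelI[where C="C * D"]) (auto simp: bdd_borel_def)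
qed

lemma bdd_borel_const: "bdd_borel (\<lambda>t. c)"
  by (intro bdd_borelI[where C="norm c"]) auto

lemma bdd_borel_indicator: "S \<in> sets borel \<Longrightarrow> bdd_borel (indicator S :: real \<Rightarrow> 'b::real_normed_algebra_1)"
  by (intro bdd_borelI[where C=1]) (auto simp: indicator_def)

lemma bdd_borel_diff:
  fixes g h :: "real \<Rightarrow> 'b::{real_normed_vector, second_countable_topology}"
  assumes g: "bdd_borel g" and h: "bdd_borel h"
  shows "bdd_borel (\<lambda>t. g t - h t)"
proof -
  have "bdd_borel (\<lambda>t. - h t)" using h by (auto simp: bdd_borel_def)
  from bdd_borel_add[OF g this] show ?thesis by simp
qed

lemma bdd_borel_norm_sq: "bdd_borel g \<Longrightarrow> bdd_borel (\<lambda>t. (norm (g t))\<^sup>2)"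
  using bdd_borel_mult[of "\<lambda>t. norm (g t)" "\<lambda>t. norm (g t)"]
  by (auto simp: power2_eq_square bdd_borel_def)

lemma bdd_borel_cnj: "bdd_borel g \<Longrightarrow> bdd_borel (\<lambda>t. cnj (g t))"
  unfolding bdd_borel_def complex_mod_cnj
  using borel_measurable_continuous_onI[OF continuous_on_cnj[OF continuous_on_id]]
  by (auto intro: measurable_compose)

lemma bdd_borel_of_real: "bdd_borel g \<Longrightarrow> bdd_borel (\<lambda>t. complex_of_real (g t))"
  unfolding bdd_borel_def by auto

lemmas bdd_borel_intros = bdd_borel_add bdd_borel_diff bdd_borel_mult bdd_borel_const
  bdd_borel_norm_sq bdd_borel_cnj bdd_borel_of_real

lemma (in finite_borel_measure) bdd_borel_integrable:
  fixes g :: "real \<Rightarrow> 'b::{banach, second_countable_topology}"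
  assumes "bdd_borel g"
  shows "integrable M g"
proof -
  from assms obtain C where "\<forall>t. norm (g t) \<le> C" "g \<in> borel_measurable borel"
    by (auto simp: bdd_borel_def)
  then show ?thesis
    by (intro integrable_const_bound[where B=C]) (auto simp: measurable_cong_sets[OF M_is_borel refl])
qed

definition dominated_by :: "real measure \<Rightarrow> real measure \<Rightarrow> bool"
  where "dominated_by N M \<longleftrightarrow> (\<forall>S\<in>sets borel. measure N S \<le> measure M S)"

lemma dominated_le:
  assumes N: "finite_borel_measure N" and M: "finite_borel_measure M" and "dominated_by N M"
  shows "N \<le> M"
proof -
  interpret N: finite_borel_measure N by fact
  interpret M: finite_borel_measure M by fact
  show ?thesis
    using assms(3) by (subst le_measure)
      (auto simp: N.M_is_borel M.M_is_borel dominated_by_def N.emeasure_eq_measure M.emeasure_eq_measure)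
qed

lemma dominated_integral_mono:
  fixes u :: "real \<Rightarrow> real"
  assumes N: "finite_borel_measure N" and M: "finite_borel_measure M" and d: "dominated_by N M"
    and u: "bdd_borel u" "\<And>t. u t \<ge> 0"
  shows "(\<integral>t. u t \<partial>N) \<le> (\<integral>t. u t \<partial>M)"
proof -
  interpret N: finite_borel_measure N by fact
  interpret M: finite_borel_measure M by fact
  have "(\<integral>\<^sup>+t. ennreal (u t) \<partial>N) \<le> (\<integral>\<^sup>+t. ennreal (u t) \<partial>M)"
    by (intro nn_integral_mono_measure dominated_le[OF N M d]) (simp add: N.M_is_borel M.M_is_borel)
  then have "ennreal (\<integral>t. u t \<partial>N) \<le> ennreal (\<integral>t. u t \<partial>M)"
    using u by (simp add: nn_integral_eq_integral N.bdd_borel_integrable M.bdd_borel_integrable)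
  then show ?thesis using u by (simp add: ennreal_le_iff integral_nonneg_AE)
qed

lemma dominated_AE:
  assumes N: "finite_borel_measure N" and M: "finite_borel_measure M" and d: "dominated_by N M"
    and "AE t in M. P t"
  shows "AE t in N. P t"
proof -
  interpret N: finite_borel_measure N by fact
  interpret M: finite_borel_measure M by fact
  obtain S where S: "{t \<in> space M. \<not> P t} \<subseteq> S" "emeasure M S = 0" "S \<in> sets M"
    using assms(4) by (rule AE_E)
  then have "measure N S \<le> 0" using d by (auto simp: dominated_by_def measure_def M.M_is_borel)
  then have "emeasure N S = 0" using measure_nonneg[of N S] by (simp add: N.emeasure_eq_measure)
  then show ?thesis using S
    by (intro AE_I[where N=S]) (auto simp: N.borel_UNIV M.borel_UNIV N.M_is_borel M.M_is_borel)
qed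

section \<open>The measures of a spectral family\<close>

text \<open>\<open>spectral_measure\<close> before completion, so that measurability means Borel
measurability.\<close>

definition smeas :: "(real \<Rightarrow> 'h::complex_hilbert_space \<Rightarrow> 'h) \<Rightarrow> 'h \<Rightarrow> real measure"
  where "smeas E \<phi> = interval_measure (\<lambda>t. (norm (E t \<phi>))\<^sup>2)"

text \<open>The sum of the measures of \<open>\<phi>\<close> and \<open>\<psi>\<close>. It
dominates the measures of all four vectors in the polarization identity, so approximation with
respect to it serves for all of them at once.\<close>

definition smeas2 :: "(real \<Rightarrow> 'h::complex_hilbert_space \<Rightarrow> 'h) \<Rightarrow> 'h \<Rightarrow> 'h \<Rightarrow> real measure"
  where "smeas2 E \<phi> \<psi> = interval_measure (\<lambda>t. (norm (E t \<phi>))\<^sup>2 + (norm (E t \<psi>))\<^sup>2)"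

lemma spectral_measure_smeas: "spectral_measure E \<phi> = completion (smeas E \<phi>)"
  unfolding spectral_measure_def smeas_def ..

context
  fixes E :: "real \<Rightarrow> 'h::complex_hilbert_space \<Rightarrow> 'h"
  assumes sf: "spectral_family E"
begin

lemma sf_proj: "orthogonal_projection (E t)"
  and sf_min: "E s (E t \<phi>) = E (min s t) \<phi>"
  and sf_right: "((\<lambda>s. E s \<phi>) \<longlongrightarrow> E t \<phi>) (at_right t)"
  and sf_bot: "((\<lambda>t. E t \<phi>) \<longlongrightarrow> 0) at_bot"
  and sf_top: "((\<lambda>t. E t \<phi>) \<longlongrightarrow> \<phi>) at_top"
  using sf unfolding spectral_family_def by simp_all

lemma sf_add: "E t (\<phi> + \<psi>) = E t \<phi> + E t \<psi>"
  and sf_scaleC: "E t (c *\<^sub>C \<phi>) = c *\<^sub>C E t \<phi>"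
  using sf_proj[of t] unfolding orthogonal_projection_def by blast+

lemma sf_diff: "E t (\<phi> - \<psi>) = E t \<phi> - E t \<psi>"
  using sf_add[of t "\<phi> - \<psi>" \<psi>] by (simp add: algebra_simps)

lemma sf_inner: "cinner (E s \<phi>) (E t \<phi>) = complex_of_real ((norm (E (min s t) \<phi>))\<^sup>2)"
proof -
  have "cinner (E s \<phi>) (E t \<phi>) = cinner \<phi> (E s (E t \<phi>))"
    using sf_proj[of s] unfolding orthogonal_projection_def by metis
  then show ?thesis by (simp add: sf_min projection_norm_sq[OF sf_proj])
qed

lemma sf_contraction: "norm (E t \<phi>) \<le> norm \<phi>"
  by (rule projection_contraction[OF sf_proj])

lemma sf_mono: "s \<le> t \<Longrightarrow> (norm (E s \<phi>))\<^sup>2 \<le> (norm (E t \<phi>))\<^sup>2"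
  using sf_contraction[of s "E t \<phi>"] by (simp add: sf_min min_absorb1 power_mono)

lemma sf_tendsto: "((\<lambda>n. E t (f n)) \<longlongrightarrow> E t x) F" if "(f \<longlongrightarrow> x) F"
proof -
  have "((\<lambda>n. norm (f n - x)) \<longlongrightarrow> 0) F" using that by (rule tendsto_norm_diff_iff[THEN iffD1])
  then have "((\<lambda>n. norm (E t (f n) - E t x)) \<longlongrightarrow> 0) F"
    by (rule tendsto_0_le[where K=1]) (simp add: sf_diff[symmetric] sf_contraction)
  then show ?thesis by (rule tendsto_norm_diff_iff[THEN iffD2])
qed

lemma sf_norm_sq_right: "continuous (at_right a) (\<lambda>t. (norm (E t \<phi>))\<^sup>2)"
  unfolding continuous_within by (intro tendsto_intros sf_right)

lemma sf_norm_sq_bot: "((\<lambda>t. (norm (E t \<phi>))\<^sup>2) \<longlongrightarrow> 0) at_bot"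
  using tendsto_power[OF tendsto_norm[OF sf_bot], where n=2] by simp

lemma sf_norm_sq_top: "((\<lambda>t. (norm (E t \<phi>))\<^sup>2) \<longlongrightarrow> (norm \<phi>)\<^sup>2) at_top"
  by (intro tendsto_intros sf_top)

lemma smeas_finite: "finite_borel_measure (smeas E \<phi>)"
  unfolding smeas_def
  by (rule finite_borel_measure_interval_measure[OF sf_mono sf_norm_sq_right sf_norm_sq_bot sf_norm_sq_top]) auto

lemma smeas_cdf: "cdf (smeas E \<phi>) t = (norm (E t \<phi>))\<^sup>2"
  unfolding smeas_def cdf_def
  by (rule measure_interval_measure_Iic[OF sf_mono sf_norm_sq_right sf_norm_sq_bot])

lemma smeas_UNIV: "measure (smeas E \<phi>) UNIV = (norm \<phi>)\<^sup>2"
  unfolding smeas_def measure_def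
  by (subst interval_measure_UNIV[OF sf_mono sf_norm_sq_right sf_norm_sq_bot sf_norm_sq_top]) auto

lemma smeas2_finite: "finite_borel_measure (smeas2 E \<phi> \<psi>)"
  and smeas2_cdf: "cdf (smeas2 E \<phi> \<psi>) t = (norm (E t \<phi>))\<^sup>2 + (norm (E t \<psi>))\<^sup>2"
proof -
  let ?F = "\<lambda>t. (norm (E t \<phi>))\<^sup>2 + (norm (E t \<psi>))\<^sup>2"
  have F: "\<And>x y. x \<le> y \<Longrightarrow> ?F x \<le> ?F y" "\<And>a. continuous (at_right a) ?F" "(?F \<longlongrightarrow> 0) at_bot"
    using tendsto_add[OF sf_norm_sq_bot sf_norm_sq_bot, of \<phi> \<psi>]
    by (auto intro: add_mono sf_mono continuous_add sf_norm_sq_right)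
  moreover have "(?F \<longlongrightarrow> (norm \<phi>)\<^sup>2 + (norm \<psi>)\<^sup>2) at_top"
    by (intro tendsto_add sf_norm_sq_top)
  ultimately show "finite_borel_measure (smeas2 E \<phi> \<psi>)"
    unfolding smeas2_def by (rule finite_borel_measure_interval_measure) auto
  show "cdf (smeas2 E \<phi> \<psi>) t = ?F t"
    unfolding smeas2_def cdf_def by (rule measure_interval_measure_Iic[OF F])
qed

lemma smeas2_measure:
  "S \<in> sets borel \<Longrightarrow> measure (smeas2 E \<phi> \<psi>) S = measure (smeas E \<phi>) S + measure (smeas E \<psi>) S"
  using cdf_sum_determines_measure[OF smeas_finite[of \<phi>] smeas_finite[of \<psi>] smeas2_finite[of \<phi> \<psi>], of 1 S]
  by (simp add: smeas_cdf smeas2_cdf)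

lemma smeas_dominated1: "dominated_by (smeas E \<phi>) (smeas2 E \<phi> \<psi>)"
  unfolding dominated_by_def by (simp add: smeas2_measure)

text \<open>By the parallelogram law the measures of \<open>(\<psi> + c\<phi>)/2\<close> and
\<open>(\<psi> - c\<phi>)/2\<close> add up to half of \<open>smeas2 E \<phi>
\<psi>\<close>.\<close>

lemma smeas_dominated_combination:
  assumes "cmod c = 1"
  shows "dominated_by (smeas E ((1/2) *\<^sub>C (\<psi> + c *\<^sub>C \<phi>))) (smeas2 E \<phi> \<psi>)"
  unfolding dominated_by_def
proof
  fix S :: "real set" assume S: "S \<in> sets borel"
  define \<xi> where "\<xi> = (1/2) *\<^sub>C (\<psi> + c *\<^sub>C \<phi>)"
  define \<eta> where "\<eta> = (1/2) *\<^sub>C (\<psi> - c *\<^sub>C \<phi>)"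
  have "cdf (smeas E \<xi>) t + cdf (smeas E \<eta>) t = 1/2 * cdf (smeas2 E \<phi> \<psi>) t" for t
    using parallelogram_law[of "E t \<psi>" "c *\<^sub>C E t \<phi>"]
    by (simp add: smeas_cdf smeas2_cdf \<xi>_def \<eta>_def sf_scaleC sf_add sf_diff norm_scaleC assms
        power_mult_distrib power_divide field_simps)
  from cdf_sum_determines_measure[OF smeas_finite smeas_finite smeas2_finite this S]
  have "measure (smeas E \<xi>) S + measure (smeas E \<eta>) S = 1/2 * measure (smeas2 E \<phi> \<psi>) S" .
  then show "measure (smeas E \<xi>) S \<le> measure (smeas2 E \<phi> \<psi>) S"
    using measure_nonneg[of "smeas E \<eta>" S] measure_nonneg[of "smeas2 E \<phi> \<psi>" S] by linarith
qed

lemma smeas_dominated_polar: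
  "dominated_by (smeas E ((1/2) *\<^sub>C (\<psi> + \<phi>))) (smeas2 E \<phi> \<psi>)"
  "dominated_by (smeas E ((1/2) *\<^sub>C (\<psi> - \<phi>))) (smeas2 E \<phi> \<psi>)"
  "dominated_by (smeas E ((1/2) *\<^sub>C (\<psi> + \<i> *\<^sub>C \<phi>))) (smeas2 E \<phi> \<psi>)"
  "dominated_by (smeas E ((1/2) *\<^sub>C (\<psi> - \<i> *\<^sub>C \<phi>))) (smeas2 E \<phi> \<psi>)"
  using smeas_dominated_combination[of 1 \<psi> \<phi>] smeas_dominated_combination[of "-1" \<psi> \<phi>]
    smeas_dominated_combination[of "\<i>" \<psi> \<phi>] smeas_dominated_combination[of "-\<i>" \<psi> \<phi>]
  by (simp_all add: scaleC_minus_left)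

text \<open>A function that is measurable for every completed measure need not agree with a single
Borel function almost everywhere for all vectors, but for two vectors, and then for those in the
polarization identity, it does. The point is that a set lying between Borel sets for each of the
two measures lies between the union of the inner and the intersection of the outer ones, and the
gap is null for both.\<close>

lemma common_borel_version:
  fixes f :: "real \<Rightarrow> real"
  assumes f1: "f \<in> borel_measurable (spectral_measure E \<phi>)"
    and f2: "f \<in> borel_measurable (spectral_measure E \<psi>)"
    and bdd: "\<And>t. \<bar>f t\<bar> \<le> C"
  obtains g where "bdd_borel g" "AE t in smeas2 E \<phi> \<psi>. f t = g t"
proof -
  interpret M: finite_borel_measure "smeas2 E \<phi> \<psi>" by (rule smeas2_finite)
  interpret M1: finite_borel_measure "smeas E \<phi>" by (rule smeas_finite)
  interpret M2: finite_borel_measure "smeas E \<psi>" by (rule smeas_finite)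
  have "f \<in> borel_measurable (completion (smeas2 E \<phi> \<psi>))"
  proof (rule measurableI)
    fix B :: "real set" assume B: "B \<in> sets borel"
    from measurable_sets[OF f1 B] have "f -` B \<in> sets (completion (smeas E \<phi>))"
      by (simp add: spectral_measure_smeas M1.borel_UNIV)
    then obtain S1 N1 N1' where 1: "f -` B = S1 \<union> N1" "N1 \<subseteq> N1'" "N1' \<in> null_sets (smeas E \<phi>)" "S1 \<in> sets (smeas E \<phi>)"
      by (rule sets_completionE)
    from measurable_sets[OF f2 B] have "f -` B \<in> sets (completion (smeas E \<psi>))"
      by (simp add: spectral_measure_smeas M2.borel_UNIV)
    then obtain S2 N2 N2' where 2: "f -` B = S2 \<union> N2" "N2 \<subseteq> N2'" "N2' \<in> null_sets (smeas E \<psi>)" "S2 \<in> sets (smeas E \<psi>)"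
      by (rule sets_completionE)
    have [simp]: "N1' \<in> sets borel" "N2' \<in> sets borel" "S1 \<in> sets borel" "S2 \<in> sets borel"
      using 1(3,4) 2(3,4) by (auto simp: M1.M_is_borel M2.M_is_borel dest: null_setsD2)
    \<comment> \<open>\<open>S1\<close> and \<open>S2\<close> approximate the preimage from inside, each up to a null set of one of the measures;
      what both miss is null for both measures.\<close>
    have "measure (smeas E \<phi>) (N1' \<inter> N2') \<le> measure (smeas E \<phi>) N1'"
      "measure (smeas E \<psi>) (N1' \<inter> N2') \<le> measure (smeas E \<psi>) N2'"
      by (intro M1.finite_measure_mono M2.finite_measure_mono; auto simp: M1.M_is_borel M2.M_is_borel)+
    moreover have "measure (smeas E \<phi>) N1' = 0" "measure (smeas E \<psi>) N2' = 0"
      using 1(3) 2(3) by (auto simp: measure_def dest: null_setsD1)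
    ultimately have "measure (smeas2 E \<phi> \<psi>) (N1' \<inter> N2') = 0"
      using measure_nonneg[of "smeas E \<phi>" "N1' \<inter> N2'"] measure_nonneg[of "smeas E \<psi>" "N1' \<inter> N2'"]
        sets.Int[of N1' borel N2']
      by (simp add: smeas2_measure)
    then have null: "N1' \<inter> N2' \<in> null_sets (smeas2 E \<phi> \<psi>)"
      by (auto simp: M.M_is_borel M.emeasure_eq_measure intro!: null_setsI)
    have "f -` B = (S1 \<union> S2) \<union> (f -` B - (S1 \<union> S2))" using 1(1) 2(1) by auto
    moreover have "f -` B - (S1 \<union> S2) \<subseteq> N1' \<inter> N2'" using 1(1,2) 2(1,2) by auto
    ultimately have "f -` B \<in> sets (completion (smeas2 E \<phi> \<psi>))"
      using null by (rule sets_completionI) (auto simp: M.M_is_borel)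
    then show "f -` B \<inter> space (completion (smeas2 E \<phi> \<psi>)) \<in> sets (completion (smeas2 E \<phi> \<psi>))"
      by (simp add: M.borel_UNIV)
  qed simp
  from completion_ex_borel_measurable_real[OF this] obtain h where
    h: "h \<in> borel_measurable borel" "AE t in smeas2 E \<phi> \<psi>. f t = h t"
    by (auto simp: measurable_cong_sets[OF M.M_is_borel refl])
  define g where "g t = max (- C) (min C (h t))" for t
  have "C \<ge> 0" using bdd[of 0] by linarith
  then have "\<bar>g t\<bar> \<le> C" for t unfolding g_def by (auto simp: abs_le_iff)
  moreover have "g \<in> borel_measurable borel" unfolding g_def using h(1) by measurable
  ultimately have "bdd_borel g" by (intro bdd_borelI[where C=C]) auto
  moreover have "AE t in smeas2 E \<phi> \<psi>. f t = g t"
    using h(2)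
  proof (rule AE_mp, intro AE_I2 impI)
    fix t assume "f t = h t"
    then show "f t = g t" unfolding g_def using bdd[of t] by (auto simp: abs_le_iff)
  qed
  ultimately show ?thesis using that by blast
qed

end

section \<open>Step functions and their density\<close>

text \<open>A list of pairs \<open>(c, s)\<close> stands for the step function \<open>\<Sum> c
1\<^bsub>(-\<infinity>, s]\<^esub>\<close>; \<open>stepv\<close> is the vector \<open>\<Sum> c
E(s)\<phi>\<close> that corresponds to it.\<close>

definition stepf :: "(complex \<times> real) list \<Rightarrow> real \<Rightarrow> complex"
  where "stepf l t = (\<Sum>(c, s)\<leftarrow>l. c * indicator {..s} t)"

definition stepv :: "(real \<Rightarrow> 'h::complex_hilbert_space \<Rightarrow> 'h) \<Rightarrow> (complex \<times> real) list \<Rightarrow> 'h \<Rightarrow> 'h"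
  where "stepv E l \<phi> = (\<Sum>(c, s)\<leftarrow>l. c *\<^sub>C E s \<phi>)"

definition step_scale :: "complex \<Rightarrow> (complex \<times> real) list \<Rightarrow> (complex \<times> real) list"
  where "step_scale a l = map (\<lambda>(c, s). (a * c, s)) l"

lemma stepf_Nil [simp]: "stepf [] t = 0"
  and stepf_Cons [simp]: "stepf (p # l) t = fst p * indicator {..snd p} t + stepf l t"
  and stepf_append [simp]: "stepf (l @ l') t = stepf l t + stepf l' t"
  by (simp_all add: stepf_def split_beta)

lemma stepv_Nil [simp]: "stepv E [] \<phi> = 0"
  and stepv_Cons [simp]: "stepv E (p # l) \<phi> = fst p *\<^sub>C E (snd p) \<phi> + stepv E l \<phi>"
  and stepv_append [simp]: "stepv E (l @ l') \<phi> = stepv E l \<phi> + stepv E l' \<phi>"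
  by (simp_all add: stepv_def split_beta)

lemma stepf_scale [simp]: "stepf (step_scale a l) t = a * stepf l t"
  by (induction l) (auto simp: step_scale_def algebra_simps)

lemma stepv_scale [simp]: "stepv E (step_scale a l) \<phi> = a *\<^sub>C stepv E l \<phi>"
  by (induction l) (auto simp: step_scale_def scaleC_add_right scaleC_scaleC)

lemma stepf_bdd: "bdd_borel (stepf l)"
proof (induction l)
  case Nil
  have "stepf [] = (\<lambda>t. 0)" by (rule ext) simp
  then show ?case by (simp add: bdd_borel_const)
next
  case (Cons p l)
  have "bdd_borel (\<lambda>t. fst p * indicator {..snd p} t + stepf l t)"
    by (intro bdd_borel_intros bdd_borel_indicator Cons) simp
  then show ?case by (simp add: bdd_borel_def)
qed

lemma cmod_diff_sq_le: "(cmod (a - c))\<^sup>2 \<le> 2 * (cmod (a - b))\<^sup>2 + 2 * (cmod (b - c))\<^sup>2"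
proof -
  have "cmod (a - c) \<le> cmod (a - b) + cmod (b - c)" by norm
  then have "(cmod (a - c))\<^sup>2 \<le> (cmod (a - b) + cmod (b - c))\<^sup>2" by (intro power_mono) auto
  also have "\<dots> \<le> 2 * (cmod (a - b))\<^sup>2 + 2 * (cmod (b - c))\<^sup>2"
    using sum_squares_bound[of "cmod (a - b)" "cmod (b - c)"] by (simp add: power2_sum)
  finally show ?thesis .
qed

context finite_borel_measure
begin

abbreviation sqdist :: "(real \<Rightarrow> complex) \<Rightarrow> (real \<Rightarrow> complex) \<Rightarrow> real"
  where "sqdist g h \<equiv> \<integral>t. (cmod (g t - h t))\<^sup>2 \<partial>M"

definition step_approx :: "(real \<Rightarrow> complex) \<Rightarrow> bool"
  where "step_approx g \<longleftrightarrow> bdd_borel g \<and> (\<forall>\<epsilon>>0. \<exists>l. sqdist (stepf l) g < \<epsilon>)"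

lemma sqdist_triangle:
  assumes "bdd_borel f" "bdd_borel g" "bdd_borel h"
  shows "sqdist f h \<le> 2 * sqdist f g + 2 * sqdist g h"
proof -
  have "sqdist f h \<le> (\<integral>t. 2 * (cmod (f t - g t))\<^sup>2 + 2 * (cmod (g t - h t))\<^sup>2 \<partial>M)"
    by (intro integral_mono bdd_borel_integrable bdd_borel_intros assms cmod_diff_sq_le)
  also have "\<dots> = 2 * sqdist f g + 2 * sqdist g h"
    by (subst Bochner_Integration.integral_add)
      (auto intro!: bdd_borel_integrable bdd_borel_intros assms)
  finally show ?thesis .
qed

text \<open>Approximability is closed under limits in mean square; the remaining closure
properties reduce the density of step functions to indicators of half-lines.\<close>

lemma step_approx_closed:
  assumes g: "bdd_borel g" and h: "\<And>\<epsilon>. \<epsilon> > 0 \<Longrightarrow> \<exists>h. step_approx h \<and> sqdist h g < \<epsilon>"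
  shows "step_approx g"
  unfolding step_approx_def
proof (intro conjI allI impI g)
  fix \<epsilon> :: real assume "\<epsilon> > 0"
  from h[of "\<epsilon> / 4"] this obtain h where h: "step_approx h" "sqdist h g < \<epsilon> / 4" by auto
  with \<open>\<epsilon> > 0\<close> obtain l where l: "sqdist (stepf l) h < \<epsilon> / 4"
    unfolding step_approx_def by (meson divide_pos_pos zero_less_numeral)
  have "sqdist (stepf l) g \<le> 2 * sqdist (stepf l) h + 2 * sqdist h g"
    using h(1) by (intro sqdist_triangle stepf_bdd g) (simp add: step_approx_def)
  then show "\<exists>l. sqdist (stepf l) g < \<epsilon>" using l h(2) by (intro exI[of _ l]) linarith
qed

lemma step_approx_bounded_limit:
  assumes h: "\<And>k::nat. step_approx (h k)" and lim: "\<And>t. (\<lambda>k. h k t) \<longlonglongrightarrow> g t"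
    and bdd: "\<And>k t. cmod (h k t) \<le> C"
  shows "step_approx g"
proof -
  have hb: "bdd_borel (h k)" for k using h by (simp add: step_approx_def)
  have gC: "cmod (g t) \<le> C" for t
    using LIMSEQ_le_const2[OF tendsto_norm[OF lim[of t]], of C] bdd by auto
  have g: "bdd_borel g"
    using borel_measurable_LIMSEQ_metric[of h borel g] hb lim gC
    by (intro bdd_borelI[where C=C]) (auto simp: bdd_borel_def)
  have "(\<lambda>k. sqdist (h k) g) \<longlonglongrightarrow> (\<integral>t. 0 \<partial>M)"
  proof (rule integral_dominated_convergence[where w="\<lambda>t. (2 * C)\<^sup>2"])
    show "AE t in M. (\<lambda>k. (cmod (h k t - g t))\<^sup>2) \<longlonglongrightarrow> 0"
      using lim by (auto intro!: AE_I2 tendsto_eq_intros)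
    show "AE t in M. norm ((cmod (h k t - g t))\<^sup>2) \<le> (2 * C)\<^sup>2" for k
    proof (intro AE_I2)
      fix t
      have "cmod (h k t - g t) \<le> 2 * C" using norm_triangle_ineq4[of "h k t" "g t"] bdd[of k t] gC[of t] by linarith
      then have "(cmod (h k t - g t))\<^sup>2 \<le> (2 * C)\<^sup>2" by (rule power_mono) simp
      then show "norm ((cmod (h k t - g t))\<^sup>2) \<le> (2 * C)\<^sup>2" by simp
    qed
  qed (use bdd_borel_integrable[OF bdd_borel_norm_sq[OF bdd_borel_diff[OF hb g]]] in auto)
  then have "(\<lambda>k. sqdist (h k) g) \<longlonglongrightarrow> 0" by simp
  then have "\<exists>k. sqdist (h k) g < \<epsilon>" if "\<epsilon> > 0" for \<epsilon>
    using order_tendstoD(2)[of _ 0 sequentially \<epsilon>] that by (auto simp: eventually_sequentially)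
  then show ?thesis using h by (intro step_approx_closed[OF g]) blast
qed

lemma step_approx_step: "step_approx (stepf l)"
  unfolding step_approx_def by (intro conjI stepf_bdd allI impI exI[of _ l]) simp

lemma step_approx_add:
  assumes g: "step_approx g" and h: "step_approx h"
  shows "step_approx (\<lambda>t. g t + h t)"
  unfolding step_approx_def
proof (intro conjI allI impI)
  have b: "bdd_borel g" "bdd_borel h" using g h by (auto simp: step_approx_def)
  show gh: "bdd_borel (\<lambda>t. g t + h t)" using b by (rule bdd_borel_add)
  fix \<epsilon> :: real assume "\<epsilon> > 0"
  then obtain l l' where l: "sqdist (stepf l) g < \<epsilon> / 4" "sqdist (stepf l') h < \<epsilon> / 4"
    using g h unfolding step_approx_def by (meson divide_pos_pos zero_less_numeral)
  have sh: "bdd_borel (\<lambda>t. stepf l t + h t)" by (intro bdd_borel_add stepf_bdd b)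
  have "sqdist (stepf (l @ l')) (\<lambda>t. g t + h t)
      \<le> 2 * sqdist (stepf (l @ l')) (\<lambda>t. stepf l t + h t) + 2 * sqdist (\<lambda>t. stepf l t + h t) (\<lambda>t. g t + h t)"
    by (intro sqdist_triangle stepf_bdd sh gh)
  then show "\<exists>l. sqdist (stepf l) (\<lambda>t. g t + h t) < \<epsilon>" using l by (intro exI[of _ "l @ l'"]) simp
qed

lemma step_approx_scale:
  assumes g: "step_approx g"
  shows "step_approx (\<lambda>t. a * g t)"
  unfolding step_approx_def
proof (intro conjI allI impI)
  show "bdd_borel (\<lambda>t. a * g t)" using g by (auto simp: step_approx_def intro: bdd_borel_intros)
  fix \<epsilon> :: real assume "\<epsilon> > 0"
  then have "\<epsilon> / ((cmod a)\<^sup>2 + 1) > 0" by (simp add: add_nonneg_pos)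
  then obtain l where l: "sqdist (stepf l) g < \<epsilon> / ((cmod a)\<^sup>2 + 1)"
    using g unfolding step_approx_def by blast
  have "sqdist (stepf (step_scale a l)) (\<lambda>t. a * g t) = (cmod a)\<^sup>2 * sqdist (stepf l) g"
    by (simp add: right_diff_distrib[symmetric] norm_mult power_mult_distrib)
  also have "\<dots> \<le> ((cmod a)\<^sup>2 + 1) * sqdist (stepf l) g"
    by (intro mult_right_mono) (auto intro: integral_nonneg_AE)
  also have "\<dots> < \<epsilon>" using l by (simp add: pos_less_divide_eq add_nonneg_pos mult.commute)
  finally show "\<exists>l. sqdist (stepf l) (\<lambda>t. a * g t) < \<epsilon>" by (rule exI[of _ "step_scale a l"])
qed

lemma step_approx_sum:
  "finite I \<Longrightarrow> (\<And>i. i \<in> I \<Longrightarrow> step_approx (g i)) \<Longrightarrow> step_approx (\<lambda>t. \<Sum>i\<in>I. g i t)"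
proof (induction I rule: finite_induct)
  case empty
  have "stepf [] = (\<lambda>t. 0)" by (rule ext) simp
  then show ?case using step_approx_step[of "[]"] by simp
next
  case (insert i I)
  then show ?case by (simp add: step_approx_add)
qed

lemma step_approx_one: "step_approx (\<lambda>t. 1)"
proof (rule step_approx_bounded_limit)
  show "step_approx (stepf [(1, real k)])" for k by (rule step_approx_step)
  show "(\<lambda>k. stepf [(1, real k)] t) \<longlonglongrightarrow> 1" for t
  proof (rule tendsto_eventually)
    obtain n :: nat where "t \<le> real n" using real_arch_simple by blast
    then show "\<forall>\<^sub>F k in sequentially. stepf [(1, real k)] t = 1"
      by (auto simp: eventually_sequentially indicator_def intro!: exI[of _ n])
  qed
  show "cmod (stepf [(1, real k)] t) \<le> 1" for k t by (simp add: indicator_def)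
qed

lemma step_approx_indicator:
  assumes S: "S \<in> sets borel"
  shows "step_approx (indicator S)"
proof -
  have borel: "sets borel = sigma_sets UNIV (range (\<lambda>a::real. {..a}))"
    by (subst borel_eq_atMost) simp
  have "Int_stable (range (\<lambda>a::real. {..a}))" "range (\<lambda>a::real. {..a}) \<subseteq> Pow UNIV"
    by (auto simp: Int_stable_def)
  from this S[unfolded borel] show ?thesis
  proof (induction rule: sigma_sets_induct_disjoint)
    case (basic S)
    then obtain a where S: "S = {..a}" by auto
    have "indicator S = stepf [(1, a)]" by (rule ext) (simp add: S)
    show ?case unfolding \<open>indicator S = stepf [(1, a)]\<close> by (rule step_approx_step)
  next
    case empty
    have eq: "indicator {} = stepf []" by (rule ext) simp
    show ?case unfolding eq by (rule step_approx_step)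
  next
    case (compl S)
    have "indicator (UNIV - S) = (\<lambda>t. 1 + (-1) * indicator S t :: complex)"
      by (auto simp: indicator_def fun_eq_iff)
    then show ?case
      using step_approx_add[OF step_approx_one step_approx_scale[OF compl(2), of "-1"]] by simp
  next
    case (union F)
    show ?case
    proof (rule step_approx_bounded_limit)
      show "step_approx (\<lambda>t. \<Sum>i<k. indicator (F i) t)" for k
        by (intro step_approx_sum union) auto
      have sum: "(\<Sum>i<k. indicator (F i) t) = (indicator (\<Union>i<k. F i) t :: complex)" for k t
        using union(1) by (subst indicator_UN_disjoint) (auto simp: disjoint_family_on_def)
      show "cmod (\<Sum>i<k. indicator (F i) t) \<le> 1" for k :: nat and t
        unfolding sum by (simp add: indicator_def)
      show "(\<lambda>k. \<Sum>i<k. indicator (F i) t) \<longlonglongrightarrow> (indicator (\<Union>i. F i) t :: complex)" for t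
        unfolding sum by (rule LIMSEQ_indicator_UN)
    qed
  qed
qed

text \<open>Step functions are dense in \<open>L\<^sup>2\<close>: simple functions are finite
combinations of indicators, and they approximate a bounded Borel function boundedly and
pointwise.\<close>

lemma bdd_borel_step_approx:
  assumes "bdd_borel g"
  shows "step_approx g"
proof -
  obtain C where C: "\<And>t. cmod (g t) \<le> C" and g: "g \<in> borel_measurable borel"
    using assms by (auto simp: bdd_borel_def)
  obtain F where F: "\<And>i. simple_function borel (F i)" "\<And>t. (\<lambda>i. F i t) \<longlonglongrightarrow> g t"
    "\<And>i t. dist (F i t) 0 \<le> 2 * dist (g t) 0"
    using borel_measurable_implies_sequence_metric[OF g, of 0] by auto
  show ?thesis
  proof (rule step_approx_bounded_limit)
    show "step_approx (F i)" for i
    proof -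
      have fin: "finite (range (F i))" using simple_functionD(1)[OF F(1)[of i]] by simp
      have "F i = (\<lambda>t. \<Sum>y\<in>range (F i). y * indicator (F i -` {y}) t)"
      proof
        fix t
        have "(\<Sum>y\<in>range (F i). y * indicator (F i -` {y}) t) = (\<Sum>y\<in>{F i t}. y * indicator (F i -` {y}) t)"
          by (rule sum.mono_neutral_right[OF fin]) auto
        then show "F i t = (\<Sum>y\<in>range (F i). y * indicator (F i -` {y}) t)" by simp
      qed
      moreover have "F i -` {y} \<in> sets borel" for y
        using simple_functionD(2)[OF F(1)[of i], of "{y}"] by simp
      ultimately show ?thesis
        using step_approx_sum[OF fin, of "\<lambda>y t. y * indicator (F i -` {y}) t"]
          step_approx_scale step_approx_indicator by metis
    qed
    show "cmod (F i t) \<le> 2 * C" for i t using F(3)[of i t] C[of t] by simp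
  qed (rule F(2))
qed

lemma step_approx_sequence:
  assumes "bdd_borel g"
  obtains l where "(\<lambda>k::nat. sqdist (stepf (l k)) g) \<longlonglongrightarrow> 0"
proof -
  have "\<forall>k::nat. \<exists>l. sqdist (stepf l) g < 1 / real (Suc k)"
    using bdd_borel_step_approx[OF assms] unfolding step_approx_def by simp
  then obtain l where l: "\<And>k. sqdist (stepf (l k)) g < 1 / real (Suc k)" by metis
  have "(\<lambda>k. sqdist (stepf (l k)) g) \<longlonglongrightarrow> 0"
  proof (rule tendsto_sandwich[OF _ _ tendsto_const LIMSEQ_Suc[OF lim_1_over_n]])
    show "\<forall>\<^sub>F k in sequentially. 0 \<le> sqdist (stepf (l k)) g" by (auto intro: integral_nonneg_AE)
    show "\<forall>\<^sub>F k in sequentially. sqdist (stepf (l k)) g \<le> 1 / real (Suc k)" using less_imp_le[OF l] by (intro always_eventually allI)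
  qed
  then show ?thesis by (rule that)
qed

end

section \<open>The cyclic representation\<close>

context finite_borel_measure
begin

text \<open>The quadratic polynomial \<open>x \<mapsto> \<integral> (\<bar>u\<bar> x -
\<bar>v\<bar>)\<^sup>2\<close> has no negative values.\<close>

lemma bdd_borel_cauchy_schwarz:
  fixes u v :: "real \<Rightarrow> complex"
  assumes u: "bdd_borel u" and v: "bdd_borel v"
  shows "cmod (\<integral>t. cnj (u t) * v t \<partial>M) \<le> sqrt (\<integral>t. (cmod (u t))\<^sup>2 \<partial>M) * sqrt (\<integral>t. (cmod (v t))\<^sup>2 \<partial>M)"
proof -
  define U where "U = (\<integral>t. (cmod (u t))\<^sup>2 \<partial>M)"
  define V where "V = (\<integral>t. (cmod (v t))\<^sup>2 \<partial>M)"
  define W where "W = (\<integral>t. cmod (u t) * cmod (v t) \<partial>M)"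
  have nu: "bdd_borel (\<lambda>t. cmod (u t))" and nv: "bdd_borel (\<lambda>t. cmod (v t))"
    using u v by (auto simp: bdd_borel_def)
  have int: "integrable M (\<lambda>t. (cmod (u t))\<^sup>2)" "integrable M (\<lambda>t. (cmod (v t))\<^sup>2)"
    "integrable M (\<lambda>t. cmod (u t) * cmod (v t))"
    by (intro bdd_borel_integrable bdd_borel_intros u v nu nv)+
  have nn: "U \<ge> 0" "V \<ge> 0" "W \<ge> 0" unfolding U_def V_def W_def by (auto intro: integral_nonneg_AE)
  have quad: "0 \<le> U * x\<^sup>2 - 2 * W * x + V" for x
  proof -
    have "0 \<le> (\<integral>t. (cmod (u t) * x - cmod (v t))\<^sup>2 \<partial>M)" by (auto intro: integral_nonneg_AE)
    also have "\<dots> = (\<integral>t. x\<^sup>2 * (cmod (u t))\<^sup>2 - 2 * x * (cmod (u t) * cmod (v t)) + (cmod (v t))\<^sup>2 \<partial>M)"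
      by (intro Bochner_Integration.integral_cong refl) (simp add: power2_diff power_mult_distrib)
    also have "\<dots> = U * x\<^sup>2 - 2 * W * x + V"
      using int by (simp add: U_def V_def W_def)
    finally show ?thesis .
  qed
  have "W\<^sup>2 \<le> U * V"
  proof (cases "U = 0")
    case True
    have "W = 0"
    proof (rule ccontr)
      assume "W \<noteq> 0"
      then have "2 * W * ((V + 1) / (2 * W)) = V + 1" by simp
      with quad[of "(V + 1) / (2 * W)"] True show False by simp
    qed
    then show ?thesis using True by simp
  next
    case False
    then have "U > 0" using nn by simp
    then show ?thesis using quad[of "W / U"] by (simp add: field_simps power2_eq_square)
  qed
  then have "W \<le> sqrt (U * V)" by (rule real_le_rsqrt)
  moreover have "cmod (\<integral>t. cnj (u t) * v t \<partial>M) \<le> W"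
    unfolding W_def using integral_norm_bound[of M "\<lambda>t. cnj (u t) * v t"] by (simp add: norm_mult)
  ultimately show ?thesis by (simp add: U_def V_def real_sqrt_mult)
qed

lemma sqdist_inner_tendsto:
  assumes bdd: "\<And>k. bdd_borel (u k)" "\<And>k. bdd_borel (v k)" "bdd_borel g" "bdd_borel h"
    and u: "(\<lambda>k. sqdist (u k) g) \<longlonglongrightarrow> 0" and v: "(\<lambda>k. sqdist (v k) h) \<longlonglongrightarrow> 0"
  shows "(\<lambda>k::nat. \<integral>t. cnj (u k t) * v k t \<partial>M) \<longlonglongrightarrow> (\<integral>t. cnj (g t) * h t \<partial>M)"
proof -
  define G where "G = sqrt (\<integral>t. (cmod (g t))\<^sup>2 \<partial>M)"
  define H where "H = sqrt (\<integral>t. (cmod (h t))\<^sup>2 \<partial>M)"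
  define a where "a k = sqrt (sqdist (u k) g)" for k
  define b where "b k = sqrt (sqdist (v k) h)" for k
  have a: "a \<longlonglongrightarrow> 0" using tendsto_real_sqrt[OF u] by (simp add: a_def[abs_def])
  have b: "b \<longlonglongrightarrow> 0" using tendsto_real_sqrt[OF v] by (simp add: b_def[abs_def])
  have "norm ((\<integral>t. cnj (u k t) * v k t \<partial>M) - (\<integral>t. cnj (g t) * h t \<partial>M)) \<le> a k * b k + a k * H + G * b k" for k
  proof -
    have bd: "bdd_borel (\<lambda>t. u k t - g t)" "bdd_borel (\<lambda>t. v k t - h t)"
      by (intro bdd_borel_diff bdd)+
    have "(\<integral>t. cnj (u k t) * v k t \<partial>M) - (\<integral>t. cnj (g t) * h t \<partial>M)
        = (\<integral>t. cnj (u k t) * v k t - cnj (g t) * h t \<partial>M)"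
      by (intro Bochner_Integration.integral_diff[symmetric] bdd_borel_integrable bdd_borel_intros bdd)
    also have "\<dots> = (\<integral>t. cnj (u k t - g t) * (v k t - h t) + cnj (u k t - g t) * h t + cnj (g t) * (v k t - h t) \<partial>M)"
      by (intro Bochner_Integration.integral_cong refl) (simp add: algebra_simps)
    also have "\<dots> = (\<integral>t. cnj (u k t - g t) * (v k t - h t) + cnj (u k t - g t) * h t \<partial>M) + (\<integral>t. cnj (g t) * (v k t - h t) \<partial>M)"
      by (intro Bochner_Integration.integral_add bdd_borel_integrable bdd_borel_add bdd_borel_mult bdd_borel_cnj bd bdd)
    also have "(\<integral>t. cnj (u k t - g t) * (v k t - h t) + cnj (u k t - g t) * h t \<partial>M)
       = (\<integral>t. cnj (u k t - g t) * (v k t - h t) \<partial>M) + (\<integral>t. cnj (u k t - g t) * h t \<partial>M)"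
      by (intro Bochner_Integration.integral_add bdd_borel_integrable bdd_borel_mult bdd_borel_cnj bd bdd)
    finally have eq: "(\<integral>t. cnj (u k t) * v k t \<partial>M) - (\<integral>t. cnj (g t) * h t \<partial>M)
       = (\<integral>t. cnj (u k t - g t) * (v k t - h t) \<partial>M) + (\<integral>t. cnj (u k t - g t) * h t \<partial>M)
         + (\<integral>t. cnj (g t) * (v k t - h t) \<partial>M)" .
    show ?thesis
      unfolding eq a_def b_def G_def H_def
      by (intro order_trans[OF norm_triangle_ineq] add_mono bdd_borel_cauchy_schwarz bd bdd)
  qed
  then have bound: "\<forall>\<^sub>F k in sequentially. norm ((\<integral>t. cnj (u k t) * v k t \<partial>M) - (\<integral>t. cnj (g t) * h t \<partial>M))
      \<le> a k * b k + a k * H + G * b k"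
    by (intro always_eventually allI)
  have "(\<lambda>k. a k * b k + a k * H + G * b k) \<longlonglongrightarrow> 0 * 0 + 0 * H + G * 0"
    by (intro tendsto_intros a b)
  then have "(\<lambda>k. a k * b k + a k * H + G * b k) \<longlonglongrightarrow> 0" by simp
  with bound have "(\<lambda>k. (\<integral>t. cnj (u k t) * v k t \<partial>M) - (\<integral>t. cnj (g t) * h t \<partial>M)) \<longlonglongrightarrow> 0"
    by (rule Lim_null_comparison)
  then show ?thesis by (rule LIM_zero_cancel)
qed

lemma sqdist_integral_tendsto:
  assumes "\<And>k. bdd_borel (u k)" "bdd_borel g" and "(\<lambda>k. sqdist (u k) g) \<longlonglongrightarrow> 0"
  shows "(\<lambda>k::nat. \<integral>t. u k t \<partial>M) \<longlonglongrightarrow> (\<integral>t. g t \<partial>M)"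
  using sqdist_inner_tendsto[of "\<lambda>_ _. 1" u "\<lambda>_. 1" g] assms by (simp add: bdd_borel_const)

end

lemma (in finite_borel_measure) complex_integral_indicator:
  assumes "S \<in> sets borel"
  shows "integral\<^sup>L M (indicator S) = complex_of_real (measure M S)"
proof -
  have "integral\<^sup>L M (indicator S) = (\<integral>t. complex_of_real (indicator S t) \<partial>M)"
    by (intro Bochner_Integration.integral_cong refl) (simp add: indicator_def)
  then show ?thesis using assms by (simp add: borel_UNIV)
qed

lemma cnj_mult_self: "cnj z * z = complex_of_real ((cmod z)\<^sup>2)"
  by (metis complex_norm_square mult.commute)

text \<open>\<open>rep E \<phi> g \<eta>\<close> says that \<open>\<eta>\<close> is
\<open>g(A)\<phi>\<close>: it is the image of \<open>g\<close> under the isometry of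
\<open>L\<^sup>2(smeas E \<phi>)\<close> onto the cyclic subspace of \<open>\<phi>\<close> that
takes \<open>stepf l\<close> to \<open>stepv E l \<phi>\<close>. Through approximating sequences
this can be said without constructing the space \<open>L\<^sup>2\<close>.\<close>

definition rep :: "(real \<Rightarrow> 'h::complex_hilbert_space \<Rightarrow> 'h) \<Rightarrow> 'h \<Rightarrow> (real \<Rightarrow> complex) \<Rightarrow> 'h \<Rightarrow> bool"
  where "rep E \<phi> g \<eta> \<longleftrightarrow> (\<exists>l. (\<lambda>k::nat. stepv E (l k) \<phi>) \<longlonglongrightarrow> \<eta> \<and>
    (\<lambda>k. \<integral>t. (cmod (stepf (l k) t - g t))\<^sup>2 \<partial>smeas E \<phi>) \<longlonglongrightarrow> 0)"

lemma repI:
  "(\<lambda>k. stepv E (l k) \<phi>) \<longlonglongrightarrow> \<eta> \<Longrightarrow> (\<lambda>k. \<integral>t. (cmod (stepf (l k) t - g t))\<^sup>2 \<partial>smeas E \<phi>) \<longlonglongrightarrow> 0 \<Longrightarrow> rep E \<phi> g \<eta>"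
  unfolding rep_def by blast

context
  fixes E :: "real \<Rightarrow> 'h::complex_hilbert_space \<Rightarrow> 'h"
  assumes sf: "spectral_family E"
begin

lemma stepv_add: "stepv E l (\<phi> + \<psi>) = stepv E l \<phi> + stepv E l \<psi>"
  by (induction l) (auto simp: sf_add[OF sf] scaleC_add_right)

lemma stepv_scaleC: "stepv E l (c *\<^sub>C \<phi>) = c *\<^sub>C stepv E l \<phi>"
  by (induction l) (auto simp: sf_scaleC[OF sf] scaleC_add_right scaleC_scaleC mult.commute)

text \<open>The isometry on step functions: \<open>E(s) E(t) = E(min s t)\<close> matches the
product of two indicators of half-lines.\<close>

lemma stepv_inner:
  "cinner (stepv E l \<phi>) (stepv E l' \<phi>) = (\<integral>t. cnj (stepf l t) * stepf l' t \<partial>smeas E \<phi>)"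
proof -
  interpret finite_borel_measure "smeas E \<phi>" by (rule smeas_finite[OF sf])
  have ind: "bdd_borel (indicator {..s} :: real \<Rightarrow> complex)" for s by (rule bdd_borel_indicator) simp
  have 1: "cinner (E s \<phi>) (stepv E l' \<phi>) = (\<integral>t. indicator {..s} t * stepf l' t \<partial>smeas E \<phi>)" for s
  proof (induction l')
    case (Cons p l')
    have "(\<integral>t. indicator {..s} t * stepf (p # l') t \<partial>smeas E \<phi>)
      = (\<integral>t. fst p * indicator {..min s (snd p)} t + indicator {..s} t * stepf l' t \<partial>smeas E \<phi>)"
      by (intro Bochner_Integration.integral_cong refl) (auto simp: indicator_def)
    also have "\<dots> = (\<integral>t. fst p * indicator {..min s (snd p)} t \<partial>smeas E \<phi>) + (\<integral>t. indicator {..s} t * stepf l' t \<partial>smeas E \<phi>)"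
      by (intro Bochner_Integration.integral_add bdd_borel_integrable bdd_borel_intros ind stepf_bdd)
    also have "(\<integral>t. fst p * indicator {..min s (snd p)} t \<partial>smeas E \<phi>) = fst p * complex_of_real (cdf (smeas E \<phi>) (min s (snd p)))"
      by (simp add: cdf_def complex_integral_indicator)
    finally show ?case
      by (simp add: cinner_add_right cinner_scaleC_right sf_inner[OF sf] smeas_cdf[OF sf] Cons.IH)
  qed simp
  show ?thesis
  proof (induction l)
    case (Cons p l)
    have "(\<integral>t. cnj (stepf (p # l) t) * stepf l' t \<partial>smeas E \<phi>)
      = (\<integral>t. cnj (fst p) * (indicator {..snd p} t * stepf l' t) + cnj (stepf l t) * stepf l' t \<partial>smeas E \<phi>)"
      by (intro Bochner_Integration.integral_cong refl) (auto simp: indicator_def algebra_simps)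
    also have "\<dots> = (\<integral>t. cnj (fst p) * (indicator {..snd p} t * stepf l' t) \<partial>smeas E \<phi>) + (\<integral>t. cnj (stepf l t) * stepf l' t \<partial>smeas E \<phi>)"
      by (intro Bochner_Integration.integral_add bdd_borel_integrable bdd_borel_intros ind stepf_bdd)
    also have "(\<integral>t. cnj (fst p) * (indicator {..snd p} t * stepf l' t) \<partial>smeas E \<phi>) = cnj (fst p) * cinner (E (snd p) \<phi>) (stepv E l' \<phi>)"
      by (simp add: 1)
    finally show ?case
      by (simp add: cinner_add_left cinner_scaleC_left Cons.IH)
  qed simp
qed

lemma rep_inner:
  assumes "rep E \<phi> g \<eta>" "rep E \<phi> h \<zeta>" "bdd_borel g" "bdd_borel h"
  shows "cinner \<eta> \<zeta> = (\<integral>t. cnj (g t) * h t \<partial>smeas E \<phi>)"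
proof -
  interpret finite_borel_measure "smeas E \<phi>" by (rule smeas_finite[OF sf])
  from assms(1) obtain l where l: "(\<lambda>k. stepv E (l k) \<phi>) \<longlonglongrightarrow> \<eta>" "(\<lambda>k. sqdist (stepf (l k)) g) \<longlonglongrightarrow> 0"
    unfolding rep_def by blast
  from assms(2) obtain l' where l': "(\<lambda>k. stepv E (l' k) \<phi>) \<longlonglongrightarrow> \<zeta>" "(\<lambda>k. sqdist (stepf (l' k)) h) \<longlonglongrightarrow> 0"
    unfolding rep_def by blast
  have "(\<lambda>k. cinner (stepv E (l k) \<phi>) (stepv E (l' k) \<phi>)) \<longlonglongrightarrow> cinner \<eta> \<zeta>"
    by (intro tendsto_cinner l l')
  moreover have "(\<lambda>k. cinner (stepv E (l k) \<phi>) (stepv E (l' k) \<phi>)) \<longlonglongrightarrow> (\<integral>t. cnj (g t) * h t \<partial>smeas E \<phi>)"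
    unfolding stepv_inner by (intro sqdist_inner_tendsto stepf_bdd assms l l')
  ultimately show ?thesis by (rule LIMSEQ_unique)
qed

lemma rep_norm_sq:
  assumes "rep E \<phi> g \<eta>" "bdd_borel g"
  shows "(norm \<eta>)\<^sup>2 = (\<integral>t. (cmod (g t))\<^sup>2 \<partial>smeas E \<phi>)"
proof -
  have "complex_of_real ((norm \<eta>)\<^sup>2) = (\<integral>t. complex_of_real ((cmod (g t))\<^sup>2) \<partial>smeas E \<phi>)"
    using rep_inner[OF assms(1,1,2,2)] by (simp only: cinner_self cnj_mult_self)
  then show ?thesis by (simp only: integral_complex_of_real of_real_eq_iff)
qed

lemma rep_step: "rep E \<phi> (stepf l) (stepv E l \<phi>)"
  unfolding rep_def by (intro exI[of _ "\<lambda>_. l"]) simp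

lemma rep_scale:
  assumes "rep E \<phi> g \<eta>"
  shows "rep E \<phi> (\<lambda>t. a * g t) (a *\<^sub>C \<eta>)"
proof -
  from assms obtain l where l: "(\<lambda>k. stepv E (l k) \<phi>) \<longlonglongrightarrow> \<eta>"
    "(\<lambda>k. \<integral>t. (cmod (stepf (l k) t - g t))\<^sup>2 \<partial>smeas E \<phi>) \<longlonglongrightarrow> 0"
    unfolding rep_def by blast
  have "(\<lambda>k. cmod a * norm (stepv E (l k) \<phi> - \<eta>)) \<longlonglongrightarrow> cmod a * 0"
    by (intro tendsto_mult_left l(1)[THEN tendsto_norm_diff_iff[THEN iffD1]])
  then have "(\<lambda>k. norm (stepv E (step_scale a (l k)) \<phi> - a *\<^sub>C \<eta>)) \<longlonglongrightarrow> 0"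
    by (simp add: scaleC_diff_right[symmetric] norm_scaleC)
  then have "(\<lambda>k. stepv E (step_scale a (l k)) \<phi>) \<longlonglongrightarrow> a *\<^sub>C \<eta>" by (rule tendsto_norm_diff_iff[THEN iffD2])
  moreover have "(\<lambda>k. (cmod a)\<^sup>2 * (\<integral>t. (cmod (stepf (l k) t - g t))\<^sup>2 \<partial>smeas E \<phi>)) \<longlonglongrightarrow> (cmod a)\<^sup>2 * 0"
    by (intro tendsto_mult_left l)
  then have "(\<lambda>k. \<integral>t. (cmod (stepf (step_scale a (l k)) t - a * g t))\<^sup>2 \<partial>smeas E \<phi>) \<longlonglongrightarrow> 0"
    by (simp add: right_diff_distrib[symmetric] norm_mult power_mult_distrib)
  ultimately show ?thesis by (rule repI)
qed

lemma rep_add: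
  assumes "rep E \<phi> g \<eta>" "rep E \<phi> h \<zeta>" "bdd_borel g" "bdd_borel h"
  shows "rep E \<phi> (\<lambda>t. g t + h t) (\<eta> + \<zeta>)"
proof -
  interpret finite_borel_measure "smeas E \<phi>" by (rule smeas_finite[OF sf])
  from assms(1) obtain l where l: "(\<lambda>k. stepv E (l k) \<phi>) \<longlonglongrightarrow> \<eta>" "(\<lambda>k. sqdist (stepf (l k)) g) \<longlonglongrightarrow> 0"
    unfolding rep_def by blast
  from assms(2) obtain l' where l': "(\<lambda>k. stepv E (l' k) \<phi>) \<longlonglongrightarrow> \<zeta>" "(\<lambda>k. sqdist (stepf (l' k)) h) \<longlonglongrightarrow> 0"
    unfolding rep_def by blast
  have "(\<lambda>k. stepv E (l k @ l' k) \<phi>) \<longlonglongrightarrow> \<eta> + \<zeta>"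
    unfolding stepv_append by (intro tendsto_add l l')
  moreover have "(\<lambda>k. sqdist (stepf (l k @ l' k)) (\<lambda>t. g t + h t)) \<longlonglongrightarrow> 0"
  proof (rule tendsto_sandwich[OF _ _ tendsto_const])
    have "sqdist (stepf (l k @ l' k)) (\<lambda>t. g t + h t) \<le> 2 * sqdist (stepf (l k)) g + 2 * sqdist (stepf (l' k)) h" for k
    proof -
      have sh: "bdd_borel (\<lambda>t. stepf (l k) t + h t)" by (intro bdd_borel_add stepf_bdd assms)
      have "sqdist (stepf (l k @ l' k)) (\<lambda>t. g t + h t)
        \<le> 2 * sqdist (stepf (l k @ l' k)) (\<lambda>t. stepf (l k) t + h t) + 2 * sqdist (\<lambda>t. stepf (l k) t + h t) (\<lambda>t. g t + h t)"
        by (intro sqdist_triangle stepf_bdd sh bdd_borel_add assms)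
      then show ?thesis by simp
    qed
    then show "\<forall>\<^sub>F k in sequentially. sqdist (stepf (l k @ l' k)) (\<lambda>t. g t + h t)
        \<le> 2 * sqdist (stepf (l k)) g + 2 * sqdist (stepf (l' k)) h"
      by (intro always_eventually allI)
    show "(\<lambda>k. 2 * sqdist (stepf (l k)) g + 2 * sqdist (stepf (l' k)) h) \<longlonglongrightarrow> 0"
      using tendsto_add[OF tendsto_mult_left[OF l(2), of 2] tendsto_mult_left[OF l'(2), of 2]] by simp
  qed (auto intro: integral_nonneg_AE)
  ultimately show ?thesis by (rule repI)
qed

lemma rep_diff:
  assumes "rep E \<phi> g \<eta>" "rep E \<phi> h \<zeta>" "bdd_borel g" "bdd_borel h"
  shows "rep E \<phi> (\<lambda>t. g t - h t) (\<eta> - \<zeta>)"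
proof -
  have "bdd_borel (\<lambda>t. - 1 * h t)" by (intro bdd_borel_intros assms)
  from rep_add[OF assms(1) rep_scale[OF assms(2)] assms(3) this]
  show ?thesis by (simp add: scaleC_minus_left)
qed

lemma rep_unique:
  assumes "rep E \<phi> g \<eta>" "rep E \<phi> h \<zeta>" "bdd_borel g" "bdd_borel h" "AE t in smeas E \<phi>. g t = h t"
  shows "\<eta> = \<zeta>"
proof -
  have "(norm (\<eta> - \<zeta>))\<^sup>2 = (\<integral>t. (cmod (g t - h t))\<^sup>2 \<partial>smeas E \<phi>)"
    by (intro rep_norm_sq rep_diff bdd_borel_diff assms)
  also have "\<dots> = 0"
    by (rule integral_eq_zero_AE) (use assms(5) in auto)
  finally show ?thesis by simp
qed

text \<open>The isometry carries a convergent sequence of step functions to a Cauchy sequence of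
vectors.\<close>

lemma sqdist_converges_rep:
  assumes l: "(\<lambda>k::nat. \<integral>t. (cmod (stepf (l k) t - g t))\<^sup>2 \<partial>smeas E \<phi>) \<longlonglongrightarrow> 0" and g: "bdd_borel g"
  obtains \<eta> where "(\<lambda>k. stepv E (l k) \<phi>) \<longlonglongrightarrow> \<eta>" "rep E \<phi> g \<eta>"
proof -
  interpret finite_borel_measure "smeas E \<phi>" by (rule smeas_finite[OF sf])
  have gs: "sqdist g (stepf m) = sqdist (stepf m) g" for m by (simp add: norm_minus_commute)
  have "Cauchy (\<lambda>k. stepv E (l k) \<phi>)"
  proof (rule CauchyI)
    fix e :: real assume "e > 0"
    then have "e\<^sup>2 / 4 > 0" by simp
    from order_tendstoD(2)[OF l this] obtain N where
      N: "\<And>k. k \<ge> N \<Longrightarrow> sqdist (stepf (l k)) g < e\<^sup>2 / 4" by (auto simp: eventually_sequentially)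
    show "\<exists>N. \<forall>m\<ge>N. \<forall>n\<ge>N. norm (stepv E (l m) \<phi> - stepv E (l n) \<phi>) < e"
    proof (intro exI allI impI)
      fix m n assume mn: "m \<ge> N" "n \<ge> N"
      have "(norm (stepv E (l m) \<phi> - stepv E (l n) \<phi>))\<^sup>2 = sqdist (stepf (l m)) (stepf (l n))"
        by (intro rep_norm_sq rep_diff rep_step stepf_bdd bdd_borel_diff)
      also have "\<dots> \<le> 2 * sqdist (stepf (l m)) g + 2 * sqdist g (stepf (l n))"
        by (intro sqdist_triangle stepf_bdd g)
      also have "\<dots> < e\<^sup>2" using N[OF mn(1)] N[OF mn(2)] gs[of "l n"] by linarith
      finally show "norm (stepv E (l m) \<phi> - stepv E (l n) \<phi>) < e"
        using \<open>e > 0\<close> by (simp add: power_less_imp_less_base)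
    qed
  qed
  then obtain \<eta> where "(\<lambda>k. stepv E (l k) \<phi>) \<longlonglongrightarrow> \<eta>"
    using Cauchy_convergent_iff convergent_def by blast
  then show ?thesis using that l unfolding rep_def by blast
qed

lemma rep_exists:
  assumes "bdd_borel g"
  obtains \<eta> where "rep E \<phi> g \<eta>"
proof -
  interpret finite_borel_measure "smeas E \<phi>" by (rule smeas_finite[OF sf])
  obtain l where "(\<lambda>k::nat. sqdist (stepf (l k)) g) \<longlonglongrightarrow> 0"
    using step_approx_sequence[OF assms] .
  from sqdist_converges_rep[OF this assms] that show ?thesis by blast
qed

lemma rep_one: "rep E \<phi> (\<lambda>t. 1) \<phi>"
proof -
  interpret finite_borel_measure "smeas E \<phi>" by (rule smeas_finite[OF sf])
  have "(\<lambda>k. stepv E [(1, real k)] \<phi>) \<longlonglongrightarrow> \<phi>"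
    using filterlim_compose[OF sf_top[OF sf, of \<phi>] filterlim_real_sequentially] by simp
  moreover have "(\<lambda>k. sqdist (stepf [(1, real k)]) (\<lambda>t. 1)) \<longlonglongrightarrow> 0"
  proof -
    have "sqdist (stepf [(1, real k)]) (\<lambda>t. 1) = measure (smeas E \<phi>) UNIV - cdf (smeas E \<phi>) (real k)" for k
    proof -
      have "sqdist (stepf [(1, real k)]) (\<lambda>t. 1) = (\<integral>t. 1 - indicator {..real k} t \<partial>smeas E \<phi>)"
        by (intro Bochner_Integration.integral_cong refl) (simp add: indicator_def)
      also have "\<dots> = (\<integral>t. 1 \<partial>smeas E \<phi>) - (\<integral>t. indicator {..real k} t \<partial>smeas E \<phi>)"
        by (intro Bochner_Integration.integral_diff bdd_borel_integrable bdd_borel_const bdd_borel_indicator) simp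
      finally show ?thesis by (simp add: borel_UNIV cdf_def)
    qed
    then show ?thesis
      using tendsto_diff[OF tendsto_const cdf_lim_infty, of "measure (smeas E \<phi>) UNIV"] by (simp add: borel_UNIV)
  qed
  ultimately show ?thesis by (rule repI)
qed

text \<open>\<open>E(s)\<close> acts as multiplication by the indicator of \<open>(-\<infinity>,
s]\<close>: on step functions it replaces each threshold \<open>u\<close> by \<open>min s
u\<close>.\<close>

lemma rep_truncate:
  assumes "rep E \<phi> g \<eta>" "bdd_borel g"
  shows "rep E \<phi> (\<lambda>t. indicator {..s} t * g t) (E s \<eta>)"
proof -
  interpret finite_borel_measure "smeas E \<phi>" by (rule smeas_finite[OF sf])
  from assms(1) obtain l where l: "(\<lambda>k. stepv E (l k) \<phi>) \<longlonglongrightarrow> \<eta>" "(\<lambda>k. sqdist (stepf (l k)) g) \<longlonglongrightarrow> 0"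
    unfolding rep_def by blast
  define cut where "cut = map (\<lambda>(c::complex, u). (c, min s u))"
  have v: "stepv E (cut m) \<phi> = E s (stepv E m \<phi>)" for m
  proof (induction m)
    case Nil
    show ?case using sf_scaleC[OF sf, of s 0 0] by (simp add: cut_def)
  qed (auto simp: cut_def sf_add[OF sf] sf_scaleC[OF sf] sf_min[OF sf])
  have f: "stepf (cut m) t = indicator {..s} t * stepf m t" for m t
    by (induction m) (auto simp: cut_def indicator_def)
  have "(\<lambda>k. stepv E (cut (l k)) \<phi>) \<longlonglongrightarrow> E s \<eta>"
    unfolding v by (rule sf_tendsto[OF sf l(1)])
  moreover have "(\<lambda>k. sqdist (stepf (cut (l k))) (\<lambda>t. indicator {..s} t * g t)) \<longlonglongrightarrow> 0"
  proof (rule tendsto_sandwich[OF _ _ tendsto_const l(2)])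
    have "sqdist (stepf (cut (l k))) (\<lambda>t. indicator {..s} t * g t) \<le> sqdist (stepf (l k)) g" for k
      by (intro integral_mono bdd_borel_integrable bdd_borel_intros stepf_bdd assms bdd_borel_indicator)
        (auto simp: f indicator_def)
    then show "\<forall>\<^sub>F k in sequentially. sqdist (stepf (cut (l k))) (\<lambda>t. indicator {..s} t * g t) \<le> sqdist (stepf (l k)) g"
      by (intro always_eventually allI)
  qed (auto intro: integral_nonneg_AE)
  ultimately show ?thesis by (rule repI)
qed

text \<open>The distribution function of \<open>smeas E \<eta>\<close> at \<open>s\<close> is
\<open>\<parallel>E(s)\<eta>\<parallel>\<^sup>2\<close>, which \<open>rep_truncate\<close> and the
isometry evaluate as an integral of \<open>\<bar>g\<bar>\<^sup>2\<close>.\<close>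

lemma smeas_rep:
  assumes "rep E \<phi> g \<eta>" "bdd_borel g"
  shows "smeas E \<eta> = density (smeas E \<phi>) (\<lambda>t. ennreal ((cmod (g t))\<^sup>2))"
proof (rule cdf_unique')
  interpret finite_borel_measure "smeas E \<phi>" by (rule smeas_finite[OF sf])
  let ?D = "density (smeas E \<phi>) (\<lambda>t. ennreal ((cmod (g t))\<^sup>2))"
  have [measurable]: "g \<in> borel_measurable (smeas E \<phi>)"
    using assms(2) by (simp add: bdd_borel_def measurable_cong_sets[OF M_is_borel refl])
  have D: "emeasure ?D S = ennreal (\<integral>t. indicator S t * (cmod (g t))\<^sup>2 \<partial>smeas E \<phi>)" if "S \<in> sets borel" for S
  proof -
    have "emeasure ?D S = (\<integral>\<^sup>+t. ennreal (indicator S t * (cmod (g t))\<^sup>2) \<partial>smeas E \<phi>)"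
      using that by (subst emeasure_density)
        (auto simp: M_is_borel intro!: nn_integral_cong simp: indicator_def)
    also have "\<dots> = ennreal (\<integral>t. indicator S t * (cmod (g t))\<^sup>2 \<partial>smeas E \<phi>)"
      by (intro nn_integral_eq_integral bdd_borel_integrable bdd_borel_intros bdd_borel_indicator assms that) auto
    finally show ?thesis .
  qed
  show "finite_borel_measure ?D"
  proof (intro finite_borel_measure.intro finite_borel_measure_axioms.intro finite_measureI)
    have "emeasure ?D (space ?D) = ennreal (\<integral>t. indicator UNIV t * (cmod (g t))\<^sup>2 \<partial>smeas E \<phi>)"
      unfolding space_density borel_UNIV by (rule D) simp
    then show "emeasure ?D (space ?D) \<noteq> \<infinity>" by simp
  qed (simp add: M_is_borel)
  show "cdf (smeas E \<eta>) = cdf ?D"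
  proof
    fix s
    have "cdf (smeas E \<eta>) s = (\<integral>t. (cmod (indicator {..s} t * g t))\<^sup>2 \<partial>smeas E \<phi>)"
      unfolding smeas_cdf[OF sf]
      by (intro rep_norm_sq rep_truncate assms bdd_borel_intros bdd_borel_indicator) simp
    also have "\<dots> = (\<integral>t. indicator {..s} t * (cmod (g t))\<^sup>2 \<partial>smeas E \<phi>)"
      by (intro Bochner_Integration.integral_cong refl) (simp add: indicator_def)
    also have "\<dots> = cdf ?D s"
      unfolding cdf_def measure_def by (subst D) (auto intro!: integral_nonneg_AE)
    finally show "cdf (smeas E \<eta>) s = cdf ?D s" .
  qed
qed (rule smeas_finite[OF sf])

lemma
  fixes u :: "real \<Rightarrow> 'b::{banach, second_countable_topology}"
  assumes r: "rep E \<phi> g \<eta>" "bdd_borel g" and u: "u \<in> borel_measurable borel"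
  shows integral_smeas_rep: "(\<integral>t. u t \<partial>smeas E \<eta>) = (\<integral>t. (cmod (g t))\<^sup>2 *\<^sub>R u t \<partial>smeas E \<phi>)"
    and integrable_smeas_rep: "integrable (smeas E \<eta>) u \<longleftrightarrow> integrable (smeas E \<phi>) (\<lambda>t. (cmod (g t))\<^sup>2 *\<^sub>R u t)"
proof -
  interpret finite_borel_measure "smeas E \<phi>" by (rule smeas_finite[OF sf])
  have m: "g \<in> borel_measurable (smeas E \<phi>)" "u \<in> borel_measurable (smeas E \<phi>)"
    using r(2) u by (simp_all add: bdd_borel_def measurable_cong_sets[OF M_is_borel refl])
  show "(\<integral>t. u t \<partial>smeas E \<eta>) = (\<integral>t. (cmod (g t))\<^sup>2 *\<^sub>R u t \<partial>smeas E \<phi>)"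
    unfolding smeas_rep[OF r] using m by (intro integral_density) auto
  show "integrable (smeas E \<eta>) u \<longleftrightarrow> integrable (smeas E \<phi>) (\<lambda>t. (cmod (g t))\<^sup>2 *\<^sub>R u t)"
    unfolding smeas_rep[OF r] using m by (intro integrable_density) auto
qed

lemma rep_step_mult:
  assumes "rep E \<phi> g \<omega>" "bdd_borel g"
  shows "rep E \<phi> (\<lambda>t. stepf l t * g t) (stepv E l \<omega>)"
proof (induction l)
  case Nil
  show ?case using rep_scale[OF assms(1), of 0] by simp
next
  case (Cons p l)
  have b: "bdd_borel (\<lambda>t. fst p * (indicator {..snd p} t * g t))" "bdd_borel (\<lambda>t. stepf l t * g t)"
    by (intro bdd_borel_intros bdd_borel_indicator stepf_bdd assms; simp)+
  from rep_add[OF rep_scale[OF rep_truncate[OF assms]] Cons.IH b]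
  show ?case by (simp add: distrib_right mult.assoc)
qed

text \<open>For a step function \<open>h\<close> this is \<open>rep_step_mult\<close>. Mean square
approximation of \<open>h\<close> for the measure of \<open>\<omega>\<close> is approximation of
\<open>h g\<close> for the measure of \<open>\<phi>\<close>, because the density is
\<open>\<bar>g\<bar>\<^sup>2\<close>.\<close>

lemma rep_mult:
  assumes g: "rep E \<phi> g \<omega>" "bdd_borel g" and h: "rep E \<omega> h \<eta>" "bdd_borel h"
  shows "rep E \<phi> (\<lambda>t. h t * g t) \<eta>"
proof -
  interpret finite_borel_measure "smeas E \<phi>" by (rule smeas_finite[OF sf])
  have hg: "bdd_borel (\<lambda>t. h t * g t)" by (intro bdd_borel_intros g h)
  obtain \<eta>' where \<eta>': "rep E \<phi> (\<lambda>t. h t * g t) \<eta>'" using rep_exists[OF hg] .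
  from h(1) obtain l where l: "(\<lambda>k. stepv E (l k) \<omega>) \<longlonglongrightarrow> \<eta>"
    "(\<lambda>k. \<integral>t. (cmod (stepf (l k) t - h t))\<^sup>2 \<partial>smeas E \<omega>) \<longlonglongrightarrow> 0"
    unfolding rep_def by blast
  have "(norm (stepv E (l k) \<omega> - \<eta>'))\<^sup>2 = (\<integral>t. (cmod (stepf (l k) t - h t))\<^sup>2 \<partial>smeas E \<omega>)" for k
  proof -
    have b: "bdd_borel (\<lambda>t. stepf (l k) t * g t)" by (intro bdd_borel_intros stepf_bdd g)
    have "(norm (stepv E (l k) \<omega> - \<eta>'))\<^sup>2 = (\<integral>t. (cmod (stepf (l k) t * g t - h t * g t))\<^sup>2 \<partial>smeas E \<phi>)"
      by (intro rep_norm_sq rep_diff rep_step_mult bdd_borel_diff g b hg \<eta>')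
    also have "\<dots> = (\<integral>t. (cmod (g t))\<^sup>2 *\<^sub>R (cmod (stepf (l k) t - h t))\<^sup>2 \<partial>smeas E \<phi>)"
      by (intro Bochner_Integration.integral_cong refl)
        (simp add: left_diff_distrib[symmetric] norm_mult power_mult_distrib)
    also have "\<dots> = (\<integral>t. (cmod (stepf (l k) t - h t))\<^sup>2 \<partial>smeas E \<omega>)"
      by (intro integral_smeas_rep[symmetric] g bdd_borel_measurable bdd_borel_intros stepf_bdd h)
    finally show ?thesis .
  qed
  with l(2) have "(\<lambda>k. (norm (stepv E (l k) \<omega> - \<eta>'))\<^sup>2) \<longlonglongrightarrow> 0" by simp
  from tendsto_real_sqrt[OF this] have "(\<lambda>k. norm (stepv E (l k) \<omega> - \<eta>')) \<longlonglongrightarrow> 0" by simp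
  then have "(\<lambda>k. stepv E (l k) \<omega>) \<longlonglongrightarrow> \<eta>'" by (rule tendsto_norm_diff_iff[THEN iffD2])
  then have "\<eta>' = \<eta>" using l(1) by (rule LIMSEQ_unique)
  then show ?thesis using \<eta>' by simp
qed

lemma rep_cinner_self:
  assumes "rep E \<phi> g \<eta>" "bdd_borel g"
  shows "cinner \<phi> \<eta> = (\<integral>t. g t \<partial>smeas E \<phi>)"
  using rep_inner[OF rep_one assms(1) bdd_borel_const assms(2)] by simp

text \<open>Approximating \<open>g\<close> by step functions in mean square for \<open>smeas2 E
\<phi> \<psi>\<close> reduces the claim to the linear maps \<open>stepv E l\<close>, for which it
is the polarization identity.\<close>

lemma rep_polar:
  assumes r: "rep E \<phi> g \<eta>" and g: "bdd_borel g"
  shows "cinner \<psi> \<eta> = polar (\<lambda>\<xi>. \<integral>t. g t \<partial>smeas E \<xi>) \<psi> \<phi>"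
proof -
  interpret N: finite_borel_measure "smeas2 E \<phi> \<psi>" by (rule smeas2_finite[OF sf])
  obtain l where l: "(\<lambda>k::nat. N.sqdist (stepf (l k)) g) \<longlonglongrightarrow> 0"
    using N.step_approx_sequence[OF g] .
  have l': "(\<lambda>k. \<integral>t. (cmod (stepf (l k) t - g t))\<^sup>2 \<partial>smeas E \<xi>) \<longlonglongrightarrow> 0"
    if d: "dominated_by (smeas E \<xi>) (smeas2 E \<phi> \<psi>)" for \<xi>
  proof (rule tendsto_sandwich[OF _ _ tendsto_const l])
    have "(\<integral>t. (cmod (stepf (l k) t - g t))\<^sup>2 \<partial>smeas E \<xi>) \<le> N.sqdist (stepf (l k)) g" for k
      by (intro dominated_integral_mono smeas_finite[OF sf] smeas2_finite[OF sf] d bdd_borel_intros stepf_bdd g) simp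
    then show "\<forall>\<^sub>F k in sequentially. (\<integral>t. (cmod (stepf (l k) t - g t))\<^sup>2 \<partial>smeas E \<xi>) \<le> N.sqdist (stepf (l k)) g"
      by (intro always_eventually allI)
  qed (auto intro: integral_nonneg_AE)
  obtain \<eta>' where \<eta>': "(\<lambda>k. stepv E (l k) \<phi>) \<longlonglongrightarrow> \<eta>'" "rep E \<phi> g \<eta>'"
    using sqdist_converges_rep[OF l'[OF smeas_dominated1[OF sf]] g] .
  have "\<eta>' = \<eta>" by (rule rep_unique[OF \<eta>'(2) r g g]) simp
  with \<eta>'(1) have "(\<lambda>k. cinner \<psi> (stepv E (l k) \<phi>)) \<longlonglongrightarrow> cinner \<psi> \<eta>"
    by (intro tendsto_cinner) auto
  moreover have "(\<lambda>k. cinner \<psi> (stepv E (l k) \<phi>)) \<longlonglongrightarrow> polar (\<lambda>\<xi>. \<integral>t. g t \<partial>smeas E \<xi>) \<psi> \<phi>"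
  proof -
    have q: "(\<lambda>k. cinner \<xi> (stepv E (l k) \<xi>)) \<longlonglongrightarrow> (\<integral>t. g t \<partial>smeas E \<xi>)"
      if d: "dominated_by (smeas E \<xi>) (smeas2 E \<phi> \<psi>)" for \<xi>
      unfolding rep_cinner_self[OF rep_step stepf_bdd]
      by (intro finite_borel_measure.sqdist_integral_tendsto smeas_finite[OF sf] stepf_bdd g l' d)
    have "cinner \<psi> (stepv E m \<phi>) = polar (\<lambda>\<xi>. cinner \<xi> (stepv E m \<xi>)) \<psi> \<phi>" for m
      by (rule polarization[OF stepv_add stepv_scaleC])
    then show ?thesis
      by (simp only: polar_def) (intro tendsto_intros q smeas_dominated_polar[OF sf])
  qed
  ultimately show ?thesis by (rule LIMSEQ_unique)
qed

end

section \<open>Bounded functions of a self-adjoint operator\<close>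

lemma spectral_form_polar:
  "spectral_form E f \<psi> \<phi> = polar (\<lambda>\<xi>. complex_of_real (\<integral>t. f t \<partial>spectral_measure E \<xi>)) \<psi> \<phi>"
  by (simp add: spectral_form_def polar_def Let_def)

lemma bdd_borel_resolvent_fun:
  assumes "Im z \<noteq> 0"
  shows "bdd_borel (\<lambda>t. 1 / (complex_of_real t - z))"
proof (rule bdd_borelI[where C="1 / \<bar>Im z\<bar>"])
  show "(\<lambda>t. 1 / (complex_of_real t - z)) \<in> borel_measurable borel" by measurable
  show "norm (1 / (complex_of_real t - z)) \<le> 1 / \<bar>Im z\<bar>" for t
    using abs_Im_le_cmod[of "complex_of_real t - z"] assms
    by (simp add: norm_divide divide_simps)
qed

context
  fixes E :: "real \<Rightarrow> 'h::complex_hilbert_space \<Rightarrow> 'h"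
  assumes sf: "spectral_family E"
begin

lemma integral_borel_version:
  fixes f g :: "real \<Rightarrow> real"
  assumes "f \<in> borel_measurable (spectral_measure E \<phi>)" "bdd_borel g" "AE t in smeas E \<phi>. f t = g t"
  shows "(\<integral>t. f t \<partial>spectral_measure E \<phi>) = (\<integral>t. g t \<partial>smeas E \<phi>)"
proof -
  interpret finite_borel_measure "smeas E \<phi>" by (rule smeas_finite[OF sf])
  have g: "g \<in> borel_measurable (smeas E \<phi>)"
    using assms(2) by (simp add: bdd_borel_def measurable_cong_sets[OF M_is_borel refl])
  have "(\<integral>t. f t \<partial>spectral_measure E \<phi>) = (\<integral>t. g t \<partial>completion (smeas E \<phi>))"
    unfolding spectral_measure_smeas
  proof (rule integral_cong_AE)
    show "f \<in> borel_measurable (completion (smeas E \<phi>))" using assms(1) by (simp add: spectral_measure_smeas)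
  qed (intro measurable_completion AE_completion g assms(3))+
  then show ?thesis by (simp add: integral_completion[OF g])
qed

text \<open>The vector \<open>f(A)\<phi>\<close> is \<open>g(A)\<phi>\<close> for a Borel version
\<open>g\<close> of \<open>f\<close> with respect to the measure of \<open>\<phi>\<close>. To
compare with the form at \<open>\<psi>\<close>, another version \<open>h\<close> is chosen that
also fits the measure of \<open>\<psi>\<close>; it yields the same vector.\<close>

lemma bounded_function_of_operator:
  fixes f :: "real \<Rightarrow> real"
  assumes f: "spectral_measurable E f" and bdd: "\<And>t. \<bar>f t\<bar> \<le> C"
  shows "cinner \<psi> (op_app (spectral_integral E f) \<phi>) = spectral_form E f \<psi> \<phi>"
    and "cinner \<phi> (op_app (spectral_integral E f) \<phi>) = complex_of_real (\<integral>t. f t \<partial>spectral_measure E \<phi>)"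
    and "(norm (op_app (spectral_integral E f) \<phi>))\<^sup>2 = (\<integral>t. (f t)\<^sup>2 \<partial>spectral_measure E \<phi>)"
proof -
  have fm: "f \<in> borel_measurable (spectral_measure E \<xi>)" for \<xi>
    using f by (simp add: spectral_measurable_def)
  note fin = smeas_finite[OF sf] smeas2_finite[OF sf]
  obtain g where g: "bdd_borel g" and fg2: "AE t in smeas2 E \<phi> \<phi>. f t = g t"
    using common_borel_version[OF sf fm fm bdd] .
  have fg: "AE t in smeas E \<phi>. f t = g t"
    by (rule dominated_AE[OF fin smeas_dominated1[OF sf] fg2])
  have cg: "bdd_borel (\<lambda>t. complex_of_real (g t))" by (rule bdd_borel_of_real[OF g])
  obtain \<eta> where \<eta>: "rep E \<phi> (\<lambda>t. complex_of_real (g t)) \<eta>" using rep_exists[OF sf cg] .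
  have form: "cinner \<psi> \<eta> = spectral_form E f \<psi> \<phi>" for \<psi>
  proof -
    obtain h where h: "bdd_borel h" and fh2: "AE t in smeas2 E \<phi> \<psi>. f t = h t"
      using common_borel_version[OF sf fm fm bdd] .
    have fh: "AE t in smeas E \<xi>. f t = h t" if "dominated_by (smeas E \<xi>) (smeas2 E \<phi> \<psi>)" for \<xi>
      by (rule dominated_AE[OF fin that fh2])
    have ch: "bdd_borel (\<lambda>t. complex_of_real (h t))" by (rule bdd_borel_of_real[OF h])
    obtain \<eta>' where \<eta>': "rep E \<phi> (\<lambda>t. complex_of_real (h t)) \<eta>'" using rep_exists[OF sf ch] .
    have "AE t in smeas E \<phi>. complex_of_real (g t) = complex_of_real (h t)"
      using fg fh[OF smeas_dominated1[OF sf]] by eventually_elim simp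
    from rep_unique[OF sf \<eta> \<eta>' cg ch this] have "cinner \<psi> \<eta> = cinner \<psi> \<eta>'" by simp
    also have "\<dots> = polar (\<lambda>\<xi>. complex_of_real (\<integral>t. h t \<partial>smeas E \<xi>)) \<psi> \<phi>"
      using rep_polar[OF sf \<eta>' ch] by simp
    also have "\<dots> = polar (\<lambda>\<xi>. complex_of_real (\<integral>t. f t \<partial>spectral_measure E \<xi>)) \<psi> \<phi>"
      unfolding polar_def
      using smeas_dominated_polar[OF sf, THEN fh, THEN integral_borel_version[OF fm h]] by simp
    finally show ?thesis by (simp add: spectral_form_polar)
  qed
  have int: "integrable (spectral_measure E \<xi>) (\<lambda>t. (f t)\<^sup>2)" for \<xi>
  proof -
    interpret M: finite_borel_measure "smeas E \<xi>" by (rule smeas_finite[OF sf])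
    have "emeasure (spectral_measure E \<xi>) (space (spectral_measure E \<xi>)) \<noteq> \<infinity>"
      using M.emeasure_finite[of UNIV] by (simp add: spectral_measure_smeas M.borel_UNIV M.M_is_borel)
    then interpret finite_measure "spectral_measure E \<xi>" by (rule finite_measureI)
    show ?thesis
      by (rule integrable_const_bound[where B="C\<^sup>2"])
        (use fm[of \<xi>] bdd abs_le_square_iff in \<open>auto intro!: power2_le_iff_abs_le[THEN iffD2] order_trans[OF abs_ge_zero bdd]\<close>)
  qed
  have app: "op_app (spectral_integral E f) \<phi> = \<eta>"
    unfolding spectral_integral_def operator.sel
  proof (rule the_equality)
    show "\<forall>\<psi>\<in>spectral_integral_dom E f. cinner \<psi> \<eta> = spectral_form E f \<psi> \<phi>" using form by simp
    have dom: "spectral_integral_dom E f = UNIV" unfolding spectral_integral_dom_def using fm int by auto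
    show "\<eta>' = \<eta>" if "\<forall>\<psi>\<in>spectral_integral_dom E f. cinner \<psi> \<eta>' = spectral_form E f \<psi> \<phi>" for \<eta>'
      by (rule cinner_eqI) (use that form dom in simp)
  qed
  show "cinner \<psi> (op_app (spectral_integral E f) \<phi>) = spectral_form E f \<psi> \<phi>"
    unfolding app by (rule form)
  show "cinner \<phi> (op_app (spectral_integral E f) \<phi>) = complex_of_real (\<integral>t. f t \<partial>spectral_measure E \<phi>)"
    unfolding app using rep_cinner_self[OF sf \<eta> cg] integral_borel_version[OF fm g fg] by simp
  have "(norm \<eta>)\<^sup>2 = (\<integral>t. (g t)\<^sup>2 \<partial>smeas E \<phi>)"
    using rep_norm_sq[OF sf \<eta> cg] by simp
  also have "\<dots> = (\<integral>t. (f t)\<^sup>2 \<partial>spectral_measure E \<phi>)"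
  proof (rule integral_borel_version[symmetric])
    show "(\<lambda>t. (f t)\<^sup>2) \<in> borel_measurable (spectral_measure E \<phi>)" using fm[of \<phi>] by measurable
    show "bdd_borel (\<lambda>t. (g t)\<^sup>2)" using bdd_borel_norm_sq[OF g] by simp
    show "AE t in smeas E \<phi>. (f t)\<^sup>2 = (g t)\<^sup>2" using fg by eventually_elim simp
  qed
  finally show "(norm (op_app (spectral_integral E f) \<phi>))\<^sup>2 = (\<integral>t. (f t)\<^sup>2 \<partial>spectral_measure E \<phi>)"
    unfolding app .
qed

text \<open>Needed for the unbounded function \<open>t\<^sup>2\<close>, which decides membership
in the domain of \<open>A\<close>.\<close>

lemma nn_integral_smeas2:
  assumes "u \<in> borel_measurable borel"
  shows "(\<integral>\<^sup>+t. u t \<partial>smeas2 E \<phi> \<psi>) = (\<integral>\<^sup>+t. u t \<partial>smeas E \<phi>) + (\<integral>\<^sup>+t. u t \<partial>smeas E \<psi>)"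
proof -
  interpret N: finite_borel_measure "smeas2 E \<phi> \<psi>" by (rule smeas2_finite[OF sf])
  interpret M1: finite_borel_measure "smeas E \<phi>" by (rule smeas_finite[OF sf])
  interpret M2: finite_borel_measure "smeas E \<psi>" by (rule smeas_finite[OF sf])
  note m = measurable_cong_sets[OF N.M_is_borel refl] measurable_cong_sets[OF M1.M_is_borel refl]
    measurable_cong_sets[OF M2.M_is_borel refl]
  show ?thesis
    using assms
  proof (induction u rule: borel_measurable_induct)
    case (cong f g)
    then show ?case by (simp add: fun_eq_iff[symmetric])
  next
    case (set S)
    then show ?case
      by (simp add: N.M_is_borel M1.M_is_borel M2.M_is_borel N.emeasure_eq_measure M1.emeasure_eq_measure
          M2.emeasure_eq_measure smeas2_measure[OF sf] ennreal_plus)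
  next
    case (mult u c)
    then show ?case by (simp add: nn_integral_cmult m distrib_left)
  next
    case (add u v)
    then show ?case by (simp add: nn_integral_add m algebra_simps)
  next
    case (seq U)
    have inc: "incseq (\<lambda>i. \<integral>\<^sup>+t. U i t \<partial>M)" for M
      using seq(3) by (auto simp: incseq_def le_fun_def intro!: nn_integral_mono)
    have sup: "(\<integral>\<^sup>+t. (SUP i. U i) t \<partial>M) = (SUP i. \<integral>\<^sup>+t. U i t \<partial>M)" if "sets M = sets borel" for M
      using seq(1,3) that unfolding SUP_apply
      by (intro nn_integral_monotone_convergence_SUP) (auto simp: measurable_cong_sets[OF that refl])
    have "(SUP i. \<integral>\<^sup>+t. U i t \<partial>smeas2 E \<phi> \<psi>) = (SUP i. (\<integral>\<^sup>+t. U i t \<partial>smeas E \<phi>) + (\<integral>\<^sup>+t. U i t \<partial>smeas E \<psi>))"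
      by (simp only: seq.IH)
    also have "\<dots> = (SUP i. \<integral>\<^sup>+t. U i t \<partial>smeas E \<phi>) + (SUP i. \<integral>\<^sup>+t. U i t \<partial>smeas E \<psi>)"
      by (rule ennreal_SUP_add[OF inc inc])
    finally show ?case
      by (simp only: sup[OF N.M_is_borel] sup[OF M1.M_is_borel] sup[OF M2.M_is_borel])
  qed
qed

lemma second_moment_dominated:
  assumes d: "dominated_by (smeas E \<xi>) (smeas2 E \<phi> \<psi>)"
    and i: "integrable (smeas E \<phi>) (\<lambda>t. t\<^sup>2)" "integrable (smeas E \<psi>) (\<lambda>t. t\<^sup>2)"
  shows "integrable (smeas E \<xi>) (\<lambda>t. t\<^sup>2)"
proof -
  note fin = smeas_finite[OF sf] smeas2_finite[OF sf]
  have m: "(\<lambda>t::real. t\<^sup>2) \<in> borel_measurable (smeas E \<xi>)"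
    by (simp add: measurable_cong_sets[OF finite_borel_measure.M_is_borel[OF fin(1)] refl])
  have "(\<integral>\<^sup>+t. ennreal (t\<^sup>2) \<partial>smeas E \<xi>) \<le> (\<integral>\<^sup>+t. ennreal (t\<^sup>2) \<partial>smeas2 E \<phi> \<psi>)"
    by (intro nn_integral_mono_measure dominated_le fin d)
      (simp add: finite_borel_measure.M_is_borel[OF fin(1)] finite_borel_measure.M_is_borel[OF fin(2)])
  also have "\<dots> = (\<integral>\<^sup>+t. ennreal (t\<^sup>2) \<partial>smeas E \<phi>) + (\<integral>\<^sup>+t. ennreal (t\<^sup>2) \<partial>smeas E \<psi>)"
    by (rule nn_integral_smeas2) simp
  also have "\<dots> < \<infinity>"
    using i by (simp add: integrable_iff_bounded)
  finally show ?thesis using m by (simp add: integrable_iff_bounded)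
qed

end

section \<open>Self-adjoint operators and their spectral families\<close>

lemma self_adjoint_symmetric:
  assumes A: "self_adjoint A" and "\<psi> \<in> op_dom A" "\<phi> \<in> op_dom A"
  shows "cinner \<psi> (op_app A \<phi>) = cinner (op_app A \<psi>) \<phi>"
proof -
  have dense: "closure (op_dom A) = UNIV" and eq: "op_eq (adjoint_op A) A"
    using A by (auto simp: self_adjoint_def)
  have "\<psi> \<in> op_dom (adjoint_op A)" using eq assms(2) by (simp add: op_eq_def)
  then obtain \<eta> where \<eta>: "\<forall>\<phi>\<in>op_dom A. cinner \<psi> (op_app A \<phi>) = cinner \<eta> \<phi>"
    by (auto simp: adjoint_op_def)
  have "op_app (adjoint_op A) \<psi> = \<eta>"
    unfolding adjoint_op_def operator.sel
  proof (rule the_equality)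
    fix \<zeta> assume \<zeta>: "\<forall>\<phi>\<in>op_dom A. cinner \<psi> (op_app A \<phi>) = cinner \<zeta> \<phi>"
    show "\<zeta> = \<eta>"
    proof (rule cinner_eqI_dense[OF dense])
      fix \<phi> assume "\<phi> \<in> op_dom A"
      then have "cinner \<zeta> \<phi> = cinner \<eta> \<phi>" using \<eta> \<zeta> by simp
      then show "cinner \<phi> \<zeta> = cinner \<phi> \<eta>" using cinner_commute by metis
    qed
  qed (rule \<eta>)
  moreover have "op_app (adjoint_op A) \<psi> = op_app A \<psi>"
    using eq \<open>\<psi> \<in> op_dom (adjoint_op A)\<close> by (simp add: op_eq_def)
  ultimately show ?thesis using \<eta> assms(3) by simp
qed

lemma linear_operator_diff:
  assumes "linear_operator A" "x \<in> op_dom A" "y \<in> op_dom A"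
  shows "x - y \<in> op_dom A" "op_app A (x - y) = op_app A x - op_app A y"
proof -
  have y: "(-1) *\<^sub>C y \<in> op_dom A" "op_app A ((-1) *\<^sub>C y) = (-1) *\<^sub>C op_app A y"
    using assms unfolding linear_operator_def by blast+
  have "x + (-1) *\<^sub>C y \<in> op_dom A" "op_app A (x + (-1) *\<^sub>C y) = op_app A x + op_app A ((-1) *\<^sub>C y)"
    using assms(1,2) y(1) unfolding linear_operator_def by blast+
  then show "x - y \<in> op_dom A" "op_app A (x - y) = op_app A x - op_app A y"
    using y(2) by (simp_all add: scaleC_minus_left)
qed

text \<open>A symmetric operator has no eigenvalue off the real line.\<close>

lemma self_adjoint_inj_on:
  assumes A: "self_adjoint A" and z: "Im z \<noteq> 0"
  shows "inj_on (\<lambda>\<phi>. op_app A \<phi> - z *\<^sub>C \<phi>) (op_dom A)"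
proof (rule inj_onI)
  fix x y assume xy: "x \<in> op_dom A" "y \<in> op_dom A" "op_app A x - z *\<^sub>C x = op_app A y - z *\<^sub>C y"
  have lin: "linear_operator A" using A by (simp add: self_adjoint_def)
  define d where "d = x - y"
  have "op_app A x - op_app A y = z *\<^sub>C x - z *\<^sub>C y" using xy(3) by (simp add: algebra_simps)
  then have d: "d \<in> op_dom A" "op_app A d = z *\<^sub>C d"
    using linear_operator_diff[OF lin xy(1,2)] by (simp_all add: d_def scaleC_diff_right)
  have "z * cinner d d = cnj z * cinner d d"
    using self_adjoint_symmetric[OF A d(1) d(1)] by (simp add: d(2) cinner_scaleC_left cinner_scaleC_right)
  moreover have "z \<noteq> cnj z" using z by (simp add: complex_eq_iff)
  ultimately have "cinner d d = 0" by simp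
  then show "x = y" by (simp add: cinner_self d_def)
qed

context
  fixes E :: "real \<Rightarrow> 'h::complex_hilbert_space \<Rightarrow> 'h" and A :: "'h operator"
  assumes sa: "self_adjoint A" and sfo: "spectral_family_of E A"
begin

lemma sfo_sf: "spectral_family E"
  using sfo by (simp add: spectral_family_of_def)

text \<open>The functional calculus of \<open>E\<close> meets the operator \<open>A\<close>. The
measure of \<open>\<omega> = r(A)\<phi>\<close> has density \<open>\<bar>r\<bar>\<^sup>2\<close>,
so \<open>\<integral> t\<^sup>2\<close> is finite as soon as \<open>t r(t)\<close> is bounded, and
\<open>\<omega>\<close> lies in the domain. The form that defines \<open>A\<omega>\<close>
involves the unbounded function \<open>t\<close> and is reached from its truncations by dominated
convergence.\<close>

lemma op_app_rep:
  assumes r: "rep E \<phi> r \<omega>" "bdd_borel r"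
    and tr: "rep E \<phi> (\<lambda>t. complex_of_real t * r t) \<eta>" "bdd_borel (\<lambda>t. complex_of_real t * r t)"
  shows "\<omega> \<in> op_dom A" and "op_app A \<omega> = \<eta>"
proof -
  note sf = sfo_sf
  interpret M: finite_borel_measure "smeas E \<phi>" by (rule smeas_finite[OF sf])
  have dom: "op_dom A = spectral_integral_dom E (\<lambda>t. t)"
    and app: "\<And>\<phi>. \<phi> \<in> op_dom A \<Longrightarrow> op_app A \<phi> = op_app (spectral_integral E (\<lambda>t. t)) \<phi>"
    using sfo by (simp_all add: spectral_family_of_def op_eq_def spectral_integral_def)
  have dense: "closure (op_dom A) = UNIV" using sa by (simp add: self_adjoint_def)
  have b: "u \<in> borel_measurable (smeas E \<xi>) \<longleftrightarrow> u \<in> borel_measurable borel" for u :: "real \<Rightarrow> real" and \<xi>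
    by (simp add: measurable_cong_sets[OF finite_borel_measure.M_is_borel[OF smeas_finite[OF sf]] refl])
  have dom_iff: "\<xi> \<in> op_dom A \<longleftrightarrow> integrable (smeas E \<xi>) (\<lambda>t. t\<^sup>2)" for \<xi>
  proof -
    have "(\<lambda>t. t) \<in> borel_measurable (completion (smeas E \<xi>))"
      by (rule measurable_completion) (simp add: b)
    then show ?thesis
      by (simp add: dom spectral_integral_dom_def spectral_measure_smeas integrable_completion b)
  qed
  have "integrable (smeas E \<phi>) (\<lambda>t. (cmod (r t))\<^sup>2 *\<^sub>R t\<^sup>2)"
    using M.bdd_borel_integrable[OF bdd_borel_norm_sq[OF tr(2)]]
    by (simp add: norm_mult power_mult_distrib mult.commute)
  then have int_w: "integrable (smeas E \<omega>) (\<lambda>t. t\<^sup>2)"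
    by (subst integrable_smeas_rep[OF sf r]) auto
  then show \<omega>: "\<omega> \<in> op_dom A" by (simp add: dom_iff)
  define tk where "tk k t = indicator {- real k..real k} t * t" for k :: nat and t :: real
  have tk: "bdd_borel (\<lambda>t. complex_of_real (tk k t))" for k
  proof (rule bdd_borelI[where C="real k"])
    show "(\<lambda>t. complex_of_real (tk k t)) \<in> borel_measurable borel" unfolding tk_def by measurable
  qed (auto simp: tk_def indicator_def)
  have tk_le: "\<bar>tk k t\<bar> \<le> \<bar>t\<bar>" for k t by (simp add: tk_def indicator_def)
  have tk_lim: "(\<lambda>k. tk k t) \<longlonglongrightarrow> t" for t
  proof (rule tendsto_eventually)
    obtain n :: nat where "\<bar>t\<bar> \<le> real n" using real_arch_simple by blast
    then show "\<forall>\<^sub>F k in sequentially. tk k t = t"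
      by (auto simp: eventually_sequentially tk_def indicator_def abs_le_iff intro!: exI[of _ n])
  qed
  have "\<exists>\<eta>k. rep E \<omega> (\<lambda>t. complex_of_real (tk k t)) \<eta>k" for k using rep_exists[OF sf tk] by metis
  then obtain \<eta>k where \<eta>k: "\<And>k. rep E \<omega> (\<lambda>t. complex_of_real (tk k t)) (\<eta>k k)" by metis
  have \<eta>k_lim: "\<eta>k \<longlonglongrightarrow> \<eta>"
  proof -
    have bk: "bdd_borel (\<lambda>t. complex_of_real (tk k t) * r t)" for k by (intro bdd_borel_mult tk r)
    have "(norm (\<eta>k k - \<eta>))\<^sup>2 = M.sqdist (\<lambda>t. complex_of_real (tk k t) * r t) (\<lambda>t. complex_of_real t * r t)" for k
      by (intro rep_norm_sq[OF sf] rep_diff[OF sf rep_mult[OF sf r \<eta>k tk] tr(1) bk tr(2)] bdd_borel_diff bk tr(2))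
    moreover have "(\<lambda>k. M.sqdist (\<lambda>t. complex_of_real (tk k t) * r t) (\<lambda>t. complex_of_real t * r t)) \<longlonglongrightarrow> (\<integral>t. 0 \<partial>smeas E \<phi>)"
    proof (rule integral_dominated_convergence[where w="\<lambda>t. (cmod (complex_of_real t * r t))\<^sup>2"])
      show "integrable (smeas E \<phi>) (\<lambda>t. (cmod (complex_of_real t * r t))\<^sup>2)"
        by (intro M.bdd_borel_integrable bdd_borel_norm_sq tr)
      show "(\<lambda>t. (cmod (complex_of_real (tk k t) * r t - complex_of_real t * r t))\<^sup>2) \<in> borel_measurable (smeas E \<phi>)" for k
        unfolding b by (intro bdd_borel_measurable bdd_borel_norm_sq bdd_borel_diff bk tr)
      show "AE t in smeas E \<phi>. (\<lambda>k. (cmod (complex_of_real (tk k t) * r t - complex_of_real t * r t))\<^sup>2) \<longlonglongrightarrow> 0"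
        using tk_lim by (auto intro!: AE_I2 tendsto_eq_intros)
      show "AE t in smeas E \<phi>. norm ((cmod (complex_of_real (tk k t) * r t - complex_of_real t * r t))\<^sup>2)
          \<le> (cmod (complex_of_real t * r t))\<^sup>2" for k
        by (auto intro!: AE_I2 simp: tk_def indicator_def)
    qed simp
    ultimately have "(\<lambda>k. (norm (\<eta>k k - \<eta>))\<^sup>2) \<longlonglongrightarrow> 0" by simp
    from tendsto_real_sqrt[OF this] have "(\<lambda>k. norm (\<eta>k k - \<eta>)) \<longlonglongrightarrow> 0" by simp
    then show ?thesis by (rule tendsto_norm_diff_iff[THEN iffD2])
  qed
  have form: "cinner \<psi> \<eta> = spectral_form E (\<lambda>t. t) \<psi> \<omega>" if "\<psi> \<in> op_dom A" for \<psi>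
  proof -
    have q: "(\<lambda>k. \<integral>t. complex_of_real (tk k t) \<partial>smeas E \<xi>) \<longlonglongrightarrow> complex_of_real (\<integral>t. t \<partial>spectral_measure E \<xi>)"
      if d: "dominated_by (smeas E \<xi>) (smeas2 E \<omega> \<psi>)" for \<xi>
    proof -
      interpret X: finite_borel_measure "smeas E \<xi>" by (rule smeas_finite[OF sf])
      have t2: "integrable (smeas E \<xi>) (\<lambda>t. t\<^sup>2)"
        using \<open>\<psi> \<in> op_dom A\<close> by (intro second_moment_dominated[OF sf d] int_w) (simp add: dom_iff)
      have "integrable (smeas E \<xi>) (\<lambda>t. \<bar>t\<bar>)"
      proof (rule Bochner_Integration.integrable_bound)
        show "integrable (smeas E \<xi>) (\<lambda>t. 1 + t\<^sup>2)" using t2 by simp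
        show "AE t in smeas E \<xi>. norm \<bar>t\<bar> \<le> norm (1 + t\<^sup>2)"
        proof (intro AE_I2)
          fix t :: real
          have "2 * \<bar>t\<bar> * 1 \<le> \<bar>t\<bar>\<^sup>2 + 1\<^sup>2" by (rule sum_squares_bound)
          then show "norm \<bar>t\<bar> \<le> norm (1 + t\<^sup>2)" by simp
        qed
      qed (simp add: b)
      then have "(\<lambda>k. \<integral>t. tk k t \<partial>smeas E \<xi>) \<longlonglongrightarrow> (\<integral>t. t \<partial>smeas E \<xi>)"
      proof (rule integral_dominated_convergence[rotated 2])
        show "tk k \<in> borel_measurable (smeas E \<xi>)" for k unfolding b tk_def by measurable
      qed (use tk_lim tk_le in \<open>auto simp: b intro!: AE_I2\<close>)
      then have "(\<lambda>k. complex_of_real (\<integral>t. tk k t \<partial>smeas E \<xi>)) \<longlonglongrightarrow> complex_of_real (\<integral>t. t \<partial>smeas E \<xi>)"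
        by (rule tendsto_of_real)
      then show ?thesis
        by (simp add: spectral_measure_smeas integral_completion b)
    qed
    have "(\<lambda>k. cinner \<psi> (\<eta>k k)) \<longlonglongrightarrow> cinner \<psi> \<eta>" by (intro tendsto_cinner tendsto_const \<eta>k_lim)
    moreover have "(\<lambda>k. cinner \<psi> (\<eta>k k)) \<longlonglongrightarrow> spectral_form E (\<lambda>t. t) \<psi> \<omega>"
      unfolding rep_polar[OF sf \<eta>k tk] spectral_form_polar polar_def
      by (intro tendsto_intros q smeas_dominated_polar[OF sf])
    ultimately show ?thesis by (rule LIMSEQ_unique)
  qed
  show "op_app A \<omega> = \<eta>"
    unfolding app[OF \<omega>] spectral_integral_def operator.sel dom[symmetric]
  proof (rule the_equality)
    show "\<forall>\<psi>\<in>op_dom A. cinner \<psi> \<eta> = spectral_form E (\<lambda>t. t) \<psi> \<omega>" using form by simp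
    show "\<eta>' = \<eta>" if "\<forall>\<psi>\<in>op_dom A. cinner \<psi> \<eta>' = spectral_form E (\<lambda>t. t) \<psi> \<omega>" for \<eta>'
      by (rule cinner_eqI_dense[OF dense]) (use that form in simp)
  qed
qed

text \<open>For \<open>r(t) = 1/(t - z)\<close> one has \<open>t r(t) = 1 + z r(t)\<close>, so
\<open>A r(A)\<phi> = \<phi> + z r(A)\<phi>\<close>: the vector \<open>r(A)\<phi>\<close> is the
unique solution of the resolvent equation.\<close>

lemma
  assumes z: "Im z \<noteq> 0"
  shows resolvent_rep: "rep E \<phi> (\<lambda>t. 1 / (complex_of_real t - z)) (resolvent A z \<phi>)"
    and resolvent_in_dom: "resolvent A z \<phi> \<in> op_dom A"
    and resolvent_solves: "op_app A (resolvent A z \<phi>) - z *\<^sub>C resolvent A z \<phi> = \<phi>"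
proof -
  note sf = sfo_sf
  let ?r = "\<lambda>t. 1 / (complex_of_real t - z)"
  note b = bdd_borel_resolvent_fun[OF z]
  obtain \<omega> where \<omega>: "rep E \<phi> ?r \<omega>" using rep_exists[OF sf b] .
  have "1 + z * ?r t = complex_of_real t * ?r t" for t
  proof -
    have "complex_of_real t - z \<noteq> 0" using z by (auto simp: complex_eq_iff)
    then show ?thesis by (simp add: field_simps)
  qed
  then have eq: "(\<lambda>t. 1 + z * ?r t) = (\<lambda>t. complex_of_real t * ?r t)" by (rule ext)
  have bz: "bdd_borel (\<lambda>t. z * ?r t)" by (intro bdd_borel_mult bdd_borel_const b)
  have tr: "rep E \<phi> (\<lambda>t. complex_of_real t * ?r t) (\<phi> + z *\<^sub>C \<omega>)"
    unfolding eq[symmetric] by (intro rep_add[OF sf] rep_one[OF sf] rep_scale[OF sf] \<omega> bdd_borel_const bz)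
  have btr: "bdd_borel (\<lambda>t. complex_of_real t * ?r t)"
    unfolding eq[symmetric] by (intro bdd_borel_add bdd_borel_const bz)
  have A\<omega>: "\<omega> \<in> op_dom A" "op_app A \<omega> - z *\<^sub>C \<omega> = \<phi>"
    using op_app_rep[OF \<omega> b tr btr] by simp_all
  \<comment> \<open>\<open>resolvent\<close> is an \<open>inv_into\<close>, so injectivity identifies its value.\<close>
  have "resolvent A z \<phi> = \<omega>"
    unfolding resolvent_def using inv_into_f_f[OF self_adjoint_inj_on[OF sa z] A\<omega>(1)] A\<omega>(2) by simp
  then show "rep E \<phi> ?r (resolvent A z \<phi>)" "resolvent A z \<phi> \<in> op_dom A"
    "op_app A (resolvent A z \<phi>) - z *\<^sub>C resolvent A z \<phi> = \<phi>"
    using \<omega> A\<omega> by simp_all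
qed

lemma resolvent_power_rep:
  assumes z: "Im z \<noteq> 0"
  shows "rep E \<phi> (\<lambda>t. (1 / (complex_of_real t - z)) ^ j) ((resolvent A z ^^ j) \<phi>)
    \<and> bdd_borel (\<lambda>t. (1 / (complex_of_real t - z)) ^ j)"
proof (induction j)
  case 0
  show ?case using rep_one[OF sfo_sf] bdd_borel_const by simp
next
  case (Suc j)
  have "rep E \<phi> (\<lambda>t. 1 / (complex_of_real t - z) * (1 / (complex_of_real t - z)) ^ j)
      (resolvent A z ((resolvent A z ^^ j) \<phi>))"
    by (rule rep_mult[OF sfo_sf conjunct1[OF Suc.IH] conjunct2[OF Suc.IH] resolvent_rep[OF z]
          bdd_borel_resolvent_fun[OF z]])
  moreover have "bdd_borel (\<lambda>t. 1 / (complex_of_real t - z) * (1 / (complex_of_real t - z)) ^ j)"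
    using Suc.IH by (intro bdd_borel_mult bdd_borel_resolvent_fun z) auto
  ultimately show ?case by simp
qed

lemma resolvent_diff:
  assumes z: "Im z \<noteq> 0"
  shows "resolvent A z (x - y) = resolvent A z x - resolvent A z y"
proof (rule inj_onD[OF self_adjoint_inj_on[OF sa z]])
  have lin: "linear_operator A" using sa by (simp add: self_adjoint_def)
  note d = linear_operator_diff[OF lin resolvent_in_dom[OF z] resolvent_in_dom[OF z]]
  show "resolvent A z x - resolvent A z y \<in> op_dom A" by (rule d)
  have "op_app A (resolvent A z x - resolvent A z y) - z *\<^sub>C (resolvent A z x - resolvent A z y)
     = (op_app A (resolvent A z x) - z *\<^sub>C resolvent A z x) - (op_app A (resolvent A z y) - z *\<^sub>C resolvent A z y)"
    by (simp add: d scaleC_diff_right)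
  then show "op_app A (resolvent A z (x - y)) - z *\<^sub>C resolvent A z (x - y)
     = op_app A (resolvent A z x - resolvent A z y) - z *\<^sub>C (resolvent A z x - resolvent A z y)"
    by (simp add: resolvent_solves[OF z])
qed (rule resolvent_in_dom[OF z])

text \<open>The projection of \<open>\<phi>\<close> belonging to the indicator of
\<open>{s}\<close> is an eigenvector, as \<open>t\<close> and \<open>s\<close> agree on
\<open>{s}\<close>; its squared norm is the mass of the atom.\<close>

lemma atom_eigenvalue:
  assumes "measure (smeas E \<phi>) {s} \<noteq> 0"
  shows "op_eigenvalue A (complex_of_real s)"
proof -
  note sf = sfo_sf
  interpret M: finite_borel_measure "smeas E \<phi>" by (rule smeas_finite[OF sf])
  have b: "bdd_borel (indicator {s} :: real \<Rightarrow> complex)" by (rule bdd_borel_indicator) simp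
  obtain \<omega> where \<omega>: "rep E \<phi> (indicator {s}) \<omega>" using rep_exists[OF sf b] .
  have eq: "(\<lambda>t. complex_of_real s * indicator {s} t) = (\<lambda>t. complex_of_real t * indicator {s} t)"
    by (auto simp: indicator_def)
  have "bdd_borel (\<lambda>t. complex_of_real s * indicator {s} t)" by (intro bdd_borel_mult bdd_borel_const b)
  from op_app_rep[OF \<omega> b, of "complex_of_real s *\<^sub>C \<omega>"] this rep_scale[OF sf \<omega>, of "complex_of_real s"]
  have "\<omega> \<in> op_dom A" "op_app A \<omega> = complex_of_real s *\<^sub>C \<omega>"
    unfolding eq by auto
  moreover have "(norm \<omega>)\<^sup>2 = (\<integral>t. (cmod (indicator {s} t))\<^sup>2 \<partial>smeas E \<phi>)"
    by (rule rep_norm_sq[OF sf \<omega> b])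
  moreover have "(\<integral>t. (cmod (indicator {s} t))\<^sup>2 \<partial>smeas E \<phi>) = (\<integral>t. indicator {s} t \<partial>smeas E \<phi>)"
    by (intro Bochner_Integration.integral_cong refl) (simp add: indicator_def)
  ultimately have "(norm \<omega>)\<^sup>2 \<noteq> 0" using assms by (simp add: M.borel_UNIV)
  then have "\<omega> \<noteq> 0" by auto
  with \<open>\<omega> \<in> op_dom A\<close> \<open>op_app A \<omega> = complex_of_real s *\<^sub>C \<omega>\<close> show ?thesis
    unfolding op_eigenvalue_def by blast
qed

text \<open>On vectors belonging to the interval of radius \<open>\<epsilon>\<close> the operator
\<open>A - s\<close> has norm at most \<open>\<epsilon>\<close>. If its inverse is bounded by
\<open>K\<close> and \<open>\<epsilon> K < 1\<close>, only the zero vector is left.\<close>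

lemma resolvent_set_null_interval:
  assumes s: "complex_of_real s \<in> resolvent_set A"
  obtains \<epsilon> where "\<epsilon> > 0" "\<And>\<phi>. measure (smeas E \<phi>) {s - \<epsilon><..<s + \<epsilon>} = 0"
proof -
  note sf = sfo_sf
  let ?R = "resolvent A (complex_of_real s)"
  have bij: "bij_betw (\<lambda>\<phi>. op_app A \<phi> - complex_of_real s *\<^sub>C \<phi>) (op_dom A) UNIV" and bl: "bounded_linear ?R"
    using s by (auto simp: resolvent_set_def)
  obtain K where K: "K > 0" "\<And>x. norm (?R x) \<le> norm x * K"
    using bounded_linear.pos_bounded[OF bl] by blast
  define \<epsilon> where "\<epsilon> = 1 / (2 * K)"
  have "\<epsilon> > 0" using K by (simp add: \<epsilon>_def)
  have "measure (smeas E \<phi>) {s - \<epsilon><..<s + \<epsilon>} = 0" for \<phi>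
  proof -
    interpret M: finite_borel_measure "smeas E \<phi>" by (rule smeas_finite[OF sf])
    let ?I = "indicator {s - \<epsilon><..<s + \<epsilon>} :: real \<Rightarrow> complex"
    have b: "bdd_borel ?I" by (rule bdd_borel_indicator) simp
    have bt: "bdd_borel (\<lambda>t. complex_of_real t * ?I t)"
    proof (rule bdd_borelI[where C="\<bar>s\<bar> + \<epsilon>"])
      show "(\<lambda>t. complex_of_real t * ?I t) \<in> borel_measurable borel" by measurable
    qed (use \<open>\<epsilon> > 0\<close> in \<open>auto simp: indicator_def\<close>)
    obtain \<omega> where \<omega>: "rep E \<phi> ?I \<omega>" using rep_exists[OF sf b] .
    obtain \<eta> where \<eta>: "rep E \<phi> (\<lambda>t. complex_of_real t * ?I t) \<eta>" using rep_exists[OF sf bt] .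
    have bs: "bdd_borel (\<lambda>t. complex_of_real s * ?I t)" by (intro bdd_borel_mult bdd_borel_const b)
    have n\<omega>: "(norm \<omega>)\<^sup>2 = measure (smeas E \<phi>) {s - \<epsilon><..<s + \<epsilon>}"
    proof -
      have "(norm \<omega>)\<^sup>2 = (\<integral>t. (cmod (?I t))\<^sup>2 \<partial>smeas E \<phi>)" by (rule rep_norm_sq[OF sf \<omega> b])
      also have "\<dots> = (\<integral>t. indicator {s - \<epsilon><..<s + \<epsilon>} t \<partial>smeas E \<phi>)"
        by (intro Bochner_Integration.integral_cong refl) (simp add: indicator_def)
      finally show ?thesis by (simp add: M.borel_UNIV)
    qed
    have A\<omega>: "\<omega> \<in> op_dom A" "op_app A \<omega> = \<eta>" by (rule op_app_rep[OF \<omega> b \<eta> bt])+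
    have "?R (op_app A \<omega> - complex_of_real s *\<^sub>C \<omega>) = \<omega>"
      unfolding resolvent_def using inv_into_f_f[OF bij_betw_imp_inj_on[OF bij] A\<omega>(1)] .
    then have "norm \<omega> \<le> norm (\<eta> - complex_of_real s *\<^sub>C \<omega>) * K" using K(2) A\<omega>(2) by metis
    then have "(norm \<omega>)\<^sup>2 \<le> (norm (\<eta> - complex_of_real s *\<^sub>C \<omega>) * K)\<^sup>2" by (rule power_mono) simp
    also have "\<dots> = (norm (\<eta> - complex_of_real s *\<^sub>C \<omega>))\<^sup>2 * K\<^sup>2" by (rule power_mult_distrib)
    also have "(norm (\<eta> - complex_of_real s *\<^sub>C \<omega>))\<^sup>2
        = (\<integral>t. (cmod (complex_of_real t * ?I t - complex_of_real s * ?I t))\<^sup>2 \<partial>smeas E \<phi>)"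
      by (intro rep_norm_sq[OF sf] rep_diff[OF sf] rep_scale[OF sf] bdd_borel_diff \<eta> \<omega> bt bs)
    also have "\<dots> \<le> (\<integral>t. \<epsilon>\<^sup>2 * indicator {s - \<epsilon><..<s + \<epsilon>} t \<partial>smeas E \<phi>)"
    proof (intro integral_mono M.bdd_borel_integrable bdd_borel_norm_sq bdd_borel_diff bt bs
        bdd_borel_mult bdd_borel_const bdd_borel_indicator)
      fix t
      show "(cmod (complex_of_real t * ?I t - complex_of_real s * ?I t))\<^sup>2 \<le> \<epsilon>\<^sup>2 * indicator {s - \<epsilon><..<s + \<epsilon>} t"
      proof (cases "t \<in> {s - \<epsilon><..<s + \<epsilon>}")
        case True
        have "cmod (complex_of_real t - complex_of_real s) = \<bar>t - s\<bar>"
          by (metis norm_of_real of_real_diff real_norm_def)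
        also have "\<dots> \<le> \<epsilon>" using True by auto
        finally show ?thesis using True by (simp add: power_mono)
      qed simp
    qed simp
    also have "\<dots> = \<epsilon>\<^sup>2 * (norm \<omega>)\<^sup>2" by (simp add: n\<omega> M.borel_UNIV)
    finally have "(norm \<omega>)\<^sup>2 \<le> (\<epsilon> * K)\<^sup>2 * (norm \<omega>)\<^sup>2"
      by (simp add: mult_right_mono power_mult_distrib algebra_simps)
    also have "(\<epsilon> * K)\<^sup>2 = 1/4" using K by (simp add: \<epsilon>_def power2_eq_square)
    finally have "(norm \<omega>)\<^sup>2 = 0" by simp
    then show ?thesis using n\<omega> by simp
  qed
  then show ?thesis using that \<open>\<epsilon> > 0\<close> by blast
qed

text \<open>The open null sets cover the real points of the resolvent set, and by the Lindeloef
property countably many of them do.\<close>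

lemma AE_spectrum: "AE t in smeas E \<phi>. complex_of_real t \<in> op_spectrum A"
proof -
  note sf = sfo_sf
  interpret M: finite_borel_measure "smeas E \<phi>" by (rule smeas_finite[OF sf])
  define \<F> where "\<F> = {U. open U \<and> measure (smeas E \<phi>) U = 0}"
  obtain \<F>' where \<F>': "\<F>' \<subseteq> \<F>" "countable \<F>'" "\<Union>\<F>' = \<Union>\<F>"
    using Lindelof[of \<F>] by (auto simp: \<F>_def)
  have "\<Union>\<F>' \<in> null_sets (smeas E \<phi>)"
  proof -
    have "U \<in> null_sets (smeas E \<phi>)" if "U \<in> \<F>'" for U
      using that \<F>'(1) by (intro null_setsI) (auto simp: \<F>_def M.emeasure_eq_measure M.M_is_borel)
    then have "(\<Union>U\<in>\<F>'. U) \<in> null_sets (smeas E \<phi>)" by (intro null_sets_UN' \<F>'(2))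
    then show ?thesis by simp
  qed
  moreover have "{t \<in> space (smeas E \<phi>). \<not> complex_of_real t \<in> op_spectrum A} \<subseteq> \<Union>\<F>'"
  proof
    fix t assume "t \<in> {t \<in> space (smeas E \<phi>). \<not> complex_of_real t \<in> op_spectrum A}"
    then have "complex_of_real t \<in> resolvent_set A" by (simp add: op_spectrum_def)
    then obtain \<epsilon> where \<epsilon>: "\<epsilon> > 0" "measure (smeas E \<phi>) {t - \<epsilon><..<t + \<epsilon>} = 0"
      using resolvent_set_null_interval by metis
    then have "{t - \<epsilon><..<t + \<epsilon>} \<in> \<F>" by (simp add: \<F>_def)
    then show "t \<in> \<Union>\<F>'" unfolding \<F>'(3) using \<epsilon>(1) by (intro UnionI) auto
  qed
  ultimately show ?thesis by (rule AE_I')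
qed

end

section \<open>Weak convergence of the spectral measures\<close>

text \<open>Polynomials in \<open>w\<close> and its conjugate. Integrals of these monomials at
\<open>w = 1/(t - z)\<close> are inner products of powers of the resolvent.\<close>

inductive conj_poly :: "(complex \<Rightarrow> complex) \<Rightarrow> bool" where
  mono: "conj_poly (\<lambda>w. c * (cnj (w ^ k) * w ^ j))"
| add: "conj_poly p \<Longrightarrow> conj_poly q \<Longrightarrow> conj_poly (\<lambda>w. p w + q w)"

lemma conj_poly_mult:
  assumes "conj_poly p" "conj_poly q"
  shows "conj_poly (\<lambda>w. p w * q w)"
  using assms
proof (induction p rule: conj_poly.induct)
  case (mono c k j)
  show ?case
    using mono
  proof (induction q rule: conj_poly.induct)
    case (mono c' k' j')
    have "(\<lambda>w. c * (cnj (w ^ k) * w ^ j) * (c' * (cnj (w ^ k') * w ^ j')))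
      = (\<lambda>w. (c * c') * (cnj (w ^ (k + k')) * w ^ (j + j')))"
      by (simp add: power_add ac_simps)
    then show ?case using conj_poly.mono by metis
  next
    case (add p q)
    then show ?case using conj_poly.add by (simp add: distrib_left)
  qed
next
  case (add p p')
  then show ?case using conj_poly.add by (simp add: distrib_right)
qed

lemma real_polynomial_conj_poly:
  fixes p :: "complex \<Rightarrow> real"
  assumes "real_polynomial_function p"
  shows "conj_poly (\<lambda>w. complex_of_real (p w))"
  using assms
proof (induction p rule: real_polynomial_function.induct)
  case (linear f)
  have f: "f w = Re w * f 1 + Im w * f \<i>" for w
  proof -
    have "w = Re w *\<^sub>R 1 + Im w *\<^sub>R \<i>" by (simp add: complex_eq_iff)
    then have "f w = f (Re w *\<^sub>R 1 + Im w *\<^sub>R \<i>)" by simp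
    then show ?thesis
      using linear by (simp add: linear_simps)
  qed
  have "complex_of_real (f w) = (f 1 / 2 - \<i> * f \<i> / 2) * (cnj (w ^ 0) * w ^ 1) + (f 1 / 2 + \<i> * f \<i> / 2) * (cnj (w ^ 1) * w ^ 0)" for w
    by (subst f) (simp add: complex_eq_iff field_simps)
  then have "(\<lambda>w. complex_of_real (f w))
    = (\<lambda>w. (f 1 / 2 - \<i> * f \<i> / 2) * (cnj (w ^ 0) * w ^ 1) + (f 1 / 2 + \<i> * f \<i> / 2) * (cnj (w ^ 1) * w ^ 0))"
    by (rule ext)
  then show ?case by (simp only:) (intro conj_poly.intros)
next
  case (const c)
  show ?case using conj_poly.mono[of "complex_of_real c" 0 0] by simp
next
  case (add f g)
  then show ?case using conj_poly.add by simp
next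
  case (mult f g)
  then show ?case using conj_poly_mult by simp
qed

lemma abs_diff_chain:
  fixes a :: real
  shows "\<bar>a - p\<bar> \<le> x \<Longrightarrow> \<bar>p - q\<bar> < y \<Longrightarrow> \<bar>b - q\<bar> \<le> x' \<Longrightarrow> x + y + x' \<le> e \<Longrightarrow> \<bar>a - b\<bar> < e"
  by linarith

lemma resolvent_norm_le:
  assumes sa: "self_adjoint A" and sfo: "spectral_family_of E A" and z: "Im z \<noteq> 0"
  shows "norm (resolvent A z x) \<le> norm x / \<bar>Im z\<bar>"
proof -
  note sf = sfo_sf[OF sa sfo]
  interpret finite_borel_measure "smeas E x" by (rule smeas_finite[OF sf])
  let ?r = "\<lambda>t. 1 / (complex_of_real t - z)"
  note b = bdd_borel_resolvent_fun[OF z]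
  have "(norm (resolvent A z x))\<^sup>2 = (\<integral>t. (cmod (?r t))\<^sup>2 \<partial>smeas E x)"
    by (rule rep_norm_sq[OF sf resolvent_rep[OF sa sfo z] b])
  also have "\<dots> \<le> (\<integral>t. (1 / \<bar>Im z\<bar>)\<^sup>2 \<partial>smeas E x)"
  proof (intro integral_mono bdd_borel_integrable bdd_borel_norm_sq b bdd_borel_const power_mono)
    show "cmod (?r t) \<le> 1 / \<bar>Im z\<bar>" for t
      using abs_Im_le_cmod[of "complex_of_real t - z"] z by (simp add: norm_divide divide_simps)
  qed simp
  also have "\<dots> = (norm x / \<bar>Im z\<bar>)\<^sup>2" by (simp add: borel_UNIV smeas_UNIV[OF sf] power_divide)
  finally show ?thesis by (rule power2_le_imp_le) simp
qed

context
  fixes An :: "nat \<Rightarrow> 'h::complex_hilbert_space operator" and A :: "'h operator"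
    and En :: "nat \<Rightarrow> real \<Rightarrow> 'h \<Rightarrow> 'h" and E :: "real \<Rightarrow> 'h \<Rightarrow> 'h" and z :: complex
  assumes san: "\<And>n. self_adjoint (An n)" and sa: "self_adjoint A"
    and sfon: "\<And>n. spectral_family_of (En n) (An n)" and sfo: "spectral_family_of E A"
    and z: "Im z \<noteq> 0" and conv: "\<And>\<phi>. (\<lambda>n. resolvent (An n) z \<phi>) \<longlonglongrightarrow> resolvent A z \<phi>"
begin

lemma resolvent_power_tendsto: "(\<lambda>n. (resolvent (An n) z ^^ j) \<phi>) \<longlonglongrightarrow> (resolvent A z ^^ j) \<phi>"
proof (induction j)
  case (Suc j)
  let ?x = "\<lambda>n. (resolvent (An n) z ^^ j) \<phi>"
  let ?y = "(resolvent A z ^^ j) \<phi>"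
  have "(\<lambda>n. norm (?x n - ?y) / \<bar>Im z\<bar>) \<longlonglongrightarrow> 0 / \<bar>Im z\<bar>"
    using z by (intro tendsto_divide tendsto_const Suc.IH[THEN tendsto_norm_diff_iff[THEN iffD1]]) simp
  then have "(\<lambda>n. norm (?x n - ?y) / \<bar>Im z\<bar>) \<longlonglongrightarrow> 0" by simp
  then have "(\<lambda>n. resolvent (An n) z (?x n - ?y)) \<longlonglongrightarrow> 0"
    by (rule Lim_null_comparison[rotated]) (intro always_eventually allI resolvent_norm_le[OF san sfon z])
  from tendsto_add[OF this conv[of ?y]]
  have "(\<lambda>n. resolvent (An n) z (?x n)) \<longlonglongrightarrow> resolvent A z ?y"
    by (simp add: resolvent_diff[OF san sfon z])
  then show ?case by simp
qed simp

text \<open>For a monomial the integral is \<open>c \<langle>R\<^sup>k \<phi>, R\<^sup>j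
\<phi>\<rangle>\<close> with the resolvent \<open>R\<close>, whose powers converge
strongly.\<close>

lemma conj_poly_integral_tendsto:
  assumes "conj_poly p"
  shows "bdd_borel (\<lambda>t. p (1 / (complex_of_real t - z))) \<and>
    (\<lambda>n. \<integral>t. p (1 / (complex_of_real t - z)) \<partial>smeas (En n) \<phi>)
      \<longlonglongrightarrow> (\<integral>t. p (1 / (complex_of_real t - z)) \<partial>smeas E \<phi>)"
  using assms
proof (induction p rule: conj_poly.induct)
  case (mono c k j)
  let ?r = "\<lambda>t. 1 / (complex_of_real t - z)"
  have moment: "(\<integral>t. c * (cnj (?r t ^ k) * ?r t ^ j) \<partial>smeas F \<phi>)
      = c * cinner ((resolvent B z ^^ k) \<phi>) ((resolvent B z ^^ j) \<phi>)"
    if "self_adjoint B" "spectral_family_of F B" for B F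
    using rep_inner[OF sfo_sf[OF that], OF conjunct1[OF resolvent_power_rep[OF that z]]
        conjunct1[OF resolvent_power_rep[OF that z]] conjunct2[OF resolvent_power_rep[OF that z]]
        conjunct2[OF resolvent_power_rep[OF that z]]] by simp
  have "bdd_borel (\<lambda>t. c * (cnj (?r t ^ k) * ?r t ^ j))"
    by (intro bdd_borel_mult bdd_borel_const bdd_borel_cnj conjunct2[OF resolvent_power_rep[OF sa sfo z]])
  then show ?case
    unfolding moment[OF san sfon] moment[OF sa sfo]
    by (intro conjI tendsto_mult_left tendsto_cinner resolvent_power_tendsto)
next
  case (add p q)
  note fin = smeas_finite[OF sfo_sf[OF sa sfo]] smeas_finite[OF sfo_sf[OF san sfon]]
  have int: "integrable (smeas E \<phi>) (\<lambda>t. f (1 / (complex_of_real t - z)))"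
    "integrable (smeas (En n) \<phi>) (\<lambda>t. f (1 / (complex_of_real t - z)))" if "f = p \<or> f = q" for f n
    using add.IH that by (auto intro: finite_borel_measure.bdd_borel_integrable[OF fin(1)]
        finite_borel_measure.bdd_borel_integrable[OF fin(2)])
  show ?case
    using add.IH int by (auto intro!: bdd_borel_add tendsto_add)
qed

text \<open>The integrand is \<open>G(r(t))\<close> with \<open>r(t) = 1/(t - z)\<close> and
\<open>G(w) = \<bar>w\<bar>\<^sup>2 h(Re (z + 1/w))\<close>, since \<open>z + 1/r(t) = t\<close>.
The factor \<open>\<bar>w\<bar>\<^sup>2\<close> makes \<open>G\<close> continuous at
\<open>0\<close>, which corresponds to \<open>t = \<infinity>\<close>, so \<open>G\<close> can be
approximated uniformly by polynomials on the disc that contains all values of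
\<open>r\<close>.\<close>

lemma weighted_integral_tendsto:
  fixes h :: "real \<Rightarrow> real"
  assumes h: "continuous_on UNIV h" and C: "\<And>t. \<bar>h t\<bar> \<le> C"
  shows "(\<lambda>n. \<integral>t. (cmod (1 / (complex_of_real t - z)))\<^sup>2 * h t \<partial>smeas (En n) \<phi>)
    \<longlonglongrightarrow> (\<integral>t. (cmod (1 / (complex_of_real t - z)))\<^sup>2 * h t \<partial>smeas E \<phi>)"
proof -
  let ?r = "\<lambda>t. 1 / (complex_of_real t - z)"
  define G where "G w = (cmod w)\<^sup>2 * h (Re (z + 1 / w))" for w
  have "C \<ge> 0" using C[of 0] by linarith
  \<comment> \<open>At \<open>w = 0\<close> the convention \<open>1 / 0 = 0\<close> gives \<open>G 0 = 0\<close>, the limit there.\<close>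
  have "isCont G w" for w
  proof (cases "w = 0")
    case True
    have "(\<lambda>w. (cmod w)\<^sup>2 * C) \<midarrow>0\<rightarrow> (cmod 0)\<^sup>2 * C" by (intro tendsto_intros)
    then have "(\<lambda>w. (cmod w)\<^sup>2 * C) \<midarrow>0\<rightarrow> 0" by simp
    then have "G \<midarrow>0\<rightarrow> 0"
      by (rule Lim_null_comparison[rotated])
        (auto intro!: always_eventually mult_left_mono C simp: G_def abs_mult)
    then show ?thesis using True by (simp add: isCont_def G_def)
  next
    case False
    have "isCont h (Re (z + 1 / w))" using h by (simp add: continuous_on_eq_continuous_at)
    then have "isCont (\<lambda>w. h (Re (z + 1 / w))) w"
      by (rule isCont_o2[rotated]) (unfold isCont_def, intro tendsto_intros False)
    then show ?thesis unfolding G_def by (intro continuous_intros)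
  qed
  then have G: "continuous_on (cball 0 (1 / \<bar>Im z\<bar>)) G"
    by (simp add: continuous_at_imp_continuous_on)
  have r_in: "?r t \<in> cball 0 (1 / \<bar>Im z\<bar>)" for t
    using abs_Im_le_cmod[of "complex_of_real t - z"] z by (simp add: norm_divide divide_simps)
  have Gr: "G (?r t) = (cmod (?r t))\<^sup>2 * h t" for t by (simp add: G_def)
  have bG: "bdd_borel (\<lambda>t. G (?r t))"
    unfolding Gr
    by (intro bdd_borel_mult bdd_borel_norm_sq bdd_borel_resolvent_fun z bdd_borelI[of h C]
        borel_measurable_continuous_onI h) (simp add: C)
  note fin = smeas_finite[OF sfo_sf[OF sa sfo]] smeas_finite[OF sfo_sf[OF san sfon]]
  \<comment> \<open>A positive bound for the total mass, also if \<open>\<phi> = 0\<close>.\<close>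
  define N where "N = (norm \<phi>)\<^sup>2 + 1"
  have N: "N > 0" "(norm \<phi>)\<^sup>2 \<le> N" by (simp_all add: N_def add_nonneg_pos)
  have "(\<lambda>n. \<integral>t. G (?r t) \<partial>smeas (En n) \<phi>) \<longlonglongrightarrow> (\<integral>t. G (?r t) \<partial>smeas E \<phi>)"
  proof (rule LIMSEQ_I)
    fix e :: real assume "e > 0"
    then have "e / (4 * N) > 0" using N by simp
    then obtain p where p: "real_polynomial_function p" "\<And>w. w \<in> cball 0 (1 / \<bar>Im z\<bar>) \<Longrightarrow> \<bar>G w - p w\<bar> < e / (4 * N)"
      using Stone_Weierstrass_real_polynomial_function[OF compact_cball G] by metis
    from conj_poly_integral_tendsto[OF real_polynomial_conj_poly[OF p(1)]]
    have bp': "bdd_borel (\<lambda>t. complex_of_real (p (?r t)))"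
      and lim: "(\<lambda>n. complex_of_real (\<integral>t. p (?r t) \<partial>smeas (En n) \<phi>)) \<longlonglongrightarrow> complex_of_real (\<integral>t. p (?r t) \<partial>smeas E \<phi>)"
      by auto
    have "(\<lambda>t. Re (complex_of_real (p (?r t)))) \<in> borel_measurable borel"
      by (rule measurable_compose[OF bdd_borel_measurable[OF bp'] borel_measurable_Re])
    then have bp: "bdd_borel (\<lambda>t. p (?r t))" using bp' by (simp add: bdd_borel_def)
    have close: "\<bar>(\<integral>t. G (?r t) \<partial>smeas F \<phi>) - (\<integral>t. p (?r t) \<partial>smeas F \<phi>)\<bar> \<le> e / 4"
      if sfF: "spectral_family F" for F
    proof -
      interpret finite_borel_measure "smeas F \<phi>" by (rule smeas_finite[OF sfF])
      have "\<bar>(\<integral>t. G (?r t) \<partial>smeas F \<phi>) - (\<integral>t. p (?r t) \<partial>smeas F \<phi>)\<bar> = \<bar>\<integral>t. G (?r t) - p (?r t) \<partial>smeas F \<phi>\<bar>"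
        by (subst Bochner_Integration.integral_diff) (auto intro!: bdd_borel_integrable bG bp)
      also have "\<dots> \<le> (\<integral>t. \<bar>G (?r t) - p (?r t)\<bar> \<partial>smeas F \<phi>)"
        by (rule integral_abs_bound)
      also have "\<dots> \<le> (\<integral>t. e / (4 * N) \<partial>smeas F \<phi>)"
        using p(2)[OF r_in]
        by (intro integral_mono integrable_abs bdd_borel_integrable bdd_borel_diff bG bp bdd_borel_const) (auto intro: less_imp_le)
      also have "\<dots> = (norm \<phi>)\<^sup>2 * (e / (4 * N))" by (simp add: borel_UNIV smeas_UNIV[OF sfF])
      also have "\<dots> \<le> N * (e / (4 * N))" using N \<open>e > 0\<close> by (intro mult_right_mono) auto
      finally show ?thesis using N by simp
    qed
    have "(\<lambda>n. \<integral>t. p (?r t) \<partial>smeas (En n) \<phi>) \<longlonglongrightarrow> (\<integral>t. p (?r t) \<partial>smeas E \<phi>)"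
      using tendsto_Re[OF lim] by simp
    from LIMSEQ_D[OF this, of "e/4"] \<open>e > 0\<close> obtain n0 where
      n0: "\<And>n. n \<ge> n0 \<Longrightarrow> \<bar>(\<integral>t. p (?r t) \<partial>smeas (En n) \<phi>) - (\<integral>t. p (?r t) \<partial>smeas E \<phi>)\<bar> < e / 4" by auto
    show "\<exists>n0. \<forall>n\<ge>n0. norm ((\<integral>t. G (?r t) \<partial>smeas (En n) \<phi>) - (\<integral>t. G (?r t) \<partial>smeas E \<phi>)) < e"
    proof (intro exI allI impI)
      fix n assume "n \<ge> n0"
      show "norm ((\<integral>t. G (?r t) \<partial>smeas (En n) \<phi>) - (\<integral>t. G (?r t) \<partial>smeas E \<phi>)) < e"
        unfolding real_norm_def
        by (rule abs_diff_chain[OF close[OF sfo_sf[OF san sfon]] n0[OF \<open>n \<ge> n0\<close>] close[OF sfo_sf[OF sa sfo]]])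
          (use \<open>e > 0\<close> in simp)
    qed
  qed
  then show ?thesis unfolding Gr .
qed

text \<open>The cut-offs \<open>w k\<close> tend to \<open>1\<close> and are
\<open>\<bar>r\<bar>\<^sup>2\<close> times a bounded function, so that the weighted convergence
applies to \<open>w k h\<close> and to \<open>w k\<close> itself. The latter bounds uniformly what
is lost by cutting off.\<close>

lemma bounded_continuous_integral_tendsto:
  fixes h :: "real \<Rightarrow> real"
  assumes h: "continuous_on UNIV h" and C: "\<And>t. \<bar>h t\<bar> \<le> C"
  shows "(\<lambda>n. \<integral>t. h t \<partial>smeas (En n) \<phi>) \<longlonglongrightarrow> (\<integral>t. h t \<partial>smeas E \<phi>)"
proof (rule LIMSEQ_I)
  fix e :: real assume "e > 0"
  note sf = sfo_sf[OF sa sfo] and sfn = sfo_sf[OF san sfon]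
  interpret M: finite_borel_measure "smeas E \<phi>" by (rule smeas_finite[OF sf])
  define d where "d t = (cmod (complex_of_real t - z))\<^sup>2" for t
  define w where "w k t = real k / (real k + d t)" for k :: nat and t
  have d: "d t > 0" for t using z by (auto simp: d_def complex_eq_iff)
  have dc: "continuous_on UNIV d" unfolding d_def by (intro continuous_intros)
  have w01: "0 \<le> w k t" "w k t \<le> 1" for k t using d[of t] by (auto simp: w_def divide_simps)
  have wc: "continuous_on UNIV (w k)" for k
    unfolding w_def using d by (intro continuous_intros dc) (auto simp: add_nonneg_eq_0_iff less_le)
  have w_eq: "w k t = (cmod (1 / (complex_of_real t - z)))\<^sup>2 * (w k t * d t)" for k t
    using d[of t] by (simp add: d_def norm_divide power_divide)
  have wd: "\<bar>w k t * d t\<bar> \<le> real k" for k t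
  proof -
    have "d t / (real k + d t) \<le> 1" using d[of t] by (simp add: divide_simps)
    then have "real k * (d t / (real k + d t)) \<le> real k * 1" by (intro mult_left_mono) auto
    then show ?thesis using d[of t] by (simp add: w_def abs_mult)
  qed
  have weighted: "(\<lambda>n. \<integral>t. w k t * u t \<partial>smeas (En n) \<phi>) \<longlonglongrightarrow> (\<integral>t. w k t * u t \<partial>smeas E \<phi>)"
    if u: "continuous_on UNIV u" "\<And>t. \<bar>u t\<bar> \<le> D" for u D k
  proof -
    have "(\<lambda>n. \<integral>t. (cmod (1 / (complex_of_real t - z)))\<^sup>2 * (w k t * d t * u t) \<partial>smeas (En n) \<phi>)
      \<longlonglongrightarrow> (\<integral>t. (cmod (1 / (complex_of_real t - z)))\<^sup>2 * (w k t * d t * u t) \<partial>smeas E \<phi>)"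
    proof (rule weighted_integral_tendsto)
      show "continuous_on UNIV (\<lambda>t. w k t * d t * u t)" by (intro continuous_intros wc dc u)
      show "\<bar>w k t * d t * u t\<bar> \<le> real k * D" for t
        unfolding abs_mult[of "w k t * d t"] by (intro mult_mono wd u) auto
    qed
    moreover have "(cmod (1 / (complex_of_real t - z)))\<^sup>2 * (w k t * d t * u t) = w k t * u t" for t
      by (subst (2) w_eq) simp
    ultimately show ?thesis by simp
  qed
  have bw: "bdd_borel (w k)" for k
    using w01 by (intro bdd_borelI[where C=1] borel_measurable_continuous_onI wc) auto
  have bh: "bdd_borel h" using C by (intro bdd_borelI[where C=C] borel_measurable_continuous_onI h) auto
  have "C \<ge> 0" using C[of 0] by linarith
  \<comment> \<open>The error of a cut-off is bounded by the mass it misses; here the common total mass \<open>\<parallel>\<phi>\<parallel>\<^sup>2\<close> enters.\<close>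
  have cut: "\<bar>(\<integral>t. h t \<partial>smeas F \<phi>) - (\<integral>t. w k t * h t \<partial>smeas F \<phi>)\<bar> \<le> C * ((norm \<phi>)\<^sup>2 - (\<integral>t. w k t \<partial>smeas F \<phi>))"
    if sfF: "spectral_family F" for F k
  proof -
    interpret finite_borel_measure "smeas F \<phi>" by (rule smeas_finite[OF sfF])
    have "\<bar>(\<integral>t. h t \<partial>smeas F \<phi>) - (\<integral>t. w k t * h t \<partial>smeas F \<phi>)\<bar> = \<bar>\<integral>t. h t - w k t * h t \<partial>smeas F \<phi>\<bar>"
      by (subst Bochner_Integration.integral_diff) (auto intro!: bdd_borel_integrable bdd_borel_mult bh bw)
    also have "\<dots> \<le> (\<integral>t. \<bar>h t - w k t * h t\<bar> \<partial>smeas F \<phi>)" by (rule integral_abs_bound)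
    also have "\<dots> \<le> (\<integral>t. C * (1 - w k t) \<partial>smeas F \<phi>)"
    proof (intro integral_mono integrable_abs bdd_borel_integrable bdd_borel_diff bdd_borel_mult bdd_borel_const bh bw)
      fix t
      have "\<bar>h t - w k t * h t\<bar> = \<bar>h t\<bar> * (1 - w k t)"
      proof -
        have "h t - w k t * h t = h t * (1 - w k t)" by (simp add: right_diff_distrib mult.commute)
        then show ?thesis using w01(2)[of k t] by (simp add: abs_mult)
      qed
      also have "\<dots> \<le> C * (1 - w k t)" using w01[of k t] C by (intro mult_right_mono) auto
      finally show "\<bar>h t - w k t * h t\<bar> \<le> C * (1 - w k t)" .
    qed
    also have "\<dots> = C * ((norm \<phi>)\<^sup>2 - (\<integral>t. w k t \<partial>smeas F \<phi>))"
      using bdd_borel_integrable[OF bw] by (simp add: borel_UNIV smeas_UNIV[OF sfF])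
    finally show ?thesis .
  qed
  have "(\<lambda>k. \<integral>t. w k t \<partial>smeas E \<phi>) \<longlonglongrightarrow> (\<integral>t. 1 \<partial>smeas E \<phi>)"
  proof (rule integral_dominated_convergence[where w="\<lambda>_. 1"])
    show "AE t in smeas E \<phi>. (\<lambda>k. w k t) \<longlonglongrightarrow> 1"
    proof (intro AE_I2)
      fix t
      have "(\<lambda>k. 1 - d t / (d t + real k)) \<longlonglongrightarrow> 1 - 0"
        by (intro tendsto_diff tendsto_const tendsto_divide_0[OF tendsto_const] filterlim_at_top_imp_at_infinity
            filterlim_tendsto_add_at_top[OF tendsto_const] filterlim_real_sequentially)
      moreover have "w k t = 1 - d t / (d t + real k)" for k
        using d[of t] by (simp add: w_def field_simps add_nonneg_pos)
      ultimately show "(\<lambda>k. w k t) \<longlonglongrightarrow> 1" by simp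
    qed
  qed (use w01 bdd_borel_measurable[OF bw] in \<open>auto simp: measurable_cong_sets[OF M.M_is_borel refl]\<close>)
  then have "(\<lambda>k. C * ((norm \<phi>)\<^sup>2 - (\<integral>t. w k t \<partial>smeas E \<phi>))) \<longlonglongrightarrow> C * ((norm \<phi>)\<^sup>2 - (norm \<phi>)\<^sup>2)"
    by (intro tendsto_intros) (simp add: M.borel_UNIV smeas_UNIV[OF sf])
  from order_tendstoD(2)[OF this, of "e / 4"] \<open>e > 0\<close> obtain k where
    k: "C * ((norm \<phi>)\<^sup>2 - (\<integral>t. w k t \<partial>smeas E \<phi>)) < e / 4" by (auto simp: eventually_sequentially)
  have "(\<lambda>n. \<integral>t. w k t * 1 \<partial>smeas (En n) \<phi>) \<longlonglongrightarrow> (\<integral>t. w k t * 1 \<partial>smeas E \<phi>)"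
    by (rule weighted[where D=1]) (auto intro: continuous_intros)
  then have "(\<lambda>n. C * ((norm \<phi>)\<^sup>2 - (\<integral>t. w k t \<partial>smeas (En n) \<phi>))) \<longlonglongrightarrow> C * ((norm \<phi>)\<^sup>2 - (\<integral>t. w k t \<partial>smeas E \<phi>))"
    by (intro tendsto_intros) simp
  from order_tendstoD(2)[OF this k] obtain n1 where
    n1: "\<And>n. n \<ge> n1 \<Longrightarrow> C * ((norm \<phi>)\<^sup>2 - (\<integral>t. w k t \<partial>smeas (En n) \<phi>)) < e / 4" by (auto simp: eventually_sequentially)
  from LIMSEQ_D[OF weighted[OF h C], of "e / 4"] \<open>e > 0\<close> obtain n2 where
    n2: "\<And>n. n \<ge> n2 \<Longrightarrow> \<bar>(\<integral>t. w k t * h t \<partial>smeas (En n) \<phi>) - (\<integral>t. w k t * h t \<partial>smeas E \<phi>)\<bar> < e / 4" by auto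
  show "\<exists>n0. \<forall>n\<ge>n0. norm ((\<integral>t. h t \<partial>smeas (En n) \<phi>) - (\<integral>t. h t \<partial>smeas E \<phi>)) < e"
  proof (intro exI[of _ "max n1 n2"] allI impI)
    fix n assume "n \<ge> max n1 n2"
    then have "n \<ge> n1" "n \<ge> n2" by auto
    show "norm ((\<integral>t. h t \<partial>smeas (En n) \<phi>) - (\<integral>t. h t \<partial>smeas E \<phi>)) < e"
      unfolding real_norm_def
      by (rule abs_diff_chain[OF cut[OF sfn, of n k] n2[OF \<open>n \<ge> n2\<close>] cut[OF sf, of k]])
        (use n1[OF \<open>n \<ge> n1\<close>] k \<open>e > 0\<close> in linarith)
  qed
qed

end

section \<open>Lipschitz envelopes\<close>

text \<open>The smallest \<open>k\<close>-Lipschitz majorant of a bounded function.\<close>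

definition lip_env :: "(real \<Rightarrow> real) \<Rightarrow> nat \<Rightarrow> real \<Rightarrow> real"
  where "lip_env f k x = (SUP y. f y - real k * \<bar>x - y\<bar>)"

text \<open>The upper semicontinuous envelope of a bounded function; the lower one of
\<open>f\<close> is \<open>- usc_env (- f)\<close>.\<close>

definition usc_env :: "(real \<Rightarrow> real) \<Rightarrow> real \<Rightarrow> real"
  where "usc_env f x = (INF k. lip_env f k x)"

context
  fixes f :: "real \<Rightarrow> real" and C :: real
  assumes C: "\<forall>t. \<bar>f t\<bar> \<le> C"
begin

lemma bump_le_bound: "f y - real k * \<bar>x - y\<bar> \<le> C"
proof -
  have "0 \<le> real k * \<bar>x - y\<bar>" by simp
  then show ?thesis using C[rule_format, of y] by linarith
qed

lemma lip_env_bdd_above: "bdd_above (range (\<lambda>y. f y - real k * \<bar>x - y\<bar>))"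
proof (rule bdd_aboveI2)
  show "f y - real k * \<bar>x - y\<bar> \<le> C" for y by (rule bump_le_bound)
qed

lemma lip_env_ge: "f y \<le> lip_env f k x + real k * \<bar>x - y\<bar>"
proof -
  have "f y - real k * \<bar>x - y\<bar> \<le> lip_env f k x"
    unfolding lip_env_def by (rule cSUP_upper[OF UNIV_I lip_env_bdd_above])
  then show ?thesis by linarith
qed

lemma lip_env_ge_self: "f x \<le> lip_env f k x"
  using lip_env_ge[of x k x] by simp

lemma lip_env_le: "(\<And>y. f y - real k * \<bar>x - y\<bar> \<le> B) \<Longrightarrow> lip_env f k x \<le> B"
  unfolding lip_env_def by (rule cSUP_least) auto

lemma lip_env_abs_le: "\<bar>lip_env f k x\<bar> \<le> C"
proof -
  have "lip_env f k x \<le> C"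
    by (rule lip_env_le) (rule bump_le_bound)
  moreover have "- C \<le> lip_env f k x" using lip_env_ge_self[of x k] C[rule_format, of x] by linarith
  ultimately show ?thesis by linarith
qed

lemma lip_env_lipschitz: "lip_env f k x \<le> lip_env f k x' + real k * \<bar>x - x'\<bar>"
proof (rule lip_env_le)
  fix y
  have "real k * \<bar>x' - y\<bar> \<le> real k * (\<bar>x - x'\<bar> + \<bar>x - y\<bar>)" by (rule mult_left_mono) auto
  then show "f y - real k * \<bar>x - y\<bar> \<le> lip_env f k x' + real k * \<bar>x - x'\<bar>"
    using lip_env_ge[of y k x'] by (simp add: distrib_left)
qed

lemma continuous_lip_env: "continuous_on UNIV (lip_env f k)"
proof -
  have "(real k)-lipschitz_on UNIV (lip_env f k)"
  proof (rule lipschitz_onI)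
    fix x y
    show "dist (lip_env f k x) (lip_env f k y) \<le> real k * dist x y"
      using lip_env_lipschitz[of k x y] lip_env_lipschitz[of k y x]
      by (auto simp: dist_real_def abs_minus_commute)
  qed simp
  then show ?thesis by (rule lipschitz_on_continuous_on)
qed

lemma lip_env_decseq: "decseq (\<lambda>k. lip_env f k x)"
proof (rule decseq_SucI, rule lip_env_le)
  fix k y
  have "real k * \<bar>x - y\<bar> \<le> real (Suc k) * \<bar>x - y\<bar>" by (rule mult_right_mono) auto
  then show "f y - real (Suc k) * \<bar>x - y\<bar> \<le> lip_env f k x" using lip_env_ge[of y k x] by linarith
qed

lemma lip_env_bdd_below: "bdd_below (range (\<lambda>k. lip_env f k x))"
  by (rule bdd_belowI2[where m="- C"]) (use lip_env_abs_le in \<open>simp add: abs_le_iff minus_le_iff\<close>)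

lemma lip_env_tendsto: "(\<lambda>k. lip_env f k x) \<longlonglongrightarrow> usc_env f x"
  unfolding usc_env_def by (rule LIMSEQ_decseq_INF[OF lip_env_bdd_below lip_env_decseq])

lemma usc_env_ge: "f x \<le> usc_env f x"
  unfolding usc_env_def by (rule cINF_greatest) (auto intro: lip_env_ge_self)

lemma usc_env_le_lip_env: "usc_env f x \<le> lip_env f k x"
  unfolding usc_env_def by (rule cINF_lower[OF lip_env_bdd_below]) simp

lemma usc_env_abs_le: "\<bar>usc_env f x\<bar> \<le> C"
  using usc_env_ge[of x] usc_env_le_lip_env[of x 0] lip_env_abs_le[of 0 x] C[rule_format, of x] by linarith

lemma bdd_borel_usc_env: "bdd_borel (usc_env f)"
proof (rule bdd_borelI[where C=C])
  show "usc_env f \<in> borel_measurable borel"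
    by (rule borel_measurable_LIMSEQ_real[OF lip_env_tendsto])
      (intro borel_measurable_continuous_onI continuous_lip_env)
qed (simp add: usc_env_abs_le)

text \<open>The envelope at \<open>x\<close> depends on \<open>f\<close> near \<open>x\<close>
only: for large \<open>k\<close> the penalty \<open>k \<bar>x - y\<bar>\<close> rules out distant
points.\<close>

lemma usc_env_local:
  assumes \<delta>: "\<delta> > 0" and B: "\<And>y. \<bar>y - x\<bar> < \<delta> \<Longrightarrow> f y \<le> B"
  shows "usc_env f x \<le> B"
proof -
  obtain k :: nat where "2 * C / \<delta> \<le> real k" using real_arch_simple by blast
  then have k: "2 * C \<le> real k * \<delta>" using \<delta> by (simp add: pos_divide_le_eq)
  have "lip_env f k x \<le> B"
  proof (rule lip_env_le)
    fix y
    show "f y - real k * \<bar>x - y\<bar> \<le> B"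
    proof (cases "\<bar>y - x\<bar> < \<delta>")
      case True
      have "0 \<le> real k * \<bar>x - y\<bar>" by simp
      then show ?thesis using B[OF True] by linarith
    next
      case False
      then have "real k * \<delta> \<le> real k * \<bar>x - y\<bar>" by (intro mult_left_mono) auto
      moreover have "f x \<le> B" using B[of x] \<delta> by simp
      ultimately show ?thesis using k C[rule_format, of x] C[rule_format, of y] by linarith
    qed
  qed
  then show ?thesis using usc_env_le_lip_env[of x k] by linarith
qed

lemma usc_env_isCont:
  assumes "isCont f x"
  shows "usc_env f x = f x"
proof (rule antisym[OF field_le_epsilon usc_env_ge])
  fix e :: real assume "e > 0"
  then obtain \<delta> where "\<delta> > 0" "\<And>y. \<bar>y - x\<bar> < \<delta> \<Longrightarrow> \<bar>f y - f x\<bar> < e"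
    using assms unfolding continuous_at_eps_delta real_norm_def dist_real_def by blast
  then show "usc_env f x \<le> f x + e"
    by (intro usc_env_local[of \<delta>]) (auto simp: abs_less_iff algebra_simps intro: less_imp_le)
qed

end

text \<open>If both envelopes take the value \<open>f x\<close>, then near \<open>x\<close> the
function is confined between two Lipschitz functions with values close to \<open>f x\<close>
there.\<close>

lemma isCont_usc_env:
  assumes C: "\<forall>t. \<bar>f t\<bar> \<le> C" and u: "usc_env f x = f x" and l: "usc_env (\<lambda>t. - f t) x = - f x"
  shows "isCont f x"
proof -
  have C': "\<forall>t. \<bar>- f t\<bar> \<le> C" using C by simp
  have half: "\<exists>\<delta>>0. \<forall>y. \<bar>y - x\<bar> < \<delta> \<longrightarrow> g y < g x + e"
    if g: "\<forall>t. \<bar>g t\<bar> \<le> C" "usc_env g x = g x" and e: "e > 0" for g :: "real \<Rightarrow> real" and e :: real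
  proof -
    have "(\<lambda>k. lip_env g k x) \<longlonglongrightarrow> g x" using lip_env_tendsto[OF g(1), of x] g(2) by simp
    from order_tendstoD(2)[OF this, of "g x + e / 2"] e obtain k where
      k: "lip_env g k x < g x + e / 2" by (auto simp: eventually_sequentially)
    show ?thesis
    proof (intro exI[of _ "e / (2 * (real k + 1))"] conjI allI impI)
      show "e / (2 * (real k + 1)) > 0" using e by simp
      fix y assume "\<bar>y - x\<bar> < e / (2 * (real k + 1))"
      then have "(real k + 1) * \<bar>y - x\<bar> < e / 2" by (simp add: pos_less_divide_eq algebra_simps)
      moreover have "real k * \<bar>x - y\<bar> \<le> (real k + 1) * \<bar>y - x\<bar>"
        unfolding abs_minus_commute[of x y] by (rule mult_right_mono) auto
      ultimately show "g y < g x + e" using k lip_env_ge[OF g(1), of y k x] by linarith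
    qed
  qed
  show ?thesis
    unfolding continuous_at_eps_delta real_norm_def dist_real_def
  proof (intro allI impI)
    fix e :: real assume e: "e > 0"
    obtain \<delta> where 1: "\<delta> > 0" "\<And>y. \<bar>y - x\<bar> < \<delta> \<Longrightarrow> f y < f x + e" using half[OF C u e] by blast
    obtain \<delta>' where 2: "\<delta>' > 0" "\<And>y. \<bar>y - x\<bar> < \<delta>' \<Longrightarrow> - f y < - f x + e" using half[OF C' l e] by blast
    show "\<exists>d>0. \<forall>y. \<bar>y - x\<bar> < d \<longrightarrow> \<bar>f y - f x\<bar> < e"
    proof (intro exI[of _ "min \<delta> \<delta>'"] conjI allI impI)
      fix y assume "\<bar>y - x\<bar> < min \<delta> \<delta>'"
      then show "\<bar>f y - f x\<bar> < e" using 1(2)[of y] 2(2)[of y] by linarith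
    qed (use 1 2 in auto)
  qed
qed

text \<open>The Lipschitz majorants decrease to \<open>f\<close> at points of continuity, so one
of them has an integral close to that of \<open>f\<close> for the limit measure; to it weak
convergence applies. Being Borel, it also serves for the completed measures.\<close>

lemma AE_continuous_limsup:
  fixes f :: "real \<Rightarrow> real"
  assumes Mn: "\<And>n. finite_borel_measure (Mn n)" and M: "finite_borel_measure M"
    and weak: "\<And>(h :: real \<Rightarrow> real) C. continuous_on UNIV h \<Longrightarrow> \<forall>t. \<bar>h t\<bar> \<le> C \<Longrightarrow> (\<lambda>n. \<integral>t. h t \<partial>Mn n) \<longlonglongrightarrow> (\<integral>t. h t \<partial>M)"
    and C: "\<forall>t. \<bar>f t\<bar> \<le> C"
    and fn: "\<And>n. f \<in> borel_measurable (completion (Mn n))" and f: "f \<in> borel_measurable (completion M)"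
    and cont: "AE t in M. isCont f t" and e: "e > 0"
  shows "\<forall>\<^sub>F n in sequentially. (\<integral>t. f t \<partial>completion (Mn n)) < (\<integral>t. f t \<partial>completion M) + e"
proof -
  interpret M: finite_borel_measure M by fact
  have env: "bdd_borel (lip_env f k)" for k
    by (intro bdd_borelI[where C=C] borel_measurable_continuous_onI continuous_lip_env[OF C])
      (simp add: lip_env_abs_le[OF C])
  have fin: "finite_measure (completion N)" if "finite_borel_measure N" for N
  proof -
    interpret N: finite_borel_measure N by fact
    show ?thesis using N.emeasure_finite[of UNIV] by (intro finite_measureI) (simp add: N.borel_UNIV N.M_is_borel)
  qed
  have envm: "lip_env f k \<in> borel_measurable N" if "finite_borel_measure N" for k N
    using bdd_borel_measurable[OF env] by (simp add: measurable_cong_sets[OF finite_borel_measure.M_is_borel[OF that] refl])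
  have envi: "integrable (completion N) (lip_env f k)" if "finite_borel_measure N" for k N
    using finite_borel_measure.bdd_borel_integrable[OF that env] by (simp add: integrable_completion envm[OF that])
  have "(\<lambda>k. \<integral>t. lip_env f k t \<partial>completion M) \<longlonglongrightarrow> (\<integral>t. f t \<partial>completion M)"
  proof (rule integral_dominated_convergence[where w="\<lambda>_. C"])
    show "integrable (completion M) (\<lambda>_. C)" using finite_measure.integrable_const[OF fin[OF M]] .
    show "AE t in completion M. (\<lambda>k. lip_env f k t) \<longlonglongrightarrow> f t"
      by (rule AE_completion, rule AE_mp[OF cont], intro AE_I2 impI)
        (use lip_env_tendsto[OF C] usc_env_isCont[OF C] in metis)
    show "AE t in completion M. norm (lip_env f k t) \<le> C" for k by (simp add: lip_env_abs_le[OF C])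
  qed (auto intro!: f measurable_completion envm[OF M])
  from order_tendstoD(2)[OF this, of "(\<integral>t. f t \<partial>completion M) + e"] e obtain k where
    "(\<integral>t. lip_env f k t \<partial>completion M) < (\<integral>t. f t \<partial>completion M) + e" by (auto simp: eventually_sequentially)
  then have "(\<integral>t. lip_env f k t \<partial>M) < (\<integral>t. f t \<partial>completion M) + e"
    by (simp add: integral_completion[OF envm[OF M]])
  moreover have "\<forall>t. \<bar>lip_env f k t\<bar> \<le> C" by (simp add: lip_env_abs_le[OF C])
  from weak[where h="lip_env f k", OF continuous_lip_env[OF C] this]
  have "(\<lambda>n. \<integral>t. lip_env f k t \<partial>Mn n) \<longlonglongrightarrow> (\<integral>t. lip_env f k t \<partial>M)" .
  ultimately
  have "\<forall>\<^sub>F n in sequentially. (\<integral>t. lip_env f k t \<partial>Mn n) < (\<integral>t. f t \<partial>completion M) + e"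
    by (intro order_tendstoD(2))
  then show ?thesis
  proof eventually_elim
    case (elim n)
    have "(\<integral>t. f t \<partial>completion (Mn n)) \<le> (\<integral>t. lip_env f k t \<partial>completion (Mn n))"
    proof (rule integral_mono)
      show "integrable (completion (Mn n)) f"
        by (rule finite_measure.integrable_const_bound[OF fin[OF Mn], where B=C]) (auto simp: C fn)
    qed (auto intro: envi[OF Mn] lip_env_ge_self[OF C])
    then show ?case using elim by (simp add: integral_completion[OF envm[OF Mn]])
  qed
qed

lemma AE_continuous_integral_tendsto:
  fixes f :: "real \<Rightarrow> real"
  assumes Mn: "\<And>n. finite_borel_measure (Mn n)" and M: "finite_borel_measure M"
    and weak: "\<And>(h :: real \<Rightarrow> real) C. continuous_on UNIV h \<Longrightarrow> \<forall>t. \<bar>h t\<bar> \<le> C \<Longrightarrow> (\<lambda>n. \<integral>t. h t \<partial>Mn n) \<longlonglongrightarrow> (\<integral>t. h t \<partial>M)"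
    and C: "\<forall>t. \<bar>f t\<bar> \<le> C"
    and fn: "\<And>n. f \<in> borel_measurable (completion (Mn n))" and f: "f \<in> borel_measurable (completion M)"
    and cont: "AE t in M. isCont f t"
  shows "(\<lambda>n. \<integral>t. f t \<partial>completion (Mn n)) \<longlonglongrightarrow> (\<integral>t. f t \<partial>completion M)"
proof (rule order_tendstoI)
  fix a assume "(\<integral>t. f t \<partial>completion M) < a"
  then show "\<forall>\<^sub>F n in sequentially. (\<integral>t. f t \<partial>completion (Mn n)) < a"
    using AE_continuous_limsup[where f=f and Mn=Mn, OF Mn M weak C fn f cont, where e="a - (\<integral>t. f t \<partial>completion M)"] by simp
next
  fix a assume a: "a < (\<integral>t. f t \<partial>completion M)"
  have C': "\<forall>t. \<bar>- f t\<bar> \<le> C" using C by simp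
  have "\<forall>\<^sub>F n in sequentially. (\<integral>t. - f t \<partial>completion (Mn n)) < (\<integral>t. - f t \<partial>completion M) + ((\<integral>t. f t \<partial>completion M) - a)"
  proof (rule AE_continuous_limsup[where f="\<lambda>t. - f t" and Mn=Mn, OF Mn M weak C'])
    show "AE t in M. isCont (\<lambda>t. - f t) t" using cont by eventually_elim (rule isCont_minus)
  qed (use fn f a in auto)
  then show "\<forall>\<^sub>F n in sequentially. a < (\<integral>t. f t \<partial>completion (Mn n))"
    by eventually_elim simp
qed

section \<open>Darboux--Stieltjes integrability and continuity almost everywhere\<close>

lemma lower_sum_upper_sum: "lower_sum f \<rho> p = - upper_sum (\<lambda>t. - f t) \<rho> p"
proof -
  have "(INF x\<in>S. f x) = - (SUP x\<in>S. - f x)" for S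
    by (simp add: Inf_real_def image_image)
  then show ?thesis
    by (simp add: lower_sum_def upper_sum_def split_beta sum_negf[symmetric])
qed

context finite_borel_measure
begin

text \<open>Inside the interval the envelope is bounded by the supremum over the closed interval.
The right end point belongs to the interval of integration but has neighbours outside; there
either the measure has no atom or \<open>f\<close> is continuous and coincides with its
envelope.\<close>

lemma integral_usc_env_interval:
  assumes C: "\<forall>t. \<bar>f t\<bar> \<le> C" and atoms: "\<And>x. measure M {x} \<noteq> 0 \<Longrightarrow> isCont f x" and s: "s < s'"
  shows "(\<integral>x. indicator {s<..s'} x * usc_env f x \<partial>M) \<le> (SUP x\<in>{s..s'}. f x) * (cdf M s' - cdf M s)"
proof -
  let ?S = "SUP x\<in>{s..s'}. f x"
  have bdd: "bdd_above (f ` {s..s'})"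
    by (rule bdd_aboveI2[where M=C]) (use C in \<open>simp add: abs_le_iff\<close>)
  have S: "f y \<le> ?S" if "y \<in> {s..s'}" for y using that by (rule cSUP_upper[OF _ bdd])
  have inner: "usc_env f x \<le> ?S" if "s < x" "x < s'" for x
    by (rule usc_env_local[OF C, of "min (x - s) (s' - x)"]) (use that in \<open>auto intro!: S\<close>)
  have "AE x in M. x \<noteq> s' \<or> isCont f s'"
  proof (cases "measure M {s'} = 0")
    case True
    then have "{s'} \<in> null_sets M" by (auto simp: emeasure_eq_measure M_is_borel intro!: null_setsI)
    then have "AE x in M. x \<notin> {s'}" by (rule AE_not_in)
    then show ?thesis by eventually_elim auto
  next
    case False
    then show ?thesis using atoms by simp
  qed
  then have le: "AE x in M. indicator {s<..s'} x * usc_env f x \<le> ?S * indicator {s<..s'} x"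
  proof eventually_elim
    case (elim x)
    consider "x \<notin> {s<..s'}" | "s < x" "x < s'" | "x = s'" using s by fastforce
    then show ?case
    proof cases
      case 3
      then show ?thesis using elim usc_env_isCont[OF C] S[of s'] s by simp
    qed (use inner in auto)
  qed
  have "(\<integral>x. indicator {s<..s'} x * usc_env f x \<partial>M) \<le> (\<integral>x. ?S * indicator {s<..s'} x \<partial>M)"
    by (intro integral_mono_AE le bdd_borel_integrable bdd_borel_mult bdd_borel_const bdd_borel_usc_env[OF C]
        bdd_borel_indicator) simp_all
  also have "\<dots> = ?S * (cdf M s' - cdf M s)"
    using cdf_diff_eq[OF s] by (simp add: borel_UNIV)
  finally show ?thesis .
qed

lemma integral_usc_env_upper_sum:
  assumes C: "\<forall>t. \<bar>f t\<bar> \<le> C" and atoms: "\<And>x. measure M {x} \<noteq> 0 \<Longrightarrow> isCont f x" and p: "p \<in> partitions a b"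
  shows "(\<integral>x. indicator {a<..b} x * usc_env f x \<partial>M) \<le> upper_sum f (cdf M) p"
proof -
  obtain n t where p_eq: "p = (n, t)" and t: "t 0 = a" "t n = b" "\<And>k. k < n \<Longrightarrow> t k < t (Suc k)"
    using p by (auto simp: partitions_def)
  have "m \<le> n \<Longrightarrow> a \<le> t m \<and> (\<integral>x. indicator {a<..t m} x * usc_env f x \<partial>M)
      \<le> (\<Sum>k<m. (SUP x\<in>{t k..t (Suc k)}. f x) * (cdf M (t (Suc k)) - cdf M (t k)))" for m
  proof (induction m)
    case 0
    then show ?case using t by simp
  next
    case (Suc m)
    then have IH: "a \<le> t m" "(\<integral>x. indicator {a<..t m} x * usc_env f x \<partial>M)
      \<le> (\<Sum>k<m. (SUP x\<in>{t k..t (Suc k)}. f x) * (cdf M (t (Suc k)) - cdf M (t k)))" and lt: "t m < t (Suc m)"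
      using t(3)[of m] by auto
    have "(\<integral>x. indicator {a<..t (Suc m)} x * usc_env f x \<partial>M)
      = (\<integral>x. indicator {a<..t m} x * usc_env f x + indicator {t m<..t (Suc m)} x * usc_env f x \<partial>M)"
      by (intro Bochner_Integration.integral_cong refl) (use IH(1) lt in \<open>auto simp: indicator_def\<close>)
    also have "\<dots> = (\<integral>x. indicator {a<..t m} x * usc_env f x \<partial>M) + (\<integral>x. indicator {t m<..t (Suc m)} x * usc_env f x \<partial>M)"
      by (intro Bochner_Integration.integral_add bdd_borel_integrable bdd_borel_mult bdd_borel_usc_env[OF C]
        bdd_borel_indicator) simp_all
    finally show ?case
      using IH lt integral_usc_env_interval[OF C atoms lt] by simp
  qed
  from this[of n] show ?thesis by (simp add: p_eq upper_sum_def t)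
qed

text \<open>Integrability leaves no gap between the integrals of the two envelopes, whose
difference is nonnegative. Hence it vanishes almost everywhere.\<close>

lemma DS_integrable_AE_isCont:
  assumes C: "\<forall>t. \<bar>f t\<bar> \<le> C" and atoms: "\<And>x. measure M {x} \<noteq> 0 \<Longrightarrow> isCont f x"
    and DS: "DS_integrable f (cdf M)"
  shows "AE x in M. isCont f x"
proof -
  have C': "\<forall>t. \<bar>- f t\<bar> \<le> C" using C by simp
  have atoms': "isCont (\<lambda>t. - f t) x" if "measure M {x} \<noteq> 0" for x
    using atoms[OF that] by (rule isCont_minus)
  let ?d = "\<lambda>x. usc_env f x + usc_env (\<lambda>t. - f t) x"
  have d0: "?d x \<ge> 0" for x using usc_env_ge[OF C, of x] usc_env_ge[OF C', of x] by linarith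
  have interval: "AE x in M. x \<in> {a<..b} \<longrightarrow> ?d x = 0" if "a < b" for a b
  proof -
    let ?u = "\<lambda>g x. indicator {a<..b} x * usc_env g x"
    have ui: "integrable M (?u f)" "integrable M (?u (\<lambda>t. - f t))"
      by (intro bdd_borel_integrable bdd_borel_mult bdd_borel_usc_env[OF C] bdd_borel_usc_env[OF C']
        bdd_borel_indicator; simp)+
    have ne: "partitions a b \<noteq> {}"
    proof -
      have "(1, \<lambda>k. if k = 0 then a else b) \<in> partitions a b" using that by (simp add: partitions_def)
      then show ?thesis by blast
    qed
    have "(\<integral>x. ?u f x \<partial>M) \<le> (INF p\<in>partitions a b. upper_sum f (cdf M) p)"
      by (intro cINF_greatest ne integral_usc_env_upper_sum[OF C atoms])
    also have "\<dots> = (SUP p\<in>partitions a b. lower_sum f (cdf M) p)"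
      using DS that by (simp add: DS_integrable_def DS_integrable_on_def)
    also have "\<dots> \<le> - (\<integral>x. ?u (\<lambda>t. - f t) x \<partial>M)"
      using integral_usc_env_upper_sum[OF C' atoms'] by (intro cSUP_least ne) (simp add: lower_sum_upper_sum)
    finally have "(\<integral>x. ?u f x + ?u (\<lambda>t. - f t) x \<partial>M) \<le> 0"
      using ui by simp
    then have "(\<integral>x. indicator {a<..b} x * ?d x \<partial>M) \<le> 0" by (simp add: distrib_left)
    moreover have "(\<integral>x. indicator {a<..b} x * ?d x \<partial>M) \<ge> 0"
      using d0 by (intro integral_nonneg_AE AE_I2) (simp add: mult_nonneg_nonneg)
    ultimately have "(\<integral>x. indicator {a<..b} x * ?d x \<partial>M) = 0" by linarith
    moreover have "integrable M (\<lambda>x. indicator {a<..b} x * ?d x)"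
      using Bochner_Integration.integrable_add[OF ui] by (simp add: distrib_left)
    ultimately have "AE x in M. indicator {a<..b} x * ?d x = 0"
      using d0 by (subst (asm) integral_nonneg_eq_0_iff_AE) (auto simp: mult_nonneg_nonneg)
    then show ?thesis by eventually_elim auto
  qed
  have "AE x in M. \<forall>N::nat. x \<in> {- (real N + 1)<..real N + 1} \<longrightarrow> ?d x = 0"
    unfolding AE_all_countable by (intro allI interval) linarith
  then show ?thesis
  proof eventually_elim
    case (elim x)
    obtain N :: nat where "\<bar>x\<bar> \<le> real N" using real_arch_simple by blast
    then have "x \<in> {- (real N + 1)<..real N + 1}" by auto
    with elim have "?d x = 0" by blast
    then have "usc_env f x = f x" "usc_env (\<lambda>t. - f t) x = - f x"
      using usc_env_ge[OF C, of x] usc_env_ge[OF C', of x] by linarith+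
    then show ?case by (rule isCont_usc_env[OF C])
  qed
qed

end

section \<open>Convergence of functions of the operators\<close>

text \<open>The restriction to the spectrum in \<open>fun_of_op\<close> changes \<open>f\<close>
on a null set only.\<close>

lemma
  fixes f :: "real \<Rightarrow> real"
  assumes sa: "self_adjoint A" and sfo: "spectral_family_of E A"
    and f: "spectral_measurable E f" and C: "\<And>t. \<bar>f t\<bar> \<le> C"
  shows fun_of_op_polar: "cinner \<psi> (op_app (fun_of_op A E f) \<phi>)
      = polar (\<lambda>\<xi>. complex_of_real (\<integral>t. f t \<partial>spectral_measure E \<xi>)) \<psi> \<phi>"
    and fun_of_op_expectation: "cinner \<phi> (op_app (fun_of_op A E f) \<phi>) = complex_of_real (\<integral>t. f t \<partial>spectral_measure E \<phi>)"
    and fun_of_op_norm_sq: "(norm (op_app (fun_of_op A E f) \<phi>))\<^sup>2 = (\<integral>t. (f t)\<^sup>2 \<partial>spectral_measure E \<phi>)"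
proof -
  note sf = sfo_sf[OF sa sfo]
  let ?\<sigma> = "{s. complex_of_real s \<in> op_spectrum A}"
  define g where "g t = indicator ?\<sigma> t * f t" for t
  have fun_eq: "fun_of_op A E f = spectral_integral E g" by (simp add: fun_of_op_def g_def[abs_def])
  have AE: "AE t in spectral_measure E \<xi>. g t = f t" for \<xi>
    unfolding spectral_measure_smeas
    by (rule AE_completion, rule AE_mp[OF AE_spectrum[OF sa sfo]]) (simp add: g_def)
  have fm: "f \<in> borel_measurable (spectral_measure E \<xi>)" for \<xi>
    using f by (simp add: spectral_measurable_def)
  have \<sigma>: "?\<sigma> \<in> sets (spectral_measure E \<xi>)" for \<xi>
  proof -
    have "AE t in smeas E \<xi>. \<not> (complex_of_real t \<notin> op_spectrum A)" using AE_spectrum[OF sa sfo] by simp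
    from pred_intros_logic(2)[OF sets_completion_AE[OF this]]
    have "Measurable.pred (spectral_measure E \<xi>) (\<lambda>t. complex_of_real t \<in> op_spectrum A)"
      unfolding spectral_measure_smeas by simp
    then show ?thesis
      by (simp add: pred_def spectral_measure_smeas finite_borel_measure.borel_UNIV[OF smeas_finite[OF sf]])
  qed
  have gm: "g \<in> borel_measurable (spectral_measure E \<xi>)" for \<xi>
    unfolding g_def by (intro borel_measurable_times borel_measurable_indicator \<sigma> fm)
  then have g: "spectral_measurable E g" by (simp add: spectral_measurable_def)
  have gC: "\<bar>g t\<bar> \<le> C" for t using C[of t] order_trans[OF abs_ge_zero C] by (simp add: g_def indicator_def)
  have int: "(\<integral>t. g t \<partial>spectral_measure E \<xi>) = (\<integral>t. f t \<partial>spectral_measure E \<xi>)" for \<xi>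
    by (intro integral_cong_AE gm fm AE)
  have int2: "(\<integral>t. (g t)\<^sup>2 \<partial>spectral_measure E \<xi>) = (\<integral>t. (f t)\<^sup>2 \<partial>spectral_measure E \<xi>)" for \<xi>
    by (rule integral_cong_AE) (use gm[of \<xi>] fm[of \<xi>] AE[of \<xi>] in auto)
  show "cinner \<psi> (op_app (fun_of_op A E f) \<phi>)
      = polar (\<lambda>\<xi>. complex_of_real (\<integral>t. f t \<partial>spectral_measure E \<xi>)) \<psi> \<phi>"
    using bounded_function_of_operator(1)[OF sf g gC] by (simp add: fun_eq spectral_form_polar int)
  show "cinner \<phi> (op_app (fun_of_op A E f) \<phi>) = complex_of_real (\<integral>t. f t \<partial>spectral_measure E \<phi>)"
    using bounded_function_of_operator(2)[OF sf g gC] by (simp add: fun_eq int)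
  show "(norm (op_app (fun_of_op A E f) \<phi>))\<^sup>2 = (\<integral>t. (f t)\<^sup>2 \<partial>spectral_measure E \<phi>)"
    using bounded_function_of_operator(3)[OF sf g gC] by (simp add: fun_eq int2)
qed

theorem theorem9:
  fixes An :: "nat \<Rightarrow> 'h::complex_hilbert_space operator"
    and A :: "'h operator"
    and En :: "nat \<Rightarrow> real \<Rightarrow> 'h \<Rightarrow> 'h"
    and E :: "real \<Rightarrow> 'h \<Rightarrow> 'h"
    and f :: "real \<Rightarrow> real"
  assumes "\<And>n. self_adjoint (An n)"
    and "self_adjoint A"
    and "\<And>n. spectral_family_of (En n) (An n)"
    and "spectral_family_of E A"
    and "strong_resolvent_convergence An A"
    and "bounded (range f)"
    and "\<And>n. spectral_measurable (En n) f"
    and "spectral_measurable E f"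
    and "\<And>t. op_eigenvalue A (complex_of_real t) \<Longrightarrow> isCont f t"
  shows "(\<forall>\<phi>. DS_integrable_vec f E \<phi> \<longrightarrow>
            (\<lambda>n. cinner \<phi> (op_app (fun_of_op (An n) (En n) f) \<phi>))
              \<longlonglongrightarrow> cinner \<phi> (op_app (fun_of_op A E f) \<phi>)) \<and>
         (\<forall>\<psi> \<phi>. DS_integrable_pair f E \<psi> \<phi> \<longrightarrow>
            (\<lambda>n. cinner \<psi> (op_app (fun_of_op (An n) (En n) f) \<phi>))
              \<longlonglongrightarrow> cinner \<psi> (op_app (fun_of_op A E f) \<phi>)) \<and>
         (DS_integrable_family f E \<longrightarrow>
            (\<forall>\<phi>. (\<lambda>n. op_app (fun_of_op (An n) (En n) f) \<phi>)
              \<longlonglongrightarrow> op_app (fun_of_op A E f) \<phi>))"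
proof -
  note san = assms(1) and sa = assms(2) and sfon = assms(3) and sfo = assms(4)
  note sfn = sfo_sf[OF san sfon] and sf = sfo_sf[OF sa sfo]
  obtain C where C: "\<And>t. \<bar>f t\<bar> \<le> C"
    using assms(6) by (auto simp: bounded_iff)
  obtain z where z: "Im z \<noteq> 0" "\<And>\<phi>. (\<lambda>n. resolvent (An n) z \<phi>) \<longlonglongrightarrow> resolvent A z \<phi>"
    using assms(5) by (auto simp: strong_resolvent_convergence_def)
  have AE_cont: "AE t in smeas E \<phi>. isCont f t" if "DS_integrable_vec f E \<phi>" for \<phi>
  proof (rule finite_borel_measure.DS_integrable_AE_isCont[OF smeas_finite[OF sf] allI[OF C]])
    show "isCont f x" if "measure (smeas E \<phi>) {x} \<noteq> 0" for x
      by (rule assms(9)[OF atom_eigenvalue[OF sa sfo that]])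
    show "DS_integrable f (cdf (smeas E \<phi>))"
      using that by (simp add: DS_integrable_vec_def smeas_cdf[OF sf, abs_def])
  qed
  have integral_lim: "(\<lambda>n. \<integral>t. g t \<partial>spectral_measure (En n) \<phi>) \<longlonglongrightarrow> (\<integral>t. g t \<partial>spectral_measure E \<phi>)"
    if g: "\<forall>t. \<bar>g t\<bar> \<le> D" "\<And>n. spectral_measurable (En n) g" "spectral_measurable E g"
      "AE t in smeas E \<phi>. isCont g t" for g :: "real \<Rightarrow> real" and D \<phi>
    unfolding spectral_measure_smeas
  proof (rule AE_continuous_integral_tendsto[where f=g, OF smeas_finite[OF sfn] smeas_finite[OF sf] _ g(1)])
    show "(\<lambda>n. \<integral>t. h t \<partial>smeas (En n) \<phi>) \<longlonglongrightarrow> (\<integral>t. h t \<partial>smeas E \<phi>)"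
      if "continuous_on UNIV h" "\<forall>t. \<bar>h t\<bar> \<le> B" for h :: "real \<Rightarrow> real" and B
      by (rule bounded_continuous_integral_tendsto[of An A En E z h B, OF san sa sfon sfo z that(1) that(2)[rule_format]])
  qed (use g(2-4) in \<open>auto simp: spectral_measurable_def spectral_measure_smeas\<close>)
  note f_lim = integral_lim[OF allI[OF C] assms(7,8) AE_cont]
  have part1: "(\<lambda>n. cinner \<phi> (op_app (fun_of_op (An n) (En n) f) \<phi>)) \<longlonglongrightarrow> cinner \<phi> (op_app (fun_of_op A E f) \<phi>)"
    if "DS_integrable_vec f E \<phi>" for \<phi>
    unfolding fun_of_op_expectation[OF san sfon assms(7) C] fun_of_op_expectation[OF sa sfo assms(8) C]
    by (intro tendsto_of_real f_lim that)
  have part2: "(\<lambda>n. cinner \<psi> (op_app (fun_of_op (An n) (En n) f) \<phi>)) \<longlonglongrightarrow> cinner \<psi> (op_app (fun_of_op A E f) \<phi>)"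
    if "DS_integrable_pair f E \<psi> \<phi>" for \<psi> \<phi>
    unfolding fun_of_op_polar[OF san sfon assms(7) C] fun_of_op_polar[OF sa sfo assms(8) C] polar_def
    using that by (intro tendsto_intros f_lim) (simp_all add: DS_integrable_pair_def)
  have part3: "(\<lambda>n. op_app (fun_of_op (An n) (En n) f) \<phi>) \<longlonglongrightarrow> op_app (fun_of_op A E f) \<phi>"
    if DS: "DS_integrable_family f E" for \<phi>
  proof (rule tendsto_of_weak_and_norm)
    have vec: "DS_integrable_vec f E \<xi>" for \<xi> using DS by (simp add: DS_integrable_family_def)
    show "(\<lambda>n. cinner \<psi> (op_app (fun_of_op (An n) (En n) f) \<phi>)) \<longlonglongrightarrow> cinner \<psi> (op_app (fun_of_op A E f) \<phi>)" for \<psi>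
      by (rule part2) (simp add: DS_integrable_pair_def vec)
    show "(\<lambda>n. (norm (op_app (fun_of_op (An n) (En n) f) \<phi>))\<^sup>2) \<longlonglongrightarrow> (norm (op_app (fun_of_op A E f) \<phi>))\<^sup>2"
      unfolding fun_of_op_norm_sq[OF san sfon assms(7) C] fun_of_op_norm_sq[OF sa sfo assms(8) C]
    proof (rule integral_lim[where D="C\<^sup>2"])
      show "\<forall>t. \<bar>(f t)\<^sup>2\<bar> \<le> C\<^sup>2" using power_mono[OF C abs_ge_zero, of _ 2] by simp
      show "AE t in smeas E \<phi>. isCont (\<lambda>t. (f t)\<^sup>2) t"
        using AE_cont[OF vec[of \<phi>]] by eventually_elim (rule isCont_power)
    qed (use assms(7,8) in \<open>auto simp: spectral_measurable_def intro!: borel_measurable_power\<close>)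
  qed
  show ?thesis using part1 part2 part3 by blast
qed

end
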